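(* $\mathsf{RCA}_0 \vdash \mathsf{SRRT}^2_2 \rightarrow \mathsf{DNR}$.
   Context: $\mathsf{RCA}_0$ is the usual base system of reverse mathematics (second-order arithmetic with $\Delta^0_1$-comprehension and $\Sigma^0_1$-induction). $f:[\mathbb{N}]^2\to\mathbb{N}$ (defined on pairs $x<s$) is 2-bounded if $|f^{-1}(y)|\le2$ for every $y$. It is rainbow-stable if for every $x$ one of the following holds: (a) there is $y\neq x$ with $f(x,s)=f(y,s)$ for all but finitely many $s$; or (b) for all but finitely many $s$ there is no $y\ne x$ with $f(x,s)=f(y,s)$. A set $R$ is a rainbow for $f$ if $f$ is injective on $[R]^2$. $\mathsf{SRRT}^2_2$ is the statement "every rainbow-stable 2-bounded coloring $f:[\mathbb{N}]^2\to\mathbb{N}$ has an infinite rainbow". A function $f:\mathbb{N}\to\mathbb{N}$ is diagonally non-computable relative to $X$ if $f(e)\neq\Phi^X_e(e)$ for every $e$ (vacuously when $\Phi^X_e(e)$ diverges). $\mathsf{DNR}$ is the statement "for every set $X$ there is a function diagonally non-computable relative to $X$". *)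

theory Defs
  imports Main
begin

section \<open>The language of second-order arithmetic\<close>

text \<open>Number variables and set variables are de Bruijn indices, counted separately:
  \<open>AllN\<close> binds number variable 0 and \<open>AllS\<close> binds set variable 0.
  Equality is primitive for numbers only.\<close>

datatype trm = Var nat | Zero | One | Add trm trm | Mul trm trm

datatype fm =
    Eq trm trm
  | Less trm trm
  | Mem trm nat
  | Fls
  | Imp fm fm
  | AllN fm
  | AllS fm

abbreviation Neg :: "fm \<Rightarrow> fm" where "Neg \<phi> \<equiv> Imp \<phi> Fls"
abbreviation Conj :: "fm \<Rightarrow> fm \<Rightarrow> fm" where "Conj \<phi> \<psi> \<equiv> Neg (Imp \<phi> (Neg \<psi>))"
abbreviation Disj :: "fm \<Rightarrow> fm \<Rightarrow> fm" where "Disj \<phi> \<psi> \<equiv> Imp (Neg \<phi>) \<psi>"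
abbreviation Iff :: "fm \<Rightarrow> fm \<Rightarrow> fm" where "Iff \<phi> \<psi> \<equiv> Conj (Imp \<phi> \<psi>) (Imp \<psi> \<phi>)"
abbreviation ExN :: "fm \<Rightarrow> fm" where "ExN \<phi> \<equiv> Neg (AllN (Neg \<phi>))"
abbreviation ExS :: "fm \<Rightarrow> fm" where "ExS \<phi> \<equiv> Neg (AllS (Neg \<phi>))"

primrec subst_trm :: "(nat \<Rightarrow> trm) \<Rightarrow> trm \<Rightarrow> trm" where
  "subst_trm \<sigma> (Var n) = \<sigma> n"
| "subst_trm \<sigma> Zero = Zero"
| "subst_trm \<sigma> One = One"
| "subst_trm \<sigma> (Add t u) = Add (subst_trm \<sigma> t) (subst_trm \<sigma> u)"
| "subst_trm \<sigma> (Mul t u) = Mul (subst_trm \<sigma> t) (subst_trm \<sigma> u)"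

definition lift_trm :: "trm \<Rightarrow> trm" where
  "lift_trm = subst_trm (\<lambda>n. Var (Suc n))"

text \<open>Simultaneous capture-avoiding substitution of terms for number variables and of
  set variables for set variables.\<close>

primrec subst :: "(nat \<Rightarrow> trm) \<Rightarrow> (nat \<Rightarrow> nat) \<Rightarrow> fm \<Rightarrow> fm" where
  "subst \<sigma> \<rho> (Eq t u) = Eq (subst_trm \<sigma> t) (subst_trm \<sigma> u)"
| "subst \<sigma> \<rho> (Less t u) = Less (subst_trm \<sigma> t) (subst_trm \<sigma> u)"
| "subst \<sigma> \<rho> (Mem t X) = Mem (subst_trm \<sigma> t) (\<rho> X)"
| "subst \<sigma> \<rho> Fls = Fls"
| "subst \<sigma> \<rho> (Imp \<phi> \<psi>) = Imp (subst \<sigma> \<rho> \<phi>) (subst \<sigma> \<rho> \<psi>)"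
| "subst \<sigma> \<rho> (AllN \<phi>) = AllN (subst (case_nat (Var 0) (\<lambda>n. lift_trm (\<sigma> n))) \<rho> \<phi>)"
| "subst \<sigma> \<rho> (AllS \<phi>) = AllS (subst \<sigma> (case_nat 0 (\<lambda>n. Suc (\<rho> n))) \<phi>)"

definition liftN :: "fm \<Rightarrow> fm" where "liftN = subst (\<lambda>n. Var (Suc n)) id"
definition liftS :: "fm \<Rightarrow> fm" where "liftS = subst Var Suc"
definition instN :: "trm \<Rightarrow> fm \<Rightarrow> fm" where "instN t = subst (case_nat t Var) id"
definition instS :: "nat \<Rightarrow> fm \<Rightarrow> fm" where "instS X = subst Var (case_nat X id)"


section \<open>Derivability\<close>

text \<open>A Hilbert calculus for classical two-sorted first-order logic with equality.
  Generalization applies to all theorems of \<open>T\<close>, so a formula of \<open>T\<close> with free variables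
  counts as an axiom with its universal closure.\<close>

inductive derivable :: "fm set \<Rightarrow> fm \<Rightarrow> bool" (infix \<open>\<turnstile>\<close> 20) for T where
  ax: "\<phi> \<in> T \<Longrightarrow> T \<turnstile> \<phi>"
| mp: "T \<turnstile> Imp \<phi> \<psi> \<Longrightarrow> T \<turnstile> \<phi> \<Longrightarrow> T \<turnstile> \<psi>"
| genN: "T \<turnstile> \<phi> \<Longrightarrow> T \<turnstile> AllN \<phi>"
| genS: "T \<turnstile> \<phi> \<Longrightarrow> T \<turnstile> AllS \<phi>"
| imp_K: "T \<turnstile> Imp \<phi> (Imp \<psi> \<phi>)"
| imp_S: "T \<turnstile> Imp (Imp \<phi> (Imp \<psi> \<chi>)) (Imp (Imp \<phi> \<psi>) (Imp \<phi> \<chi>))"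
| dne: "T \<turnstile> Imp (Neg (Neg \<phi>)) \<phi>"
| allN_inst: "T \<turnstile> Imp (AllN \<phi>) (instN t \<phi>)"
| allN_dist: "T \<turnstile> Imp (AllN (Imp \<phi> \<psi>)) (Imp (AllN \<phi>) (AllN \<psi>))"
| allN_vac: "T \<turnstile> Imp \<phi> (AllN (liftN \<phi>))"
| allS_inst: "T \<turnstile> Imp (AllS \<phi>) (instS X \<phi>)"
| allS_dist: "T \<turnstile> Imp (AllS (Imp \<phi> \<psi>)) (Imp (AllS \<phi>) (AllS \<psi>))"
| allS_vac: "T \<turnstile> Imp \<phi> (AllS (liftS \<phi>))"
| eq_refl: "T \<turnstile> Eq t t"
| eq_subst: "T \<turnstile> Imp (Eq t u) (Imp (instN t \<phi>) (instN u \<phi>))"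


section \<open>The axioms of \<open>RCA\<^sub>0\<close>\<close>

text \<open>In a bounded quantifier the bound does not contain the bound variable, whence the
  lifting.  The bounded existential quantifier is the dual of the universal one.\<close>

inductive Delta0 :: "fm \<Rightarrow> bool" where
  "Delta0 (Eq t u)"
| "Delta0 (Less t u)"
| "Delta0 (Mem t X)"
| "Delta0 Fls"
| "Delta0 \<phi> \<Longrightarrow> Delta0 \<psi> \<Longrightarrow> Delta0 (Imp \<phi> \<psi>)"
| "Delta0 \<phi> \<Longrightarrow> Delta0 (AllN (Imp (Less (Var 0) (lift_trm t)) \<phi>))"

definition Sigma1 :: "fm \<Rightarrow> bool" where
  "Sigma1 \<phi> \<longleftrightarrow> (\<exists>\<theta>. Delta0 \<theta> \<and> \<phi> = ExN \<theta>)"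

definition Pi1 :: "fm \<Rightarrow> bool" where
  "Pi1 \<phi> \<longleftrightarrow> (\<exists>\<theta>. Delta0 \<theta> \<and> \<phi> = AllN \<theta>)"

definition basic_axioms :: "fm set" where
  "basic_axioms = (let m = Var 0; n = Var 1 in
    { Neg (Eq (Add n One) Zero),
      Imp (Eq (Add m One) (Add n One)) (Eq m n),
      Eq (Add m Zero) m,
      Eq (Add m (Add n One)) (Add (Add m n) One),
      Eq (Mul m Zero) Zero,
      Eq (Mul m (Add n One)) (Add (Mul m n) m),
      Neg (Less m Zero),
      Iff (Less m (Add n One)) (Disj (Less m n) (Eq m n)) })"

text \<open>Induction on number variable 0; all other variables of \<open>\<phi>\<close> are parameters.\<close>

definition induction_axiom :: "fm \<Rightarrow> fm" where
  "induction_axiom \<phi> =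
    Imp (Conj (instN Zero \<phi>)
              (AllN (Imp \<phi> (subst (case_nat (Add (Var 0) One) (\<lambda>n. Var (Suc n))) id \<phi>))))
        (AllN \<phi>)"

text \<open>The universal closure of \<open>\<forall>n (\<phi>(n) \<leftrightarrow> \<psi>(n)) \<longrightarrow> \<exists>X \<forall>n (n \<in> X \<leftrightarrow> \<phi>(n))\<close>, where \<open>n\<close> is
  number variable 0 and \<open>X\<close> is not free in \<open>\<phi>\<close>.\<close>

definition comprehension_axiom :: "fm \<Rightarrow> fm \<Rightarrow> fm" where
  "comprehension_axiom \<phi> \<psi> =
    Imp (AllN (Iff \<phi> \<psi>)) (ExS (AllN (Iff (Mem (Var 0) 0) (liftS \<phi>))))"

definition RCA0 :: "fm set" where
  "RCA0 = basic_axioms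
    \<union> {induction_axiom \<phi> | \<phi>. Sigma1 \<phi>}
    \<union> {comprehension_axiom \<phi> \<psi> | \<phi> \<psi>. Sigma1 \<phi> \<and> Pi1 \<psi>}"


section \<open>Writing formulas with bound variable names\<close>

text \<open>A scheme assigns to the number \<open>d\<close> of enclosing number quantifiers and the number \<open>k\<close>
  of enclosing set quantifiers the de Bruijn formula it denotes there.  The variable bound at
  depth \<open>d\<close> is represented by \<open>\<lambda>d'. Var (d' - Suc d)\<close>, its index at each depth \<open>d' > d\<close>.
  A closed formula is obtained at depth \<open>0\<close>, \<open>0\<close>.\<close>

type_synonym nterm = "nat \<Rightarrow> trm"
type_synonym sterm = "nat \<Rightarrow> nat"
type_synonym scheme = "nat \<Rightarrow> nat \<Rightarrow> fm"

definition add_s :: "nterm \<Rightarrow> nterm \<Rightarrow> nterm" (infixl \<open>\<^bold>+\<close> 65) where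
  "t \<^bold>+ u = (\<lambda>d. Add (t d) (u d))"
definition mul_s :: "nterm \<Rightarrow> nterm \<Rightarrow> nterm" (infixl \<open>\<^bold>*\<close> 70) where
  "t \<^bold>* u = (\<lambda>d. Mul (t d) (u d))"

primrec numeral_s :: "nat \<Rightarrow> nterm" (\<open>\<^bold>#_\<close> [100] 100) where
  "\<^bold>#0 = (\<lambda>d. Zero)"
| "\<^bold>#(Suc n) = \<^bold>#n \<^bold>+ (\<lambda>d. One)"

definition suc_s :: "nterm \<Rightarrow> nterm" where
  "suc_s t = t \<^bold>+ (\<lambda>d. One)"

definition eq_s :: "nterm \<Rightarrow> nterm \<Rightarrow> scheme" (infix \<open>\<^bold>=\<close> 50) where
  "(t \<^bold>= u) = (\<lambda>d k. Eq (t d) (u d))"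
definition less_s :: "nterm \<Rightarrow> nterm \<Rightarrow> scheme" (infix \<open>\<^bold><\<close> 50) where
  "(t \<^bold>< u) = (\<lambda>d k. Less (t d) (u d))"
definition mem_s :: "nterm \<Rightarrow> sterm \<Rightarrow> scheme" (infix \<open>\<^bold>\<in>\<close> 50) where
  "(t \<^bold>\<in> X) = (\<lambda>d k. Mem (t d) (X k))"
definition neg_s :: "scheme \<Rightarrow> scheme" (\<open>\<^bold>\<not>_\<close> [40] 40) where
  "(\<^bold>\<not>F) = (\<lambda>d k. Neg (F d k))"
definition conj_s :: "scheme \<Rightarrow> scheme \<Rightarrow> scheme" (infixr \<open>\<^bold>\<and>\<close> 35) where
  "(F \<^bold>\<and> G) = (\<lambda>d k. Conj (F d k) (G d k))"
definition disj_s :: "scheme \<Rightarrow> scheme \<Rightarrow> scheme" (infixr \<open>\<^bold>\<or>\<close> 30) where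
  "(F \<^bold>\<or> G) = (\<lambda>d k. Disj (F d k) (G d k))"
definition imp_s :: "scheme \<Rightarrow> scheme \<Rightarrow> scheme" (infixr \<open>\<^bold>\<longrightarrow>\<close> 25) where
  "(F \<^bold>\<longrightarrow> G) = (\<lambda>d k. Imp (F d k) (G d k))"

definition allN_s :: "(nterm \<Rightarrow> scheme) \<Rightarrow> scheme" (binder \<open>\<^bold>\<forall>\<close> 10) where
  "allN_s F = (\<lambda>d k. AllN (F (\<lambda>d'. Var (d' - Suc d)) (Suc d) k))"
definition exN_s :: "(nterm \<Rightarrow> scheme) \<Rightarrow> scheme" (binder \<open>\<^bold>\<exists>\<close> 10) where
  "exN_s F = (\<lambda>d k. ExN (F (\<lambda>d'. Var (d' - Suc d)) (Suc d) k))"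
definition allS_s :: "(sterm \<Rightarrow> scheme) \<Rightarrow> scheme" (binder \<open>\<^bold>\<forall>\<^sub>S\<close> 10) where
  "allS_s F = (\<lambda>d k. AllS (F (\<lambda>k'. k' - Suc k) d (Suc k)))"
definition exS_s :: "(sterm \<Rightarrow> scheme) \<Rightarrow> scheme" (binder \<open>\<^bold>\<exists>\<^sub>S\<close> 10) where
  "exS_s F = (\<lambda>d k. ExS (F (\<lambda>k'. k' - Suc k) d (Suc k)))"

definition all_below :: "nterm \<Rightarrow> (nterm \<Rightarrow> scheme) \<Rightarrow> scheme" where
  "all_below t F = (\<^bold>\<forall>x. x \<^bold>< t \<^bold>\<longrightarrow> F x)"
definition ex_below :: "nterm \<Rightarrow> (nterm \<Rightarrow> scheme) \<Rightarrow> scheme" where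
  "ex_below t F = (\<^bold>\<not> all_below t (\<lambda>x. \<^bold>\<not> F x))"


section \<open>Colorings of pairs\<close>

text \<open>The injective pairing \<open>(x + y)\<^sup>2 + x\<close> customary in second-order arithmetic; it is not
  surjective.\<close>

definition pair_s :: "nterm \<Rightarrow> nterm \<Rightarrow> nterm" (\<open>\<langle>_,/ _\<rangle>\<close>) where
  "\<langle>x, y\<rangle> = (x \<^bold>+ y) \<^bold>* (x \<^bold>+ y) \<^bold>+ x"

text \<open>\<open>F\<close> is (the graph of) a function from \<open>[\<nat>]\<^sup>2\<close> to \<open>\<nat>\<close>, where \<open>[\<nat>]\<^sup>2\<close> is the set of pairs
  \<open>\<langle>x, s\<rangle>\<close> with \<open>x < s\<close>.\<close>

definition coloring :: "sterm \<Rightarrow> scheme" where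
  "coloring F =
    ((\<^bold>\<forall>w. w \<^bold>\<in> F \<^bold>\<longrightarrow> (\<^bold>\<exists>x s z. x \<^bold>< s \<^bold>\<and> w \<^bold>= \<langle>\<langle>x, s\<rangle>, z\<rangle>)) \<^bold>\<and>
     (\<^bold>\<forall>x s. x \<^bold>< s \<^bold>\<longrightarrow> (\<^bold>\<exists>z. \<langle>\<langle>x, s\<rangle>, z\<rangle> \<^bold>\<in> F)) \<^bold>\<and>
     (\<^bold>\<forall>p z z'. \<langle>p, z\<rangle> \<^bold>\<in> F \<^bold>\<and> \<langle>p, z'\<rangle> \<^bold>\<in> F \<^bold>\<longrightarrow> z \<^bold>= z'))"

definition two_bounded :: "sterm \<Rightarrow> scheme" where
  "two_bounded F =
    (\<^bold>\<forall>z p q r. \<langle>p, z\<rangle> \<^bold>\<in> F \<^bold>\<and> \<langle>q, z\<rangle> \<^bold>\<in> F \<^bold>\<and> \<langle>r, z\<rangle> \<^bold>\<in> F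
       \<^bold>\<longrightarrow> p \<^bold>= q \<^bold>\<or> p \<^bold>= r \<^bold>\<or> q \<^bold>= r)"

text \<open>\<open>x, y < s\<close> and \<open>F\<close> gives the pairs \<open>(x, s)\<close> and \<open>(y, s)\<close> the same color.\<close>

definition same_color :: "sterm \<Rightarrow> nterm \<Rightarrow> nterm \<Rightarrow> nterm \<Rightarrow> scheme" where
  "same_color F x y s = (\<^bold>\<exists>z. \<langle>\<langle>x, s\<rangle>, z\<rangle> \<^bold>\<in> F \<^bold>\<and> \<langle>\<langle>y, s\<rangle>, z\<rangle> \<^bold>\<in> F)"

text \<open>A property holds for all but finitely many \<open>s\<close> iff it holds for all \<open>s\<close> above some \<open>t\<close>.\<close>

definition almost_all :: "(nterm \<Rightarrow> scheme) \<Rightarrow> scheme" where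
  "almost_all P = (\<^bold>\<exists>t. \<^bold>\<forall>s. t \<^bold>< s \<^bold>\<longrightarrow> P s)"

definition rainbow_stable :: "sterm \<Rightarrow> scheme" where
  "rainbow_stable F =
    (\<^bold>\<forall>x. (\<^bold>\<exists>y. \<^bold>\<not> (y \<^bold>= x) \<^bold>\<and> almost_all (\<lambda>s. same_color F x y s)) \<^bold>\<or>
         almost_all (\<lambda>s. \<^bold>\<not> (\<^bold>\<exists>y. \<^bold>\<not> (y \<^bold>= x) \<^bold>\<and> same_color F x y s)))"

definition infinite_set :: "sterm \<Rightarrow> scheme" where
  "infinite_set R = (\<^bold>\<forall>x. \<^bold>\<exists>y. x \<^bold>< y \<^bold>\<and> y \<^bold>\<in> R)"

definition rainbow :: "sterm \<Rightarrow> sterm \<Rightarrow> scheme" where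
  "rainbow F R =
    (\<^bold>\<forall>x s y t z. x \<^bold>\<in> R \<^bold>\<and> s \<^bold>\<in> R \<^bold>\<and> x \<^bold>< s \<^bold>\<and> y \<^bold>\<in> R \<^bold>\<and> t \<^bold>\<in> R \<^bold>\<and> y \<^bold>< t \<^bold>\<and>
       \<langle>\<langle>x, s\<rangle>, z\<rangle> \<^bold>\<in> F \<^bold>\<and> \<langle>\<langle>y, t\<rangle>, z\<rangle> \<^bold>\<in> F \<^bold>\<longrightarrow> x \<^bold>= y \<^bold>\<and> s \<^bold>= t)"

definition SRRT22 :: fm where
  "SRRT22 =
    (\<^bold>\<forall>\<^sub>S F. coloring F \<^bold>\<and> two_bounded F \<^bold>\<and> rainbow_stable F
       \<^bold>\<longrightarrow> (\<^bold>\<exists>\<^sub>S R. infinite_set R \<^bold>\<and> rainbow F R)) 0 0"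


section \<open>Computation relative to an oracle\<close>

text \<open>The entry with index \<open>i\<close> of the sequence coded by \<open>a, b\<close> through Goedel's beta function,
  the remainder of \<open>a\<close> modulo \<open>1 + (i + 1) b\<close>, is \<open>z\<close>.\<close>

definition beta :: "nterm \<Rightarrow> nterm \<Rightarrow> nterm \<Rightarrow> nterm \<Rightarrow> scheme" where
  "beta a b i z =
    (z \<^bold>< suc_s (suc_s i \<^bold>* b) \<^bold>\<and>
     ex_below (suc_s a) (\<lambda>q. a \<^bold>= q \<^bold>* suc_s (suc_s i \<^bold>* b) \<^bold>+ z))"

text \<open>Indices denote unary partial functions, built as follows from the oracle \<open>X\<close>; functions of
  several arguments are coded through pairing.

  \<^item> \<open>\<langle>0,0\<rangle>\<close>, \<open>\<langle>1,0\<rangle>\<close>, \<open>\<langle>2,0\<rangle>\<close>: constant zero, identity, successor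
  \<^item> \<open>\<langle>3,0\<rangle>\<close>, \<open>\<langle>4,0\<rangle>\<close>: the two projections of a pair, undefined on non-pairs
  \<^item> \<open>\<langle>5,0\<rangle>\<close>: the characteristic function of \<open>X\<close>
  \<^item> \<open>\<langle>6,\<langle>f,g\<rangle>\<rangle>\<close>: the function \<open>x \<mapsto> \<langle>f x, g x\<rangle>\<close>
  \<^item> \<open>\<langle>7,\<langle>f,g\<rangle>\<rangle>\<close>: the composition \<open>x \<mapsto> f (g x)\<close>
  \<^item> \<open>\<langle>8,\<langle>f,g\<rangle>\<rangle>\<close>: primitive recursion, \<open>h \<langle>p,0\<rangle> = f p\<close> and \<open>h \<langle>p,m+1\<rangle> = g \<langle>p,\<langle>m, h \<langle>p,m\<rangle>\<rangle>\<rangle>\<close>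
  \<^item> \<open>\<langle>9,f\<rangle>\<close>: unbounded search, \<open>\<langle>p,m\<rangle> \<mapsto>\<close> the least \<open>y \<ge> m\<close> with \<open>f \<langle>p,y\<rangle> = 0\<close>

  All other numbers are indices of the nowhere defined function.

  The scheme \<open>step X D a c x y\<close> says that the value of the function with index \<open>c\<close> at \<open>x\<close> is \<open>y\<close>
  by one of these clauses, given the values recorded in \<open>D\<close>; the number \<open>a\<close> bounds all
  auxiliary quantities.\<close>

definition step ::
  "sterm \<Rightarrow> (nterm \<Rightarrow> nterm \<Rightarrow> nterm \<Rightarrow> scheme) \<Rightarrow> nterm \<Rightarrow> nterm \<Rightarrow> nterm \<Rightarrow> nterm \<Rightarrow> scheme" where
  "step X D a c x y = (let E = ex_below (suc_s a) in
      (c \<^bold>= \<langle>\<^bold>#0, \<^bold>#0\<rangle> \<^bold>\<and> y \<^bold>= \<^bold>#0)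
    \<^bold>\<or> (c \<^bold>= \<langle>\<^bold>#1, \<^bold>#0\<rangle> \<^bold>\<and> y \<^bold>= x)
    \<^bold>\<or> (c \<^bold>= \<langle>\<^bold>#2, \<^bold>#0\<rangle> \<^bold>\<and> y \<^bold>= suc_s x)
    \<^bold>\<or> (c \<^bold>= \<langle>\<^bold>#3, \<^bold>#0\<rangle> \<^bold>\<and> E (\<lambda>v. x \<^bold>= \<langle>y, v\<rangle>))
    \<^bold>\<or> (c \<^bold>= \<langle>\<^bold>#4, \<^bold>#0\<rangle> \<^bold>\<and> E (\<lambda>u. x \<^bold>= \<langle>u, y\<rangle>))
    \<^bold>\<or> (c \<^bold>= \<langle>\<^bold>#5, \<^bold>#0\<rangle> \<^bold>\<and> ((x \<^bold>\<in> X \<^bold>\<and> y \<^bold>= \<^bold>#1) \<^bold>\<or> (\<^bold>\<not> (x \<^bold>\<in> X) \<^bold>\<and> y \<^bold>= \<^bold>#0)))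
    \<^bold>\<or> E (\<lambda>f. E (\<lambda>g. E (\<lambda>u. E (\<lambda>v.
        c \<^bold>= \<langle>\<^bold>#6, \<langle>f, g\<rangle>\<rangle> \<^bold>\<and> y \<^bold>= \<langle>u, v\<rangle> \<^bold>\<and> D f x u \<^bold>\<and> D g x v))))
    \<^bold>\<or> E (\<lambda>f. E (\<lambda>g. E (\<lambda>u.
        c \<^bold>= \<langle>\<^bold>#7, \<langle>f, g\<rangle>\<rangle> \<^bold>\<and> D g x u \<^bold>\<and> D f u y)))
    \<^bold>\<or> E (\<lambda>f. E (\<lambda>g. E (\<lambda>p.
        c \<^bold>= \<langle>\<^bold>#8, \<langle>f, g\<rangle>\<rangle> \<^bold>\<and> x \<^bold>= \<langle>p, \<^bold>#0\<rangle> \<^bold>\<and> D f p y)))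
    \<^bold>\<or> E (\<lambda>f. E (\<lambda>g. E (\<lambda>p. E (\<lambda>m. E (\<lambda>u.
        c \<^bold>= \<langle>\<^bold>#8, \<langle>f, g\<rangle>\<rangle> \<^bold>\<and> x \<^bold>= \<langle>p, suc_s m\<rangle> \<^bold>\<and> D c \<langle>p, m\<rangle> u \<^bold>\<and> D g \<langle>p, \<langle>m, u\<rangle>\<rangle> y)))))
    \<^bold>\<or> E (\<lambda>f. E (\<lambda>p.
        c \<^bold>= \<langle>\<^bold>#9, f\<rangle> \<^bold>\<and> x \<^bold>= \<langle>p, y\<rangle> \<^bold>\<and> D f x (\<^bold>#0)))
    \<^bold>\<or> E (\<lambda>f. E (\<lambda>p. E (\<lambda>m. E (\<lambda>u.
        c \<^bold>= \<langle>\<^bold>#9, f\<rangle> \<^bold>\<and> x \<^bold>= \<langle>p, m\<rangle> \<^bold>\<and> D f x (suc_s u) \<^bold>\<and> D c \<langle>p, suc_s m\<rangle> y)))))"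

text \<open>\<open>\<Phi>\<^sup>X\<^sub>e(x)\<close> converges to \<open>y\<close>: some coded sequence of triples \<open>\<langle>c,\<langle>u,v\<rangle>\<rangle>\<close>, each of which
  follows from earlier ones by a computation step, ends in \<open>\<langle>e,\<langle>x,y\<rangle>\<rangle>\<close>.\<close>

definition Phi :: "sterm \<Rightarrow> nterm \<Rightarrow> nterm \<Rightarrow> nterm \<Rightarrow> scheme" where
  "Phi X e x y =
    (\<^bold>\<exists>a b n. beta a b n \<langle>e, \<langle>x, y\<rangle>\<rangle> \<^bold>\<and>
      all_below (suc_s n) (\<lambda>i.
        ex_below (suc_s a) (\<lambda>c. ex_below (suc_s a) (\<lambda>u. ex_below (suc_s a) (\<lambda>v.
          beta a b i \<langle>c, \<langle>u, v\<rangle>\<rangle> \<^bold>\<and>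
          step X (\<lambda>c' u' v'. ex_below i (\<lambda>j. beta a b j \<langle>c', \<langle>u', v'\<rangle>\<rangle>)) a c u v)))))"

definition total_function :: "sterm \<Rightarrow> scheme" where
  "total_function G =
    ((\<^bold>\<forall>w. w \<^bold>\<in> G \<^bold>\<longrightarrow> (\<^bold>\<exists>x y. w \<^bold>= \<langle>x, y\<rangle>)) \<^bold>\<and>
     (\<^bold>\<forall>x. \<^bold>\<exists>y. \<langle>x, y\<rangle> \<^bold>\<in> G) \<^bold>\<and>
     (\<^bold>\<forall>x y y'. \<langle>x, y\<rangle> \<^bold>\<in> G \<^bold>\<and> \<langle>x, y'\<rangle> \<^bold>\<in> G \<^bold>\<longrightarrow> y \<^bold>= y'))"

definition diagonally_noncomputable :: "sterm \<Rightarrow> sterm \<Rightarrow> scheme" where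
  "diagonally_noncomputable X G = (\<^bold>\<forall>e y. \<langle>e, y\<rangle> \<^bold>\<in> G \<^bold>\<longrightarrow> \<^bold>\<not> Phi X e e y)"

definition DNR :: fm where
  "DNR = (\<^bold>\<forall>\<^sub>S X. \<^bold>\<exists>\<^sub>S G. total_function G \<^bold>\<and> diagonally_noncomputable X G) 0 0"

end

theory Submission
  imports Defs "HOL-Library.Countable_Set"
begin

text \<open>By the completeness theorem it suffices to argue in a model of \<open>RCA\<^sub>0\<close>, whose number part may be
  nonstandard; there \<open>\<Sigma>\<^sub>1\<close> induction and \<open>\<Delta>\<^sub>1\<close> comprehension are available for predicates definable
  with parameters.

  Given \<open>X\<close>, regard a value \<open>\<Phi>\<^sup>X\<^sub>e(e)\<close> as the code of an increasing list of \<open>2 sz e\<close> numbers \<open>\<ge> e\<close>,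
  split into \<open>sz e\<close> consecutive pairs.  Once this computation has converged, \<open>e\<close> claims at every later
  stage \<open>s\<close> the first of these pairs that avoids all lists found by stage \<open>s\<close> at arguments below \<open>e\<close>, and
  the members \<open>u < v\<close> of the claimed pair are made to satisfy \<open>f(u, s) = f(v, s)\<close>; all other colors are
  distinct.  As claimed pairs are disjoint, \<open>f\<close> is 2-bounded, and since \<open>x\<close> is listed only by
  \<open>e \<le> x\<close>, it is rainbow-stable.  The number \<open>sz e\<close> is so large that, by the pigeonhole principle, the
  lists at arguments below \<open>e\<close> cannot meet every pair of the list at \<open>e\<close>.

  Let \<open>R\<close> be an infinite rainbow and let \<open>G(e)\<close> be the least code of such a list with all entries in
  \<open>R\<close>.  If \<open>G(e) = \<Phi>\<^sup>X\<^sub>e(e)\<close>, then at every large stage \<open>s \<in> R\<close> two elements of \<open>R\<close> are claimed by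
  \<open>e\<close>, and the colors of their pairs with \<open>s\<close> agree, contradicting that \<open>R\<close> is a rainbow.\<close>

section \<open>Substitution\<close>

text \<open>The object calculus is a bare Hilbert system, so no formal derivation is ever displayed;
  its existence follows from truth in all countable models. In exchange, every induction,
  minimization and set formation inside a model must be backed by a formula of the permitted class.
  Only \<open>\<Sigma>\<^sub>1\<close> induction is at hand, and this shapes the combinatorics:
  limits over stages are obtained as extrema of single \<open>\<Sigma>\<^sub>1\<close> sets, such as
  the indices that ever list \<open>x\<close>, or the bounded set of positions that one index ever
  claims.

  A whole list rather than one pair is guessed because smaller indices have priority and may spoil a
  pair whenever their computations happen to converge. An index below \<open>e\<close> has at most
  one guess, whose entries are addressed by their positions. Hence the possible spoilers are bounded
  in advance, uniformly in all computations, and \<open>sz e\<close> is chosen just above that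
  bound.\<close>

abbreviation up :: "(nat \<Rightarrow> trm) \<Rightarrow> nat \<Rightarrow> trm" where
  "up \<sigma> \<equiv> case_nat (Var 0) (\<lambda>n. lift_trm (\<sigma> n))"

abbreviation upS :: "(nat \<Rightarrow> nat) \<Rightarrow> nat \<Rightarrow> nat" where
  "upS \<rho> \<equiv> case_nat 0 (\<lambda>n. Suc (\<rho> n))"

lemma subst_trm_Var [simp]: "subst_trm Var t = t"
  by (induction t) auto

lemma subst_trm_subst_trm: "subst_trm \<sigma> (subst_trm \<tau> t) = subst_trm (\<lambda>n. subst_trm \<sigma> (\<tau> n)) t"
  by (induction t) auto

lemma lift_trm_Var [simp]: "lift_trm (Var n) = Var (Suc n)"
  by (simp add: lift_trm_def)

lemma subst_trm_Var_Suc: "subst_trm (\<lambda>n. Var (Suc n)) t = lift_trm t"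
  by (simp add: lift_trm_def)

lemma subst_trm_lift_trm: "subst_trm \<sigma> (lift_trm t) = subst_trm (\<lambda>n. \<sigma> (Suc n)) t"
  by (simp add: lift_trm_def subst_trm_subst_trm)

lemma lift_trm_subst_trm: "lift_trm (subst_trm \<sigma> t) = subst_trm (\<lambda>n. lift_trm (\<sigma> n)) t"
  by (simp add: lift_trm_def subst_trm_subst_trm)

lemma up_Var [simp]: "case_nat (Var 0) (\<lambda>n. Var (Suc n)) = Var"
  by (auto split: nat.split)

lemma upS_id [simp]: "case_nat 0 Suc = (\<lambda>n. n)"
  by (auto split: nat.split)

lemma subst_Var [simp]: "subst Var id \<phi> = \<phi>"
  by (induction \<phi>) (auto simp: id_def)

lemma subst_subst:
  "subst \<sigma> \<rho> (subst \<tau> \<pi> \<phi>) = subst (\<lambda>n. subst_trm \<sigma> (\<tau> n)) (\<lambda>n. \<rho> (\<pi> n)) \<phi>"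
proof (induction \<phi> arbitrary: \<sigma> \<rho> \<tau> \<pi>)
  case (AllN \<phi>)
  have "(\<lambda>n. subst_trm (up \<sigma>) (up \<tau> n)) = up (\<lambda>n. subst_trm \<sigma> (\<tau> n))"
    by (auto split: nat.split simp: subst_trm_lift_trm lift_trm_subst_trm)
  then show ?case by (simp add: AllN)
next
  case (AllS \<phi>)
  have "(\<lambda>n. upS \<rho> (upS \<pi> n)) = upS (\<lambda>n. \<rho> (\<pi> n))"
    by (auto split: nat.split)
  then show ?case by (simp add: AllS)
qed (auto simp: subst_trm_subst_trm)

lemma subst_instN: "subst \<sigma> \<rho> (instN t \<phi>) = instN (subst_trm \<sigma> t) (subst (up \<sigma>) \<rho> \<phi>)"
  unfolding instN_def subst_subst
  by (rule arg_cong3[where f = subst]) (auto split: nat.split simp: subst_trm_lift_trm)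

lemma subst_liftN: "subst (up \<sigma>) \<rho> (liftN \<phi>) = liftN (subst \<sigma> \<rho> \<phi>)"
  unfolding liftN_def subst_subst
  by (rule arg_cong3[where f = subst]) (auto simp: lift_trm_def)

lemma subst_instS: "subst \<sigma> \<rho> (instS X \<phi>) = instS (\<rho> X) (subst \<sigma> (upS \<rho>) \<phi>)"
  unfolding instS_def subst_subst
  by (rule arg_cong3[where f = subst]) (auto split: nat.split)

lemma subst_liftS: "subst \<sigma> (upS \<rho>) (liftS \<phi>) = liftS (subst \<sigma> \<rho> \<phi>)"
  unfolding liftS_def subst_subst
  by (rule arg_cong3[where f = subst]) auto

lemma subst_instN_up: "instN t (subst (up \<sigma>) \<rho> \<phi>) = subst (case_nat t \<sigma>) \<rho> \<phi>"
  unfolding instN_def subst_subst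
  by (rule arg_cong3[where f = subst]) (auto split: nat.split simp: subst_trm_lift_trm)

lemma subst_instS_up: "instS X (subst \<sigma> (upS \<rho>) \<phi>) = subst \<sigma> (case_nat X \<rho>) \<phi>"
  unfolding instS_def subst_subst
  by (rule arg_cong3[where f = subst]) (auto split: nat.split)

text \<open>Instances need only be derivable, not axioms again: the basic axioms are single formulas
  in variables 0 and 1, and their instances arise by generalizing and instantiating.\<close>

definition substitutive :: "fm set \<Rightarrow> bool" where
  "substitutive T \<longleftrightarrow> (\<forall>\<phi>\<in>T. \<forall>\<sigma> \<rho>. T \<turnstile> subst \<sigma> \<rho> \<phi>)"

lemma derivable_subst:
  assumes "substitutive T" "T \<turnstile> \<phi>"
  shows "T \<turnstile> subst \<sigma> \<rho> \<phi>"
  using assms(2)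
proof (induction arbitrary: \<sigma> \<rho>)
  case (ax \<phi>)
  then show ?case using assms(1) by (simp add: substitutive_def)
next
  case (mp \<phi> \<psi>)
  from mp.IH(1)[of \<sigma> \<rho>] mp.IH(2)[of \<sigma> \<rho>] show ?case by (auto intro: derivable.mp)
qed (simp_all add: subst_instN subst_instS subst_liftN subst_liftS derivable.intros(3-))

subsection \<open>Fresh variables\<close>

text \<open>Freshness is insensitivity of substitution, the form in which
  \<open>ded_AllN_fresh\<close> uses it; no free-variable function has to be carried through
  binders.\<close>

definition freshN :: "nat \<Rightarrow> fm \<Rightarrow> bool" where
  "freshN v \<phi> \<longleftrightarrow> (\<forall>\<sigma> \<sigma>' \<rho>. (\<forall>n. n \<noteq> v \<longrightarrow> \<sigma> n = \<sigma>' n) \<longrightarrow> subst \<sigma> \<rho> \<phi> = subst \<sigma>' \<rho> \<phi>)"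

definition freshS :: "nat \<Rightarrow> fm \<Rightarrow> bool" where
  "freshS v \<phi> \<longleftrightarrow> (\<forall>\<sigma> \<rho> \<rho>'. (\<forall>n. n \<noteq> v \<longrightarrow> \<rho> n = \<rho>' n) \<longrightarrow> subst \<sigma> \<rho> \<phi> = subst \<sigma> \<rho>' \<phi>)"

primrec var_bound_trm :: "trm \<Rightarrow> nat" where
  "var_bound_trm (Var n) = Suc n"
| "var_bound_trm Zero = 0"
| "var_bound_trm One = 0"
| "var_bound_trm (Add t u) = max (var_bound_trm t) (var_bound_trm u)"
| "var_bound_trm (Mul t u) = max (var_bound_trm t) (var_bound_trm u)"

text \<open>A coarse bound, not lowered under binders and mixing both sorts. Every number from it on
  is fresh in both senses, which is all that \<open>ex_fresh\<close> asks for.\<close>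

primrec var_bound :: "fm \<Rightarrow> nat" where
  "var_bound (Eq t u) = max (var_bound_trm t) (var_bound_trm u)"
| "var_bound (Less t u) = max (var_bound_trm t) (var_bound_trm u)"
| "var_bound (Mem t X) = max (var_bound_trm t) (Suc X)"
| "var_bound Fls = 0"
| "var_bound (Imp \<phi> \<psi>) = max (var_bound \<phi>) (var_bound \<psi>)"
| "var_bound (AllN \<phi>) = var_bound \<phi>"
| "var_bound (AllS \<phi>) = var_bound \<phi>"

lemma subst_trm_cong:
  "(\<And>n. n < var_bound_trm t \<Longrightarrow> \<sigma> n = \<sigma>' n) \<Longrightarrow> subst_trm \<sigma> t = subst_trm \<sigma>' t"
  by (induction t) simp_all

lemma subst_cong:
  "(\<And>n. n < var_bound \<phi> \<Longrightarrow> \<sigma> n = \<sigma>' n) \<Longrightarrow> (\<And>n. n < var_bound \<phi> \<Longrightarrow> \<rho> n = \<rho>' n) \<Longrightarrow>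
    subst \<sigma> \<rho> \<phi> = subst \<sigma>' \<rho>' \<phi>"
proof (induction \<phi> arbitrary: \<sigma> \<sigma>' \<rho> \<rho>')
  case (AllN \<phi>)
  show ?case unfolding subst.simps
    by (intro arg_cong[where f = AllN] AllN.IH) (auto split: nat.split intro!: arg_cong[where f = lift_trm] AllN.prems[simplified])
next
  case (AllS \<phi>)
  show ?case unfolding subst.simps
    by (intro arg_cong[where f = AllS] AllS.IH) (auto split: nat.split intro: AllS.prems[simplified])
next
  case (Imp \<phi> \<psi>)
  show ?case unfolding subst.simps
    by (intro arg_cong2[where f = Imp] Imp.IH) (auto intro: Imp.prems)
qed (auto intro!: subst_trm_cong)

lemma ex_fresh:
  assumes "finite \<Gamma>"
  shows "\<exists>v. \<forall>\<gamma>\<in>\<Gamma>. freshN v \<gamma> \<and> freshS v \<gamma>"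
proof -
  have "freshN v \<phi> \<and> freshS v \<phi>" if "var_bound \<phi> \<le> v" for v \<phi>
    unfolding freshN_def freshS_def using that by (auto intro!: subst_cong)
  moreover have "\<forall>\<gamma>\<in>\<Gamma>. var_bound \<gamma> \<le> Max (insert 0 (var_bound ` \<Gamma>))"
    using assms by simp
  ultimately show ?thesis by blast
qed


section \<open>Completeness\<close>

text \<open>Hypotheses cannot be generalized: their free variables behave like constants, so the
  deduction theorem \<open>ded_Imp\<close> has no side condition and variables can later serve as
  Henkin witnesses.\<close>

inductive ded :: "fm set \<Rightarrow> fm set \<Rightarrow> fm \<Rightarrow> bool" for T \<Gamma> where
  deriv: "T \<turnstile> \<phi> \<Longrightarrow> ded T \<Gamma> \<phi>"
| hyp: "\<phi> \<in> \<Gamma> \<Longrightarrow> ded T \<Gamma> \<phi>"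
| mp: "ded T \<Gamma> (Imp \<phi> \<psi>) \<Longrightarrow> ded T \<Gamma> \<phi> \<Longrightarrow> ded T \<Gamma> \<psi>"

lemma ded_mono: "ded T \<Gamma> \<phi> \<Longrightarrow> \<Gamma> \<subseteq> \<Delta> \<Longrightarrow> ded T \<Delta> \<phi>"
  by (induction rule: ded.induct) (blast intro: ded.intros)+

lemma ded_empty: "ded T {} \<phi> \<Longrightarrow> T \<turnstile> \<phi>"
  by (induction rule: ded.induct) (auto intro: derivable.mp)

lemma derivable_imp_refl: "T \<turnstile> Imp \<phi> \<phi>"
  using imp_S[of T \<phi> "Imp \<phi> \<phi>" \<phi>] imp_K derivable.mp by blast

lemma ded_Imp: "ded T (insert \<psi> \<Gamma>) \<phi> \<Longrightarrow> ded T \<Gamma> (Imp \<psi> \<phi>)"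
proof (induction rule: ded.induct)
  case (deriv \<phi>)
  then show ?case by (meson ded.deriv derivable.mp imp_K)
next
  case (hyp \<phi>)
  then show ?case by (metis ded.hyp ded.mp ded.deriv derivable_imp_refl imp_K insertE)
next
  case (mp \<phi> \<chi>)
  then show ?case by (meson ded.mp ded.deriv imp_S)
qed

lemma ded_Neg_Neg: "ded T \<Gamma> (Neg (Neg \<phi>)) \<Longrightarrow> ded T \<Gamma> \<phi>"
  by (meson ded.mp ded.deriv dne)

lemma ded_Fls: "ded T \<Gamma> Fls \<Longrightarrow> ded T \<Gamma> \<phi>"
  by (meson ded.mp ded.deriv imp_K ded_Neg_Neg)

lemma ded_subst:
  assumes "substitutive T" "ded T \<Gamma> \<phi>"
  shows "ded T (subst \<sigma> \<rho> ` \<Gamma>) (subst \<sigma> \<rho> \<phi>)"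
  using assms(2)
proof (induction rule: ded.induct)
  case (mp \<phi> \<psi>)
  then show ?case by (auto intro: ded.mp)
qed (auto intro: ded.deriv ded.hyp derivable_subst[OF assms(1)])

text \<open>The lifted hypotheses do not mention the variable to be bound, so
  \<open>allN_vac\<close> quantifies them and \<open>allN_dist\<close> pushes the quantifier through
  each modus ponens.\<close>

lemma ded_AllN:
  assumes "ded T (liftN ` \<Gamma>) \<psi>"
  shows "ded T \<Gamma> (AllN \<psi>)"
  using assms
proof (induction rule: ded.induct)
  case (deriv \<phi>)
  then show ?case by (auto intro: ded.deriv genN)
next
  case (hyp \<phi>)
  then show ?case by (metis allN_vac ded.hyp ded.mp ded.deriv imageE)
next
  case (mp \<phi> \<psi>)
  then show ?case by (meson allN_dist ded.mp ded.deriv)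
qed

lemma ded_AllS:
  assumes "ded T (liftS ` \<Gamma>) \<psi>"
  shows "ded T \<Gamma> (AllS \<psi>)"
  using assms
proof (induction rule: ded.induct)
  case (deriv \<phi>)
  then show ?case by (auto intro: ded.deriv genS)
next
  case (hyp \<phi>)
  then show ?case by (metis allS_vac ded.hyp ded.mp ded.deriv imageE)
next
  case (mp \<phi> \<psi>)
  then show ?case by (meson allS_dist ded.mp ded.deriv)
qed

lemma ded_AllN_fresh:
  assumes T: "substitutive T" and fresh: "\<forall>\<gamma>\<in>insert (AllN \<psi>) \<Gamma>. freshN v \<gamma>"
    and ded: "ded T \<Gamma> (instN (Var v) \<psi>)"
  shows "ded T \<Gamma> (AllN \<psi>)"
proof -
  \<comment> \<open>Sending \<open>v\<close> to 0 and shifting all other variables coincides with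
    lifting on formulas in which \<open>v\<close> is fresh, and turns the instance at
    \<open>v\<close> back into the body \<open>\<psi>\<close>.\<close>
  define \<sigma> where "\<sigma> = (\<lambda>n. if n = v then Var 0 else Var (Suc n))"
  have "subst \<sigma> id \<gamma> = liftN \<gamma>" if "\<gamma> \<in> insert (AllN \<psi>) \<Gamma>" for \<gamma>
    unfolding liftN_def using bspec[OF fresh that] by (auto simp: freshN_def \<sigma>_def)
  then have lift: "subst \<sigma> id ` \<Gamma> = liftN ` \<Gamma>"
    and all: "subst \<sigma> id (AllN \<psi>) = liftN (AllN \<psi>)" by (auto simp del: subst.simps)
  from all have "subst (up \<sigma>) id \<psi> = subst (up (\<lambda>n. Var (Suc n))) id \<psi>"
    by (simp add: liftN_def)
  then have "subst \<sigma> id (instN (Var v) \<psi>) = instN (Var 0) (subst (up (\<lambda>n. Var (Suc n))) id \<psi>)"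
    by (simp add: subst_instN \<sigma>_def)
  also have "\<dots> = subst Var id \<psi>"
    unfolding subst_instN_up by (rule arg_cong3[where f = subst]) (auto split: nat.split)
  finally have "subst \<sigma> id (instN (Var v) \<psi>) = \<psi>" by simp
  with ded_subst[OF T ded, of \<sigma> id] lift show ?thesis
    by (auto intro: ded_AllN)
qed

lemma ded_AllS_fresh:
  assumes T: "substitutive T" and fresh: "\<forall>\<gamma>\<in>insert (AllS \<psi>) \<Gamma>. freshS v \<gamma>"
    and ded: "ded T \<Gamma> (instS v \<psi>)"
  shows "ded T \<Gamma> (AllS \<psi>)"
proof -
  define \<rho> where "\<rho> = (\<lambda>n. if n = v then 0 else Suc n)"
  have "subst Var \<rho> \<gamma> = liftS \<gamma>" if "\<gamma> \<in> insert (AllS \<psi>) \<Gamma>" for \<gamma>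
    unfolding liftS_def using bspec[OF fresh that] by (auto simp: freshS_def \<rho>_def)
  then have lift: "subst Var \<rho> ` \<Gamma> = liftS ` \<Gamma>"
    and all: "subst Var \<rho> (AllS \<psi>) = liftS (AllS \<psi>)" by (auto simp del: subst.simps)
  from all have "subst Var (upS \<rho>) \<psi> = subst Var (upS Suc) \<psi>"
    by (simp add: liftS_def)
  then have "subst Var \<rho> (instS v \<psi>) = instS 0 (subst Var (upS Suc) \<psi>)"
    by (simp add: subst_instS \<rho>_def)
  also have "\<dots> = subst Var id \<psi>"
    unfolding subst_instS_up by (rule arg_cong3[where f = subst]) (auto split: nat.split)
  finally have "subst Var \<rho> (instS v \<psi>) = \<psi>" by simp
  with ded_subst[OF T ded, of Var \<rho>] lift show ?thesis
    by (auto intro: ded_AllS)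
qed

subsection \<open>Maximal consistent sets with witnesses\<close>

definition consistent :: "fm set \<Rightarrow> fm set \<Rightarrow> bool" where
  "consistent T \<Gamma> \<longleftrightarrow> \<not> ded T \<Gamma> Fls"

lemma consistent_insert: "\<not> consistent T (insert \<phi> \<Gamma>) \<Longrightarrow> ded T \<Gamma> (Neg \<phi>)"
  by (auto simp: consistent_def intro: ded_Imp)

lemma consistent_insert_Neg: "\<not> consistent T (insert (Neg \<phi>) \<Gamma>) \<Longrightarrow> ded T \<Gamma> \<phi>"
  by (auto dest!: consistent_insert intro: ded_Neg_Neg)

text \<open>The last two conjuncts are the Henkin conditions: a universal formula that is not
  accepted has a rejected instance.\<close>

definition decides :: "fm set \<Rightarrow> fm \<Rightarrow> bool" where
  "decides \<Gamma> \<phi> \<longleftrightarrow> (\<phi> \<in> \<Gamma> \<or> Neg \<phi> \<in> \<Gamma>) \<and>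
    (\<forall>\<psi>. \<phi> = AllN \<psi> \<longrightarrow> \<phi> \<in> \<Gamma> \<or> (\<exists>t. Neg (instN t \<psi>) \<in> \<Gamma>)) \<and>
    (\<forall>\<psi>. \<phi> = AllS \<psi> \<longrightarrow> \<phi> \<in> \<Gamma> \<or> (\<exists>X. Neg (instS X \<psi>) \<in> \<Gamma>))"

lemma decides_mono: "decides \<Gamma> \<phi> \<Longrightarrow> \<Gamma> \<subseteq> \<Delta> \<Longrightarrow> decides \<Delta> \<phi>"
  unfolding decides_def by blast

lemma ex_decides:
  assumes T: "substitutive T" and fin: "finite \<Gamma>" and con: "consistent T \<Gamma>"
  shows "\<exists>\<Gamma>'. \<Gamma> \<subseteq> \<Gamma>' \<and> finite \<Gamma>' \<and> consistent T \<Gamma>' \<and> decides \<Gamma>' \<phi>"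
proof (cases "consistent T (insert \<phi> \<Gamma>)")
  case True
  then show ?thesis
    using fin by (intro exI[of _ "insert \<phi> \<Gamma>"]) (auto simp: decides_def)
next
  case False
  let ?\<Gamma> = "insert (Neg \<phi>) \<Gamma>"
  from False have neg: "ded T \<Gamma> (Neg \<phi>)" by (rule consistent_insert)
  have con': "consistent T ?\<Gamma>"
  proof (rule ccontr)
    assume "\<not> consistent T ?\<Gamma>"
    then have "ded T \<Gamma> \<phi>" by (rule consistent_insert_Neg)
    with neg con show False unfolding consistent_def using ded.mp by blast
  qed
  obtain v where v: "\<forall>\<gamma>\<in>insert \<phi> ?\<Gamma>. freshN v \<gamma> \<and> freshS v \<gamma>"
    using ex_fresh[of "insert \<phi> ?\<Gamma>"] fin by auto
  have nded: "\<not> ded T ?\<Gamma> \<phi>"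
    using con' ded.mp[OF ded.hyp[of "Neg \<phi>" ?\<Gamma>]] unfolding consistent_def by blast
  consider (N) \<psi> where "\<phi> = AllN \<psi>" | (S) \<psi> where "\<phi> = AllS \<psi>"
    | (other) "\<And>\<psi>. \<phi> \<noteq> AllN \<psi>" "\<And>\<psi>. \<phi> \<noteq> AllS \<psi>" by blast
  then show ?thesis
  proof cases
    case N
    have "consistent T (insert (Neg (instN (Var v) \<psi>)) ?\<Gamma>)"
    proof (rule ccontr)
      assume "\<not> ?thesis"
      then have "ded T ?\<Gamma> (instN (Var v) \<psi>)" by (rule consistent_insert_Neg)
      then have "ded T ?\<Gamma> (AllN \<psi>)" using v N by (intro ded_AllN_fresh[OF T, of \<psi> _ v]) auto
      with nded N show False by simp
    qed
    then show ?thesis using fin N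
      by (intro exI[of _ "insert (Neg (instN (Var v) \<psi>)) ?\<Gamma>"]) (auto simp: decides_def)
  next
    case S
    have "consistent T (insert (Neg (instS v \<psi>)) ?\<Gamma>)"
    proof (rule ccontr)
      assume "\<not> ?thesis"
      then have "ded T ?\<Gamma> (instS v \<psi>)" by (rule consistent_insert_Neg)
      then have "ded T ?\<Gamma> (AllS \<psi>)" using v S by (intro ded_AllS_fresh[OF T, of \<psi> _ v]) auto
      with nded S show False by simp
    qed
    then show ?thesis using fin S
      by (intro exI[of _ "insert (Neg (instS v \<psi>)) ?\<Gamma>"]) (auto simp: decides_def)
  next
    case other
    then show ?thesis using fin con'
      by (intro exI[of _ ?\<Gamma>]) (auto simp: decides_def)
  qed
qed

instance trm :: countable by countable_datatype
instance fm :: countable by countable_datatype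

lemma ded_Union_chain:
  assumes "ded T (\<Union>n. G n) \<phi>" and chain: "\<And>n. G n \<subseteq> G (Suc n)"
  shows "\<exists>n. ded T (G n) \<phi>"
  using assms(1)
proof (induction rule: ded.induct)
  case (mp \<phi> \<psi>)
  then obtain m n where "ded T (G m) (Imp \<phi> \<psi>)" "ded T (G n) \<phi>" by blast
  moreover have "G m \<subseteq> G (max m n)" "G n \<subseteq> G (max m n)"
    by (rule lift_Suc_mono_le[of G], rule chain, simp)+
  ultimately show ?case by (meson ded.mp ded_mono)
qed (auto intro: ded.deriv ded.hyp)

text \<open>Lindenbaum's construction, with formula number \<open>n\<close> settled at stage
  \<open>n\<close>. The closure properties of \<open>W\<close> are the truth conditions of the
  connectives and quantifiers, ready for the induction in the term model.\<close>

lemma ex_Henkin_set: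
  assumes T: "substitutive T" and "\<not> (T \<turnstile> \<chi>)"
  shows "\<exists>W. \<chi> \<notin> W \<and> {\<phi>. T \<turnstile> \<phi>} \<subseteq> W \<and> Fls \<notin> W \<and> (\<forall>\<phi> \<psi>. Imp \<phi> \<psi> \<in> W \<longleftrightarrow> (\<phi> \<in> W \<longrightarrow> \<psi> \<in> W)) \<and>
    (\<forall>\<psi>. AllN \<psi> \<in> W \<longleftrightarrow> (\<forall>t. instN t \<psi> \<in> W)) \<and>
    (\<forall>\<psi>. AllS \<psi> \<in> W \<longleftrightarrow> (\<forall>X. instS X \<psi> \<in> W))"
proof -
  have "consistent T {Neg \<chi>}"
    using assms(2) consistent_insert_Neg ded_empty by blast
  then have "\<exists>G. \<forall>n. (finite (G n) \<and> consistent T (G n) \<and> (n = 0 \<longrightarrow> Neg \<chi> \<in> G n)) \<and>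
      G n \<subseteq> G (Suc n) \<and> decides (G (Suc n)) (from_nat n)"
  proof (intro dependent_nat_choice)
    show "\<exists>\<Gamma>. finite \<Gamma> \<and> consistent T \<Gamma> \<and> (0 = 0 \<longrightarrow> Neg \<chi> \<in> \<Gamma>)"
      using \<open>consistent T {Neg \<chi>}\<close> by blast
  next
    fix \<Gamma> and n :: nat
    assume "finite \<Gamma> \<and> consistent T \<Gamma> \<and> (n = 0 \<longrightarrow> Neg \<chi> \<in> \<Gamma>)"
    then show "\<exists>\<Gamma>'. (finite \<Gamma>' \<and> consistent T \<Gamma>' \<and> (Suc n = 0 \<longrightarrow> Neg \<chi> \<in> \<Gamma>')) \<and>
      \<Gamma> \<subseteq> \<Gamma>' \<and> decides \<Gamma>' (from_nat n)"
      using ex_decides[OF T, of \<Gamma> "from_nat n"] by auto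
  qed
  then obtain G where G: "\<And>n. consistent T (G n)" "Neg \<chi> \<in> G 0" "\<And>n. G n \<subseteq> G (Suc n)"
    "\<And>n. decides (G (Suc n)) (from_nat n)" by auto
  define H where "H = (\<Union>n. G n)"
  define W where "W = {\<phi>. ded T H \<phi>}"
  have "Fls \<notin> W"
    using ded_Union_chain[of T G Fls] G(1,3) by (auto simp: W_def H_def consistent_def)
  moreover have thms: "\<phi> \<in> W" if "T \<turnstile> \<phi>" for \<phi>
    using that by (simp add: W_def ded.deriv)
  moreover have mp: "\<psi> \<in> W" if "Imp \<phi> \<psi> \<in> W" "\<phi> \<in> W" for \<phi> \<psi>
    using that by (auto simp: W_def intro: ded.mp)
  moreover have dec: "decides W \<phi>" for \<phi>
  proof -
    have "decides H (from_nat (to_nat \<phi>))"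
      using G(4) by (rule decides_mono) (auto simp: H_def)
    then show ?thesis by (auto intro: decides_mono ded.hyp simp: W_def)
  qed
  moreover have "Imp \<phi> \<psi> \<in> W \<longleftrightarrow> (\<phi> \<in> W \<longrightarrow> \<psi> \<in> W)" for \<phi> \<psi>
  proof
    assume "\<phi> \<in> W \<longrightarrow> \<psi> \<in> W"
    moreover have "Imp \<phi> \<psi> \<in> W" if "\<psi> \<in> W"
      using that mp thms imp_K by blast
    moreover have "Imp \<phi> \<psi> \<in> W" if "Neg \<phi> \<in> W"
    proof -
      have "ded T (insert \<phi> H) Fls"
        using that ded_mono[of T H "Neg \<phi>" "insert \<phi> H"] ded.mp[OF _ ded.hyp[of \<phi>]]
        unfolding W_def by blast
      then show ?thesis by (auto simp: W_def intro: ded_Imp ded_Fls)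
    qed
    ultimately show "Imp \<phi> \<psi> \<in> W"
      using dec[of \<phi>] by (auto simp: decides_def)
  qed (use mp in blast)
  moreover have "\<chi> \<notin> W"
    using mp[of \<chi> Fls] \<open>Fls \<notin> W\<close> G(2) by (auto simp: W_def H_def intro: ded.hyp)
  moreover have "AllN \<psi> \<in> W \<longleftrightarrow> (\<forall>t. instN t \<psi> \<in> W)" for \<psi>
    using dec[of "AllN \<psi>"] mp thms allN_inst \<open>Fls \<notin> W\<close> unfolding decides_def by blast
  moreover have "AllS \<psi> \<in> W \<longleftrightarrow> (\<forall>X. instS X \<psi> \<in> W)" for \<psi>
    using dec[of "AllS \<psi>"] mp thms allS_inst \<open>Fls \<notin> W\<close> unfolding decides_def by blast
  ultimately show ?thesis by (intro exI[of _ W]) blast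
qed

subsection \<open>Structures\<close>

text \<open>Set quantifiers range over the designated family \<open>sets_of\<close> only, the
  semantics for which the two-sorted calculus is complete.\<close>

record 'a str =
  zero_of :: 'a
  one_of :: 'a
  add_of :: "'a \<Rightarrow> 'a \<Rightarrow> 'a"
  mul_of :: "'a \<Rightarrow> 'a \<Rightarrow> 'a"
  less_of :: "'a \<Rightarrow> 'a \<Rightarrow> bool"
  sets_of :: "'a set set"

primrec val :: "'a str \<Rightarrow> (nat \<Rightarrow> 'a) \<Rightarrow> trm \<Rightarrow> 'a" where
  "val M \<sigma> (Var n) = \<sigma> n"
| "val M \<sigma> Zero = zero_of M"
| "val M \<sigma> One = one_of M"
| "val M \<sigma> (Add t u) = add_of M (val M \<sigma> t) (val M \<sigma> u)"
| "val M \<sigma> (Mul t u) = mul_of M (val M \<sigma> t) (val M \<sigma> u)"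

primrec sat :: "'a str \<Rightarrow> (nat \<Rightarrow> 'a) \<Rightarrow> (nat \<Rightarrow> 'a set) \<Rightarrow> fm \<Rightarrow> bool" where
  "sat M \<sigma> \<rho> (Eq t u) \<longleftrightarrow> val M \<sigma> t = val M \<sigma> u"
| "sat M \<sigma> \<rho> (Less t u) \<longleftrightarrow> less_of M (val M \<sigma> t) (val M \<sigma> u)"
| "sat M \<sigma> \<rho> (Mem t X) \<longleftrightarrow> val M \<sigma> t \<in> \<rho> X"
| "sat M \<sigma> \<rho> Fls \<longleftrightarrow> False"
| "sat M \<sigma> \<rho> (Imp \<phi> \<psi>) \<longleftrightarrow> (sat M \<sigma> \<rho> \<phi> \<longrightarrow> sat M \<sigma> \<rho> \<psi>)"
| "sat M \<sigma> \<rho> (AllN \<phi>) \<longleftrightarrow> (\<forall>x. sat M (case_nat x \<sigma>) \<rho> \<phi>)"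
| "sat M \<sigma> \<rho> (AllS \<phi>) \<longleftrightarrow> (\<forall>A\<in>sets_of M. sat M \<sigma> (case_nat A \<rho>) \<phi>)"

lemma val_subst_trm: "val M \<sigma> (subst_trm \<tau> t) = val M (\<lambda>n. val M \<sigma> (\<tau> n)) t"
  by (induction t) auto

lemma val_lift_trm [simp]: "val M (case_nat x \<sigma>) (lift_trm t) = val M \<sigma> t"
  by (simp add: lift_trm_def val_subst_trm)

lemma sat_subst: "sat M \<sigma> \<rho> (subst \<tau> \<pi> \<phi>) \<longleftrightarrow> sat M (\<lambda>n. val M \<sigma> (\<tau> n)) (\<lambda>n. \<rho> (\<pi> n)) \<phi>"
proof (induction \<phi> arbitrary: \<sigma> \<rho> \<tau> \<pi>)
  case (AllN \<phi>)
  have "(\<lambda>n. val M (case_nat x \<sigma>) (up \<tau> n)) = case_nat x (\<lambda>n. val M \<sigma> (\<tau> n))" for x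
    by (auto split: nat.split)
  then show ?case by (simp add: AllN)
next
  case (AllS \<phi>)
  have "(\<lambda>n. case_nat A \<rho> (upS \<pi> n)) = case_nat A (\<lambda>n. \<rho> (\<pi> n))" for A
  proof
    fix n show "case_nat A \<rho> (upS \<pi> n) = case_nat A (\<lambda>n. \<rho> (\<pi> n)) n"
      by (cases n) auto
  qed
  then show ?case by (simp add: AllS)
qed (auto simp: val_subst_trm)

definition models :: "'a str \<Rightarrow> fm \<Rightarrow> bool" where
  "models M \<phi> \<longleftrightarrow> (\<forall>\<sigma> \<rho>. range \<rho> \<subseteq> sets_of M \<longrightarrow> sat M \<sigma> \<rho> \<phi>)"

text \<open>Infinitely many provably distinct closed terms ensure that the term model is countably
  infinite, so that it can be transferred to the type of natural numbers.\<close>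

lemma ex_countermodel:
  fixes num :: "nat \<Rightarrow> trm"
  assumes T: "substitutive T" and "\<not> (T \<turnstile> \<chi>)"
    and num: "\<And>i j. i < j \<Longrightarrow> T \<turnstile> Neg (Eq (num j) (num i))"
  shows "\<exists>M :: nat str. (\<forall>\<phi>. (T \<turnstile> \<phi>) \<longrightarrow> models M \<phi>) \<and> \<not> models M \<chi>"
proof -
  obtain W where W: "\<chi> \<notin> W" "\<And>\<phi>. T \<turnstile> \<phi> \<Longrightarrow> \<phi> \<in> W" "Fls \<notin> W"
    "\<And>\<phi> \<psi>. Imp \<phi> \<psi> \<in> W \<longleftrightarrow> (\<phi> \<in> W \<longrightarrow> \<psi> \<in> W)"
    "\<And>\<psi>. AllN \<psi> \<in> W \<longleftrightarrow> (\<forall>t. instN t \<psi> \<in> W)"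
    "\<And>\<psi>. AllS \<psi> \<in> W \<longleftrightarrow> (\<forall>X. instS X \<psi> \<in> W)"
    using ex_Henkin_set[OF assms(1,2)] by auto
  have eq_subst': "subst (case_nat u Var) id \<phi> \<in> W" if "Eq t u \<in> W" "subst (case_nat t Var) id \<phi> \<in> W" for t u \<phi>
    using W(2)[OF eq_subst[of T t u \<phi>]] that by (simp add: W(4) instN_def)
  have refl: "Eq t t \<in> W" for t by (rule W(2)[OF eq_refl])
  have sym: "Eq u t \<in> W" if "Eq t u \<in> W" for t u
    using eq_subst'[OF that, of "Eq (Var 0) (lift_trm t)"] refl by (simp add: subst_trm_lift_trm)
  have trans: "Eq t s \<in> W" if "Eq t u \<in> W" "Eq u s \<in> W" for t u s
    using eq_subst'[OF that(2), of "Eq (lift_trm t) (Var 0)"] that(1) by (simp add: subst_trm_lift_trm)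
  have add: "Eq (Add t s) (Add t' s') \<in> W" if "Eq t t' \<in> W" "Eq s s' \<in> W" for t s t' s'
  proof -
    have "Eq (Add t s) (Add t' s) \<in> W"
      using eq_subst'[OF that(1), of "Eq (lift_trm (Add t s)) (Add (Var 0) (lift_trm s))"] refl
      by (simp add: subst_trm_lift_trm)
    moreover have "Eq (Add t' s) (Add t' s') \<in> W"
      using eq_subst'[OF that(2), of "Eq (lift_trm (Add t' s)) (Add (lift_trm t') (Var 0))"] refl
      by (simp add: subst_trm_lift_trm)
    ultimately show ?thesis by (rule trans)
  qed
  have mul: "Eq (Mul t s) (Mul t' s') \<in> W" if "Eq t t' \<in> W" "Eq s s' \<in> W" for t s t' s'
  proof -
    have "Eq (Mul t s) (Mul t' s) \<in> W"
      using eq_subst'[OF that(1), of "Eq (lift_trm (Mul t s)) (Mul (Var 0) (lift_trm s))"] refl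
      by (simp add: subst_trm_lift_trm)
    moreover have "Eq (Mul t' s) (Mul t' s') \<in> W"
      using eq_subst'[OF that(2), of "Eq (lift_trm (Mul t' s)) (Mul (lift_trm t') (Var 0))"] refl
      by (simp add: subst_trm_lift_trm)
    ultimately show ?thesis by (rule trans)
  qed
  have less: "Less t' s' \<in> W" if "Eq t t' \<in> W" "Eq s s' \<in> W" "Less t s \<in> W" for t s t' s'
  proof -
    have "Less t' s \<in> W"
      using eq_subst'[OF that(1), of "Less (Var 0) (lift_trm s)"] that(3)
      by (simp add: subst_trm_lift_trm)
    then show ?thesis
      using eq_subst'[OF that(2), of "Less (lift_trm t') (Var 0)"]
      by (simp add: subst_trm_lift_trm)
  qed
  have mem: "Mem t' X \<in> W" if "Eq t t' \<in> W" "Mem t X \<in> W" for t t' X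
    using eq_subst'[OF that(1), of "Mem (Var 0) X"] that(2) by simp
  define cl where "cl t = {u. Eq t u \<in> W}" for t
  have cl: "cl t = cl u \<longleftrightarrow> Eq t u \<in> W" for t u
  proof
    assume "cl t = cl u"
    then have "u \<in> cl t" using refl by (simp add: cl_def)
    then show "Eq t u \<in> W" by (simp add: cl_def)
  next
    assume "Eq t u \<in> W"
    then show "cl t = cl u"
      unfolding cl_def using trans[OF \<open>Eq t u \<in> W\<close>] trans[OF sym[OF \<open>Eq t u \<in> W\<close>]] by auto
  qed
  have "inj (\<lambda>n. cl (num n))"
  proof (rule linorder_injI)
    fix i j :: nat assume "i < j"
    then have "Neg (Eq (num j) (num i)) \<in> W" by (intro W(2) num)
    then have "cl (num j) \<noteq> cl (num i)" using W(3,4) by (simp add: cl)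
    then show "cl (num i) \<noteq> cl (num j)" by (rule not_sym)
  qed
  then have "infinite (range (\<lambda>n. cl (num n)))" by (rule range_inj_infinite)
  then have inf: "infinite (range cl)" by (rule infinite_super[rotated]) auto
  \<comment> \<open>\<open>rk\<close> numbers the classes of terms equal according to
    \<open>W\<close>, and \<open>tm\<close> below picks a representative. The carrier consists of
    codes of classes; its operations are unrelated to the usual ones on the type.\<close>
  define rk where "rk t = to_nat_on (range cl) (cl t)" for t
  have rk: "rk t = rk u \<longleftrightarrow> Eq t u \<in> W" for t u
    unfolding rk_def cl[symmetric] by simp
  have "bij_betw (to_nat_on (range cl)) (range cl) UNIV"
    using inf by (intro to_nat_on_infinite) auto
  then have surj: "\<exists>t. rk t = n" for n
  proof -
    have "n \<in> to_nat_on (range cl) ` range cl"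
      using \<open>bij_betw _ _ UNIV\<close> by (simp add: bij_betw_def)
    then show ?thesis by (auto simp: rk_def)
  qed
  define tm where "tm n = (SOME t. rk t = n)" for n
  have rk_tm [simp]: "rk (tm n) = n" for n
    unfolding tm_def by (rule someI_ex[OF surj])
  have Eq_tm: "Eq t (tm (rk t)) \<in> W" "Eq (tm (rk t)) t \<in> W" for t
    by (simp_all add: rk[symmetric])
  define S where "S X = {n. Mem (tm n) X \<in> W}" for X
  define M where "M = \<lparr>zero_of = rk Zero, one_of = rk One,
    add_of = (\<lambda>x y. rk (Add (tm x) (tm y))), mul_of = (\<lambda>x y. rk (Mul (tm x) (tm y))),
    less_of = (\<lambda>x y. Less (tm x) (tm y) \<in> W), sets_of = range S\<rparr>"
  have M [simp]: "zero_of M = rk Zero" "one_of M = rk One"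
    "add_of M x y = rk (Add (tm x) (tm y))" "mul_of M x y = rk (Mul (tm x) (tm y))"
    "less_of M x y \<longleftrightarrow> Less (tm x) (tm y) \<in> W" "sets_of M = range S" for x y
    by (simp_all add: M_def)
  have val: "val M (\<lambda>n. rk (\<sigma> n)) t = rk (subst_trm \<sigma> t)" for \<sigma> t
    by (induction t) (simp_all add: rk add[OF Eq_tm(2) Eq_tm(2)] mul[OF Eq_tm(2) Eq_tm(2)])
  have sat: "sat M (\<lambda>n. rk (\<sigma> n)) (\<lambda>X. S (\<rho> X)) \<phi> \<longleftrightarrow> subst \<sigma> \<rho> \<phi> \<in> W" for \<sigma> \<rho> \<phi>
  proof (induction \<phi> arbitrary: \<sigma> \<rho>)
    case (Eq t u)
    then show ?case by (simp add: val rk)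
  next
    case (Less t u)
    have "Less (tm (rk (subst_trm \<sigma> t))) (tm (rk (subst_trm \<sigma> u))) \<in> W \<longleftrightarrow> Less (subst_trm \<sigma> t) (subst_trm \<sigma> u) \<in> W"
      by (rule iffI[OF less[OF Eq_tm(2) Eq_tm(2)] less[OF Eq_tm(1) Eq_tm(1)]])
    then show ?case by (simp add: val)
  next
    case (Mem t X)
    have "Mem (tm (rk (subst_trm \<sigma> t))) (\<rho> X) \<in> W \<longleftrightarrow> Mem (subst_trm \<sigma> t) (\<rho> X) \<in> W"
      by (rule iffI[OF mem[OF Eq_tm(2)] mem[OF Eq_tm(1)]])
    then show ?case by (simp add: val S_def)
  next
    case Fls
    then show ?case by (simp add: W)
  next
    case (Imp \<phi> \<psi>)
    then show ?case by (simp add: W)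
  next
    case (AllN \<phi>)
    have "sat M (\<lambda>n. rk (\<sigma> n)) (\<lambda>X. S (\<rho> X)) (AllN \<phi>) \<longleftrightarrow>
      (\<forall>t. sat M (case_nat (rk t) (\<lambda>n. rk (\<sigma> n))) (\<lambda>X. S (\<rho> X)) \<phi>)"
      by (simp only: sat.simps) (metis rk_tm)
    also have "\<dots> \<longleftrightarrow> (\<forall>t. sat M (\<lambda>n. rk (case_nat t \<sigma> n)) (\<lambda>X. S (\<rho> X)) \<phi>)"
    proof -
      have "case_nat (rk t) (\<lambda>n. rk (\<sigma> n)) = (\<lambda>n. rk (case_nat t \<sigma> n))" for t
        by (auto split: nat.split)
      then show ?thesis by simp
    qed
    also have "\<dots> \<longleftrightarrow> (\<forall>t. instN t (subst (up \<sigma>) \<rho> \<phi>) \<in> W)"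
      by (simp add: AllN subst_instN_up)
    finally show ?case by (simp add: W)
  next
    case (AllS \<phi>)
    have "sat M (\<lambda>n. rk (\<sigma> n)) (\<lambda>X. S (\<rho> X)) (AllS \<phi>) \<longleftrightarrow>
      (\<forall>X. sat M (\<lambda>n. rk (\<sigma> n)) (case_nat (S X) (\<lambda>X. S (\<rho> X))) \<phi>)"
      by simp
    also have "\<dots> \<longleftrightarrow> (\<forall>X. sat M (\<lambda>n. rk (\<sigma> n)) (\<lambda>n. S (case_nat X \<rho> n)) \<phi>)"
    proof -
      have "case_nat (S X) (\<lambda>X. S (\<rho> X)) = (\<lambda>n. S (case_nat X \<rho> n))" for X
        by (rule ext) (simp split: nat.split)
      then show ?thesis by simp
    qed
    also have "\<dots> \<longleftrightarrow> (\<forall>X. instS X (subst \<sigma> (upS \<rho>) \<phi>) \<in> W)"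
      by (simp add: AllS subst_instS_up)
    finally show ?case by (simp add: W)
  qed
  have "models M \<phi>" if "T \<turnstile> \<phi>" for \<phi>
    unfolding models_def
  proof (intro allI impI)
    fix \<sigma> :: "nat \<Rightarrow> nat" and \<rho> :: "nat \<Rightarrow> nat set"
    assume "range \<rho> \<subseteq> sets_of M"
    then have "\<forall>n. \<exists>X. \<rho> n = S X" by auto
    then obtain \<pi> where "\<rho> = (\<lambda>n. S (\<pi> n))" by metis
    moreover have "\<sigma> = (\<lambda>n. rk (tm (\<sigma> n)))" by simp
    ultimately show "sat M \<sigma> \<rho> \<phi>"
      using sat[of "\<lambda>n. tm (\<sigma> n)" \<pi> \<phi>] W(2)[OF derivable_subst[OF T that]] by simp
  qed
  moreover have "\<not> models M \<chi>"
  proof -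
    have "\<not> sat M (\<lambda>n. rk (Var n)) (\<lambda>X. S (id X)) \<chi>"
      using sat[of Var id \<chi>] W(1) by simp
    moreover have "range (\<lambda>X. S (id X)) \<subseteq> sets_of M" by auto
    ultimately show ?thesis unfolding models_def by blast
  qed
  ultimately show ?thesis by blast
qed


section \<open>Models of \<open>RCA\<^sub>0\<close>\<close>

lemma Delta0_subst: "Delta0 \<phi> \<Longrightarrow> Delta0 (subst \<sigma> \<rho> \<phi>)"
proof (induction arbitrary: \<sigma> \<rho> rule: Delta0.induct)
  case (6 \<phi> t)
  have "subst_trm (up \<sigma>) (lift_trm t) = lift_trm (subst_trm \<sigma> t)"
    by (simp add: subst_trm_lift_trm lift_trm_subst_trm)
  then show ?case using 6 by (auto intro: Delta0.intros)
qed (auto intro: Delta0.intros)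

lemma subst_induction_axiom:
  "subst \<sigma> \<rho> (induction_axiom \<phi>) = induction_axiom (subst (up \<sigma>) \<rho> \<phi>)"
proof -
  have "subst (up \<sigma>) \<rho> (subst (case_nat (Add (Var 0) One) (\<lambda>n. Var (Suc n))) id \<phi>) =
    subst (case_nat (Add (Var 0) One) (\<lambda>n. Var (Suc n))) id (subst (up \<sigma>) \<rho> \<phi>)"
    unfolding subst_subst
    by (rule arg_cong3[where f = subst]) (auto split: nat.split simp: subst_trm_lift_trm subst_trm_Var_Suc)
  then show ?thesis by (simp add: induction_axiom_def subst_instN)
qed

lemma subst_comprehension_axiom:
  "subst \<sigma> \<rho> (comprehension_axiom \<phi> \<psi>) =
    comprehension_axiom (subst (up \<sigma>) \<rho> \<phi>) (subst (up \<sigma>) \<rho> \<psi>)"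
  by (simp add: comprehension_axiom_def subst_liftS)

lemma derivable_inst2:
  assumes "T \<turnstile> \<phi>"
  shows "T \<turnstile> subst (case_nat t (case_nat u Var)) id \<phi>"
proof -
  have "T \<turnstile> instN u (AllN \<phi>)"
    using assms by (meson allN_inst derivable.mp genN)
  then have "T \<turnstile> AllN (subst (up (case_nat u Var)) id \<phi>)"
    by (simp add: instN_def)
  then have "T \<turnstile> instN t (subst (up (case_nat u Var)) id \<phi>)"
    by (meson allN_inst derivable.mp)
  then show ?thesis by (simp only: subst_instN_up)
qed

lemma substitutive_RCA0: "substitutive RCA0"
  unfolding substitutive_def
proof (intro ballI allI)
  fix \<phi> \<sigma> \<rho>
  assume "\<phi> \<in> RCA0"
  then consider "\<phi> \<in> basic_axioms" | \<psi> where "\<phi> = induction_axiom \<psi>" "Sigma1 \<psi>"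
    | \<psi> \<chi> where "\<phi> = comprehension_axiom \<psi> \<chi>" "Sigma1 \<psi>" "Pi1 \<chi>"
    unfolding RCA0_def by blast
  then show "RCA0 \<turnstile> subst \<sigma> \<rho> \<phi>"
  proof cases
    case 1
    then have "subst \<sigma> \<rho> \<phi> = subst (case_nat (\<sigma> 0) (case_nat (\<sigma> 1) Var)) id \<phi>"
      unfolding basic_axioms_def Let_def by auto
    moreover have "RCA0 \<turnstile> \<phi>" using \<open>\<phi> \<in> RCA0\<close> by (rule ax)
    ultimately show ?thesis by (simp add: derivable_inst2)
  next
    case 2
    then have "Sigma1 (subst (up \<sigma>) \<rho> \<psi>)"
      by (auto simp: Sigma1_def intro: Delta0_subst)
    with 2 show ?thesis unfolding RCA0_def by (auto simp: subst_induction_axiom intro: ax)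
  next
    case 3
    then have "Sigma1 (subst (up \<sigma>) \<rho> \<psi>)" "Pi1 (subst (up \<sigma>) \<rho> \<chi>)"
      by (auto simp: Sigma1_def Pi1_def intro: Delta0_subst)
    then have "comprehension_axiom (subst (up \<sigma>) \<rho> \<psi>) (subst (up \<sigma>) \<rho> \<chi>) \<in> RCA0"
      unfolding RCA0_def by blast
    with 3 show ?thesis by (simp add: subst_comprehension_axiom ax)
  qed
qed

primrec num :: "nat \<Rightarrow> trm" where
  "num 0 = Zero"
| "num (Suc n) = Add (num n) One"

lemma derivable_contrapos: "T \<turnstile> Imp \<phi> \<psi> \<Longrightarrow> T \<turnstile> Neg \<psi> \<Longrightarrow> T \<turnstile> Neg \<phi>"
  by (meson derivable.mp imp_K imp_S)

lemma RCA0_num_distinct: "i < j \<Longrightarrow> RCA0 \<turnstile> Neg (Eq (num j) (num i))"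
proof (induction i arbitrary: j)
  case 0
  then obtain k where "j = Suc k" by (cases j) auto
  moreover have "RCA0 \<turnstile> Neg (Eq (Add (Var 1) One) Zero)"
    by (rule ax) (simp add: RCA0_def basic_axioms_def Let_def)
  from derivable_subst[OF substitutive_RCA0 this, of "\<lambda>_. num k" id]
  have "RCA0 \<turnstile> Neg (Eq (Add (num k) One) Zero)" by simp
  ultimately show ?case by simp
next
  case (Suc i)
  then obtain k where k: "j = Suc k" "i < k" by (cases j) auto
  have "RCA0 \<turnstile> Imp (Eq (Add (Var 0) One) (Add (Var 1) One)) (Eq (Var 0) (Var 1))"
    by (rule ax) (simp add: RCA0_def basic_axioms_def Let_def)
  from derivable_subst[OF substitutive_RCA0 this, of "case_nat (num k) (\<lambda>_. num i)" id]
  have "RCA0 \<turnstile> Imp (Eq (Add (num k) One) (Add (num i) One)) (Eq (num k) (num i))" by simp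
  with Suc.IH[OF k(2)] show ?case by (auto simp: k intro: derivable_contrapos)
qed

theorem RCA0_completeness:
  assumes "\<And>M :: nat str. \<forall>\<phi>\<in>RCA0. models M \<phi> \<Longrightarrow> models M \<chi>"
  shows "RCA0 \<turnstile> \<chi>"
proof (rule ccontr)
  assume "\<not> (RCA0 \<turnstile> \<chi>)"
  then obtain M :: "nat str" where "\<forall>\<phi>. (RCA0 \<turnstile> \<phi>) \<longrightarrow> models M \<phi>" "\<not> models M \<chi>"
    using ex_countermodel[OF substitutive_RCA0, of \<chi> num] RCA0_num_distinct by auto
  with assms ax show False by blast
qed

text \<open>Without any set there would be no assignment and \<open>models\<close> would hold
  vacuously, so nonemptiness is assumed separately.\<close>

locale rca_model =
  fixes M :: "'a str"
  assumes axioms: "\<phi> \<in> RCA0 \<Longrightarrow> models M \<phi>"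
    and sets_nonempty: "sets_of M \<noteq> {}"
begin

abbreviation plus (infixl \<open>\<oplus>\<close> 65) where "x \<oplus> y \<equiv> add_of M x y"
abbreviation times (infixl \<open>\<otimes>\<close> 70) where "x \<otimes> y \<equiv> mul_of M x y"
abbreviation less (infix \<open>\<prec>\<close> 50) where "x \<prec> y \<equiv> less_of M x y"
abbreviation zero (\<open>\<zero>\<close>) where "\<zero> \<equiv> zero_of M"
abbreviation one (\<open>\<one>\<close>) where "\<one> \<equiv> one_of M"
abbreviation sets where "sets \<equiv> sets_of M"

subsection \<open>Definability with parameters\<close>

text \<open>In \<open>env k \<sigma> \<tau>\<close> the first \<open>k\<close> number variables are proper arguments, taken from \<open>\<sigma>\<close>;
  the other ones are parameters, taken from \<open>\<tau>\<close>.\<close>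

definition env :: "nat \<Rightarrow> (nat \<Rightarrow> 'a) \<Rightarrow> (nat \<Rightarrow> 'a) \<Rightarrow> nat \<Rightarrow> 'a" where
  "env k \<sigma> \<tau> n = (if n < k then \<sigma> n else \<tau> (n - k))"

definition isT :: "((nat \<Rightarrow> 'a) \<Rightarrow> 'a) \<Rightarrow> bool" where
  "isT f \<longleftrightarrow> (\<exists>t k \<tau>. \<forall>\<sigma>. f \<sigma> = val M (env k \<sigma> \<tau>) t)"

text \<open>Definability of a HOL predicate on assignments, witnessed by a
  \<open>\<Delta>\<^sub>0\<close> formula that is never displayed: the rules in \<open>dfn\<close>
  follow the shape of the predicate.\<close>

definition isD :: "((nat \<Rightarrow> 'a) \<Rightarrow> bool) \<Rightarrow> bool" where
  "isD P \<longleftrightarrow> (\<exists>\<phi> k \<tau> \<rho>. Delta0 \<phi> \<and> range \<rho> \<subseteq> sets \<and> (\<forall>\<sigma>. P \<sigma> \<longleftrightarrow> sat M (env k \<sigma> \<tau>) \<rho> \<phi>))"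

definition isS :: "((nat \<Rightarrow> 'a) \<Rightarrow> bool) \<Rightarrow> bool" where
  "isS P \<longleftrightarrow> (\<exists>Q. isD Q \<and> (\<forall>\<sigma>. P \<sigma> \<longleftrightarrow> (\<exists>x. Q (case_nat x \<sigma>))))"

text \<open>Placing the two parameter sequences at the even and odd positions behind the arguments
  lets two formulas with unrelated parameters be read in one environment after renaming their
  variables.\<close>

lemma merge_env:
  fixes K k1 k2 :: nat
  obtains k \<tau> r1 r2 where "K \<le> k" "\<And>\<sigma> n. env k1 \<sigma> \<tau>1 n = env k \<sigma> \<tau> (r1 n)"
    "\<And>\<sigma> n. env k2 \<sigma> \<tau>2 n = env k \<sigma> \<tau> (r2 n)"
proof
  define k where "k = max K (max k1 k2)"
  define \<tau> where "\<tau> n = (if even n then \<tau>1 (n div 2) else \<tau>2 (n div 2))" for n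
  define r1 where "r1 n = (if n < k1 then n else k + 2 * (n - k1))" for n
  define r2 where "r2 n = (if n < k2 then n else k + Suc (2 * (n - k2)))" for n
  show "K \<le> k" by (simp add: k_def)
  show "env k1 \<sigma> \<tau>1 n = env k \<sigma> \<tau> (r1 n)" "env k2 \<sigma> \<tau>2 n = env k \<sigma> \<tau> (r2 n)" for \<sigma> n
    by (auto simp: env_def r1_def r2_def \<tau>_def k_def)
qed

lemma merge_sets:
  assumes "range \<rho>1 \<subseteq> sets" "range \<rho>2 \<subseteq> sets"
  obtains \<rho> r1 r2 where "range \<rho> \<subseteq> sets" "\<And>n :: nat. \<rho>1 n = \<rho> (r1 n :: nat)"
    "\<And>n :: nat. \<rho>2 n = \<rho> (r2 n)"
proof
  define \<rho> where "\<rho> n = (if even n then \<rho>1 (n div 2) else \<rho>2 (n div 2))" for n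
  show "range \<rho> \<subseteq> sets" using assms by (auto simp: \<rho>_def)
  show "\<rho>1 n = \<rho> (2 * n)" "\<rho>2 n = \<rho> (Suc (2 * n))" for n
    by (simp_all add: \<rho>_def)
qed

lemma isD_merge:
  assumes "isD P" "isD Q"
  obtains k \<tau> \<rho> \<phi> \<psi> where "K \<le> k" "range \<rho> \<subseteq> sets" "Delta0 \<phi>" "Delta0 \<psi>"
    "\<And>\<sigma>. P \<sigma> \<longleftrightarrow> sat M (env k \<sigma> \<tau>) \<rho> \<phi>" "\<And>\<sigma>. Q \<sigma> \<longleftrightarrow> sat M (env k \<sigma> \<tau>) \<rho> \<psi>"
proof -
  obtain \<phi>1 k1 \<tau>1 \<rho>1 where 1: "Delta0 \<phi>1" "range \<rho>1 \<subseteq> sets" "\<And>\<sigma>. P \<sigma> \<longleftrightarrow> sat M (env k1 \<sigma> \<tau>1) \<rho>1 \<phi>1"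
    using assms(1) unfolding isD_def by iprover
  obtain \<phi>2 k2 \<tau>2 \<rho>2 where 2: "Delta0 \<phi>2" "range \<rho>2 \<subseteq> sets" "\<And>\<sigma>. Q \<sigma> \<longleftrightarrow> sat M (env k2 \<sigma> \<tau>2) \<rho>2 \<phi>2"
    using assms(2) unfolding isD_def by iprover
  obtain k \<tau> r1 r2 where k: "K \<le> k" "\<And>\<sigma> n. env k1 \<sigma> \<tau>1 n = env k \<sigma> \<tau> (r1 n)"
    "\<And>\<sigma> n. env k2 \<sigma> \<tau>2 n = env k \<sigma> \<tau> (r2 n)" by (rule merge_env[of K k1 \<tau>1 k2 \<tau>2]) (rule that)
  obtain \<rho> p1 p2 where \<rho>: "range (\<rho> :: nat \<Rightarrow> 'a set) \<subseteq> sets" "\<And>n. \<rho>1 n = \<rho> (p1 n)" "\<And>n. \<rho>2 n = \<rho> (p2 n)"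
    by (rule merge_sets[OF 1(2) 2(2)]) (rule that)
  show thesis
  proof (rule that[OF k(1) \<rho>(1)])
    show "Delta0 (subst (\<lambda>n. Var (r1 n)) p1 \<phi>1)" "Delta0 (subst (\<lambda>n. Var (r2 n)) p2 \<phi>2)"
      by (intro Delta0_subst 1 2)+
    show "P \<sigma> \<longleftrightarrow> sat M (env k \<sigma> \<tau>) \<rho> (subst (\<lambda>n. Var (r1 n)) p1 \<phi>1)" for \<sigma>
      by (simp add: 1(3) sat_subst k(2)[symmetric] \<rho>(2)[symmetric])
    show "Q \<sigma> \<longleftrightarrow> sat M (env k \<sigma> \<tau>) \<rho> (subst (\<lambda>n. Var (r2 n)) p2 \<phi>2)" for \<sigma>
      by (simp add: 2(3) sat_subst k(3)[symmetric] \<rho>(3)[symmetric])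
  qed
qed

lemma isT_merge:
  assumes "isT f" "isT g"
  obtains k \<tau> t u where "\<And>\<sigma>. f \<sigma> = val M (env k \<sigma> \<tau>) t" "\<And>\<sigma>. g \<sigma> = val M (env k \<sigma> \<tau>) u"
proof -
  obtain t1 k1 \<tau>1 where 1: "\<And>\<sigma>. f \<sigma> = val M (env k1 \<sigma> \<tau>1) t1"
    using assms(1) unfolding isT_def by iprover
  obtain t2 k2 \<tau>2 where 2: "\<And>\<sigma>. g \<sigma> = val M (env k2 \<sigma> \<tau>2) t2"
    using assms(2) unfolding isT_def by iprover
  obtain k \<tau> r1 r2 where k: "0 \<le> k" "\<And>\<sigma> n. env k1 \<sigma> \<tau>1 n = env k \<sigma> \<tau> (r1 n)"
    "\<And>\<sigma> n. env k2 \<sigma> \<tau>2 n = env k \<sigma> \<tau> (r2 n)" by (rule merge_env[of 0 k1 \<tau>1 k2 \<tau>2]) (rule that)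
  show thesis
  proof (rule that)
    show "f \<sigma> = val M (env k \<sigma> \<tau>) (subst_trm (\<lambda>n. Var (r1 n)) t1)" for \<sigma>
      by (simp add: 1 val_subst_trm k(2)[symmetric])
    show "g \<sigma> = val M (env k \<sigma> \<tau>) (subst_trm (\<lambda>n. Var (r2 n)) t2)" for \<sigma>
      by (simp add: 2 val_subst_trm k(3)[symmetric])
  qed
qed

named_theorems dfn

lemma isT_var [dfn]: "isT (\<lambda>\<sigma>. \<sigma> i)"
  unfolding isT_def by (rule exI[of _ "Var i"], rule exI[of _ "Suc i"]) (simp add: env_def)

lemma isT_const [dfn]: "isT (\<lambda>\<sigma>. c)"
  unfolding isT_def
  by (rule exI[of _ "Var 0"], rule exI[of _ 0], rule exI[of _ "\<lambda>_. c"]) (simp add: env_def)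

lemma isT_add [dfn]: "isT f \<Longrightarrow> isT g \<Longrightarrow> isT (\<lambda>\<sigma>. f \<sigma> \<oplus> g \<sigma>)"
  by (erule isT_merge, assumption) (simp add: isT_def, metis val.simps)

lemma isT_mul [dfn]: "isT f \<Longrightarrow> isT g \<Longrightarrow> isT (\<lambda>\<sigma>. f \<sigma> \<otimes> g \<sigma>)"
  by (erule isT_merge, assumption) (simp add: isT_def, metis val.simps)

lemma ex_renamed_env: "\<exists>K r'. \<forall>\<sigma> n. env k (\<lambda>n. \<sigma> (r n)) \<tau> n = env K \<sigma> \<tau> (r' n)"
proof (intro exI allI)
  fix \<sigma> n
  define K where "K = Suc (Max (insert 0 (r ` {..<k})))"
  have "r n < K" if "n < k" for n
    unfolding K_def less_Suc_eq_le by (rule Max_ge) (use that in auto)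
  then show "env k (\<lambda>n. \<sigma> (r n)) \<tau> n = env (Suc (Max (insert 0 (r ` {..<k})))) \<sigma> \<tau>
      (if n < k then r n else Suc (Max (insert 0 (r ` {..<k}))) + (n - k))"
    by (auto simp: env_def K_def)
qed

lemma isT_rename: "isT f \<Longrightarrow> isT (\<lambda>\<sigma>. f (\<lambda>n. \<sigma> (r n)))"
proof -
  assume "isT f"
  then obtain t k \<tau> where f: "\<And>\<sigma>. f \<sigma> = val M (env k \<sigma> \<tau>) t" unfolding isT_def by iprover
  obtain K r' where r': "\<And>\<sigma> n. env k (\<lambda>n. \<sigma> (r n)) \<tau> n = env K \<sigma> \<tau> (r' n)"
    using ex_renamed_env[of k r \<tau>] by iprover
  have "f (\<lambda>n. \<sigma> (r n)) = val M (env K \<sigma> \<tau>) (subst_trm (\<lambda>n. Var (r' n)) t)" for \<sigma>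
    by (simp add: f val_subst_trm r'[symmetric])
  then show ?thesis unfolding isT_def by iprover
qed

lemma isT_isD_merge:
  assumes "isT f" "isD P"
  obtains k \<tau> \<rho> t \<phi> where "range \<rho> \<subseteq> sets" "Delta0 \<phi>"
    "\<And>\<sigma>. f \<sigma> = val M (env k \<sigma> \<tau>) t"
    "\<And>x \<sigma>. P (case_nat x \<sigma>) \<longleftrightarrow> sat M (case_nat x (env k \<sigma> \<tau>)) \<rho> \<phi>"
proof -
  obtain t1 k1 \<tau>1 where 1: "\<And>\<sigma>. f \<sigma> = val M (env k1 \<sigma> \<tau>1) t1"
    using assms(1) unfolding isT_def by iprover
  \<comment> \<open>Merging \<open>P\<close> with itself serves to raise the number of arguments to
    at least 1, so that the quantified variable is a proper argument rather than a
    parameter.\<close>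
  obtain k2 \<tau>2 \<rho> \<phi> where 2: "1 \<le> k2" "range \<rho> \<subseteq> sets" "Delta0 \<phi>" "\<And>\<sigma>. P \<sigma> \<longleftrightarrow> sat M (env k2 \<sigma> \<tau>2) \<rho> \<phi>"
    by (rule isD_merge[OF assms(2,2), of 1]) (rule that)
  obtain j where j: "k2 = Suc j" using 2(1) by (cases k2) auto
  obtain k \<tau> r1 r2 where k: "0 \<le> k" "\<And>\<sigma> n. env k1 \<sigma> \<tau>1 n = env k \<sigma> \<tau> (r1 n)"
    "\<And>\<sigma> n. env j \<sigma> \<tau>2 n = env k \<sigma> \<tau> (r2 n)" by (rule merge_env[of 0 k1 \<tau>1 j \<tau>2]) (rule that)
  define s where "s = case_nat (Var 0) (\<lambda>n. Var (Suc (r2 n)))"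
  have "(\<lambda>n. val M (case_nat x (env k \<sigma> \<tau>)) (s n)) = env k2 (case_nat x \<sigma>) \<tau>2" for x \<sigma>
  proof
    show "val M (case_nat x (env k \<sigma> \<tau>)) (s n) = env k2 (case_nat x \<sigma>) \<tau>2 n" for n
    proof (cases n)
      case 0
      then show ?thesis by (simp add: s_def env_def j)
    next
      case (Suc m)
      then have "val M (case_nat x (env k \<sigma> \<tau>)) (s n) = env j \<sigma> \<tau>2 m"
        by (simp add: s_def k(3))
      also have "\<dots> = env k2 (case_nat x \<sigma>) \<tau>2 n"
        using Suc by (auto simp: env_def j)
      finally show ?thesis .
    qed
  qed
  then have P: "P (case_nat x \<sigma>) \<longleftrightarrow> sat M (case_nat x (env k \<sigma> \<tau>)) \<rho> (subst s id \<phi>)" for x \<sigma>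
    by (simp add: 2(4) sat_subst)
  have f: "f \<sigma> = val M (env k \<sigma> \<tau>) (subst_trm (\<lambda>n. Var (r1 n)) t1)" for \<sigma>
    by (simp add: 1 val_subst_trm k(2)[symmetric])
  from 2(2) Delta0_subst[OF 2(3)] f P show thesis by (rule that)
qed

lemma
  assumes "isT f" "isT g"
  shows isD_eq [dfn]: "isD (\<lambda>\<sigma>. f \<sigma> = g \<sigma>)" and isD_less [dfn]: "isD (\<lambda>\<sigma>. f \<sigma> \<prec> g \<sigma>)"
proof -
  obtain k \<tau> t u where tu: "\<And>\<sigma>. f \<sigma> = val M (env k \<sigma> \<tau>) t" "\<And>\<sigma>. g \<sigma> = val M (env k \<sigma> \<tau>) u"
    by (rule isT_merge[OF assms]) (rule that)
  obtain A where "A \<in> sets" using sets_nonempty by blast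
  then have A: "range (\<lambda>_::nat. A) \<subseteq> sets" by auto
  have "Delta0 (Eq t u)" "\<forall>\<sigma>. (f \<sigma> = g \<sigma>) = sat M (env k \<sigma> \<tau>) (\<lambda>_. A) (Eq t u)"
    by (auto simp: tu intro: Delta0.intros)
  with A show "isD (\<lambda>\<sigma>. f \<sigma> = g \<sigma>)" unfolding isD_def by iprover
  have "Delta0 (Less t u)" "\<forall>\<sigma>. (f \<sigma> \<prec> g \<sigma>) = sat M (env k \<sigma> \<tau>) (\<lambda>_. A) (Less t u)"
    by (auto simp: tu intro: Delta0.intros)
  with A show "isD (\<lambda>\<sigma>. f \<sigma> \<prec> g \<sigma>)" unfolding isD_def by iprover
qed

lemma isD_mem [dfn]:
  assumes "A \<in> sets" "isT f"
  shows "isD (\<lambda>\<sigma>. f \<sigma> \<in> A)"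
proof -
  obtain k \<tau> t where t: "\<And>\<sigma>. f \<sigma> = val M (env k \<sigma> \<tau>) t"
    using assms(2) unfolding isT_def by iprover
  have "Delta0 (Mem t 0)" "\<forall>\<sigma>. (f \<sigma> \<in> A) = sat M (env k \<sigma> \<tau>) (\<lambda>_. A) (Mem t 0)"
    by (auto simp: t intro: Delta0.intros)
  moreover have "range (\<lambda>_::nat. A) \<subseteq> sets" using assms(1) by auto
  ultimately show ?thesis unfolding isD_def by iprover
qed

lemma isD_imp [dfn]:
  assumes "isD P" "isD Q"
  shows "isD (\<lambda>\<sigma>. P \<sigma> \<longrightarrow> Q \<sigma>)"
proof -
  obtain k \<tau> \<rho> \<phi> \<psi> where "range \<rho> \<subseteq> sets" "Delta0 \<phi>" "Delta0 \<psi>"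
    "\<And>\<sigma>. P \<sigma> \<longleftrightarrow> sat M (env k \<sigma> \<tau>) \<rho> \<phi>" "\<And>\<sigma>. Q \<sigma> \<longleftrightarrow> sat M (env k \<sigma> \<tau>) \<rho> \<psi>"
    by (rule isD_merge[OF assms, of 0]) (rule that)
  then show ?thesis unfolding isD_def
    by (intro exI[of _ "Imp \<phi> \<psi>"] exI[of _ k] exI[of _ \<tau>] exI[of _ \<rho>]) (auto intro: Delta0.intros)
qed

text \<open>In the premise the quantified variable is position 0 of the assignment and the old
  assignment is its tail, which matches \<open>case_nat x \<sigma>\<close>.\<close>

lemma isD_ball [dfn]:
  assumes "isT f" "isD (\<lambda>\<sigma>. P (\<sigma> 0) (\<lambda>n. \<sigma> (Suc n)))"
  shows "isD (\<lambda>\<sigma>. \<forall>x. x \<prec> f \<sigma> \<longrightarrow> P x \<sigma>)"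
proof -
  obtain k \<tau> \<rho> t \<phi> where *: "range \<rho> \<subseteq> sets" "Delta0 \<phi>" "\<And>\<sigma>. f \<sigma> = val M (env k \<sigma> \<tau>) t"
    "\<And>x \<sigma>. P x \<sigma> \<longleftrightarrow> sat M (case_nat x (env k \<sigma> \<tau>)) \<rho> \<phi>"
    by (rule isT_isD_merge[OF assms]) (rule that, simp_all)
  have "Delta0 (AllN (Imp (Less (Var 0) (lift_trm t)) \<phi>))"
    using *(2) by (rule Delta0.intros)
  moreover have "\<forall>\<sigma>. (\<forall>x. x \<prec> f \<sigma> \<longrightarrow> P x \<sigma>) \<longleftrightarrow>
    sat M (env k \<sigma> \<tau>) \<rho> (AllN (Imp (Less (Var 0) (lift_trm t)) \<phi>))"
    by (simp add: *)
  ultimately show ?thesis using *(1) unfolding isD_def by iprover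
qed

lemma isD_False [dfn]: "isD (\<lambda>\<sigma>. False)"
proof -
  obtain A where "A \<in> sets" using sets_nonempty by blast
  then show ?thesis unfolding isD_def
    by (intro exI[of _ Fls] exI[of _ 0] exI[of _ "\<lambda>_. A"]) (auto intro: Delta0.intros)
qed

lemma isD_not [dfn]: "isD P \<Longrightarrow> isD (\<lambda>\<sigma>. \<not> P \<sigma>)"
  using isD_imp[OF _ isD_False] by simp

lemma isD_conj [dfn]: "isD P \<Longrightarrow> isD Q \<Longrightarrow> isD (\<lambda>\<sigma>. P \<sigma> \<and> Q \<sigma>)"
  using isD_not[OF isD_imp[OF _ isD_not]] by simp

lemma isD_disj [dfn]: "isD P \<Longrightarrow> isD Q \<Longrightarrow> isD (\<lambda>\<sigma>. P \<sigma> \<or> Q \<sigma>)"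
  using isD_imp[OF isD_not] by (simp add: disj_imp)

lemma isD_iff [dfn]: "isD P \<Longrightarrow> isD Q \<Longrightarrow> isD (\<lambda>\<sigma>. P \<sigma> \<longleftrightarrow> Q \<sigma>)"
  using isD_conj[OF isD_imp isD_imp, of P Q Q P] by (simp add: iff_conv_conj_imp)

lemma isD_bex [dfn]:
  assumes "isT f" "isD (\<lambda>\<sigma>. P (\<sigma> 0) (\<lambda>n. \<sigma> (Suc n)))"
  shows "isD (\<lambda>\<sigma>. \<exists>x. x \<prec> f \<sigma> \<and> P x \<sigma>)"
  using isD_not[OF isD_ball[OF assms(1), of "\<lambda>x \<sigma>. \<not> P x \<sigma>", OF isD_not[OF assms(2)]]] by simp

lemma isD_rename: "isD P \<Longrightarrow> isD (\<lambda>\<sigma>. P (\<lambda>n. \<sigma> (r n)))"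
proof -
  assume "isD P"
  then obtain \<phi> k \<tau> \<rho> where P: "Delta0 \<phi>" "range \<rho> \<subseteq> sets" "\<And>\<sigma>. P \<sigma> \<longleftrightarrow> sat M (env k \<sigma> \<tau>) \<rho> \<phi>"
    unfolding isD_def by iprover
  obtain K r' where r': "\<And>\<sigma> n. env k (\<lambda>n. \<sigma> (r n)) \<tau> n = env K \<sigma> \<tau> (r' n)"
    using ex_renamed_env[of k r \<tau>] by iprover
  have "P (\<lambda>n. \<sigma> (r n)) \<longleftrightarrow> sat M (env K \<sigma> \<tau>) \<rho> (subst (\<lambda>n. Var (r' n)) id \<phi>)" for \<sigma>
    by (simp add: P sat_subst r'[symmetric])
  then show ?thesis unfolding isD_def
    by (intro exI conjI allI) (rule Delta0_subst[OF P(1)], rule P(2))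
qed

lemma isS_ex: "isD (\<lambda>\<sigma>. P (\<sigma> 0) (\<lambda>n. \<sigma> (Suc n))) \<Longrightarrow> isS (\<lambda>\<sigma>. \<exists>x. P x \<sigma>)"
  unfolding isS_def by (intro exI[of _ "\<lambda>\<sigma>. P (\<sigma> 0) (\<lambda>n. \<sigma> (Suc n))"]) simp

lemma isS_isD: "isD P \<Longrightarrow> isS P"
  using isS_ex[of "\<lambda>x. P"] isD_rename[of P Suc] by simp

lemma isS_imp:
  assumes "isD P" "isS Q"
  shows "isS (\<lambda>\<sigma>. P \<sigma> \<longrightarrow> Q \<sigma>)"
proof -
  obtain R where R: "isD R" "\<And>\<sigma>. Q \<sigma> \<longleftrightarrow> (\<exists>x. R (case_nat x \<sigma>))"
    using assms(2) unfolding isS_def by (elim exE conjE) (rule that, simp_all)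
  have "isD (\<lambda>\<sigma>. P (\<lambda>n. \<sigma> (Suc n)) \<longrightarrow> R \<sigma>)"
    by (rule isD_imp[OF isD_rename[OF assms(1)] R(1)])
  then show ?thesis unfolding isS_def
    by (intro exI[of _ "\<lambda>\<sigma>. P (\<lambda>n. \<sigma> (Suc n)) \<longrightarrow> R \<sigma>"]) (simp add: R(2))
qed

text \<open>Both predicates get formulas under one assignment, because comprehension compares a
  \<open>\<Sigma>\<^sub>1\<close> and a \<open>\<Pi>\<^sub>1\<close> formula with the same
  parameters. At least two argument positions are kept, for the element and the witness.\<close>

lemma isS_formula:
  assumes "isS (\<lambda>\<sigma>. P (\<sigma> 0))" "isS (\<lambda>\<sigma>. Q (\<sigma> 0))"
  obtains \<phi> \<psi> \<tau> \<rho> where "Delta0 \<phi>" "Delta0 \<psi>" "range \<rho> \<subseteq> sets"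
    "\<And>x. P x \<longleftrightarrow> sat M (case_nat x \<tau>) \<rho> (ExN \<phi>)" "\<And>x. Q x \<longleftrightarrow> sat M (case_nat x \<tau>) \<rho> (ExN \<psi>)"
proof -
  obtain P' where P': "isD P'" "\<And>\<sigma>. P (\<sigma> 0) \<longleftrightarrow> (\<exists>x. P' (case_nat x \<sigma>))"
    using assms(1) unfolding isS_def by (elim exE conjE) (rule that, simp_all)
  obtain Q' where Q': "isD Q'" "\<And>\<sigma>. Q (\<sigma> 0) \<longleftrightarrow> (\<exists>x. Q' (case_nat x \<sigma>))"
    using assms(2) unfolding isS_def by (elim exE conjE) (rule that, simp_all)
  obtain k \<tau> \<rho> \<phi> \<psi> where k: "2 \<le> k" "range \<rho> \<subseteq> sets" "Delta0 \<phi>" "Delta0 \<psi>"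
    "\<And>\<sigma>. P' \<sigma> \<longleftrightarrow> sat M (env k \<sigma> \<tau>) \<rho> \<phi>" "\<And>\<sigma>. Q' \<sigma> \<longleftrightarrow> sat M (env k \<sigma> \<tau>) \<rho> \<psi>"
    by (rule isD_merge[OF P'(1) Q'(1), of 2]) (rule that)
  define \<tau>' where "\<tau>' = env (k - 2) (\<lambda>_. \<zero>) \<tau>"
  have "env k (case_nat y (case_nat x (\<lambda>_. \<zero>))) \<tau> = case_nat y (case_nat x \<tau>')" for x y
  proof
    fix n show "env k (case_nat y (case_nat x (\<lambda>_. \<zero>))) \<tau> n = case_nat y (case_nat x \<tau>') n"
    proof (cases n)
      case (Suc m)
      then show ?thesis using k(1)
        by (cases m) (auto simp: env_def \<tau>'_def diff_diff_left[symmetric])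
    qed (use k(1) in \<open>simp add: env_def\<close>)
  qed
  then have "P x \<longleftrightarrow> sat M (case_nat x \<tau>') \<rho> (ExN \<phi>)" "Q x \<longleftrightarrow> sat M (case_nat x \<tau>') \<rho> (ExN \<psi>)" for x
    using P'(2)[of "case_nat x (\<lambda>_. \<zero>)"] Q'(2)[of "case_nat x (\<lambda>_. \<zero>)"] by (simp_all add: k)
  with k(3,4,2) show thesis by (rule that)
qed

lemma isS_induct:
  assumes S: "isS (\<lambda>\<sigma>. P (\<sigma> 0))" and 0: "P \<zero>" and Suc: "\<And>x. P x \<Longrightarrow> P (x \<oplus> \<one>)"
  shows "P x"
proof -
  obtain \<xi> \<tau> \<rho> where \<xi>: "Sigma1 \<xi>" "range \<rho> \<subseteq> sets" "\<And>x. sat M (case_nat x \<tau>) \<rho> \<xi> \<longleftrightarrow> P x"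
    by (rule isS_formula[OF S S]) (rule that, auto simp: Sigma1_def)
  have "induction_axiom \<xi> \<in> RCA0"
    using \<xi>(1) by (auto simp: RCA0_def)
  then have ind: "sat M \<tau> \<rho> (induction_axiom \<xi>)"
    using axioms \<xi>(2) unfolding models_def by blast
  have "(\<lambda>n. val M \<tau> (case n of 0 \<Rightarrow> Zero | Suc n \<Rightarrow> Var n)) = case_nat \<zero> \<tau>"
    by (auto split: nat.split)
  then have base: "sat M \<tau> \<rho> (instN Zero \<xi>) \<longleftrightarrow> P \<zero>"
    unfolding instN_def sat_subst \<xi>(3)[symmetric] by simp
  have "(\<lambda>n. val M (case_nat x \<tau>) (case n of 0 \<Rightarrow> Add (Var 0) One | Suc n \<Rightarrow> Var (Suc n))) =
      case_nat (x \<oplus> \<one>) \<tau>" for x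
    by (rule ext) (simp split: nat.split)
  then have step: "sat M (case_nat x \<tau>) \<rho>
      (subst (case_nat (Add (Var 0) One) (\<lambda>n. Var (Suc n))) id \<xi>) \<longleftrightarrow> P (x \<oplus> \<one>)" for x
    unfolding sat_subst \<xi>(3)[symmetric] by simp
  have "\<forall>x. P x"
    using ind 0 Suc by (simp add: induction_axiom_def base step \<xi>(3))
  then show ?thesis ..
qed

lemma comprehension:
  assumes "isS (\<lambda>\<sigma>. P (\<sigma> 0))" "isS (\<lambda>\<sigma>. \<not> P (\<sigma> 0))"
  shows "{x. P x} \<in> sets"
proof -
  obtain \<phi> \<psi> \<tau> \<rho> where \<phi>: "Delta0 \<phi>" "Delta0 \<psi>" "range \<rho> \<subseteq> sets"
    "\<And>x. P x \<longleftrightarrow> sat M (case_nat x \<tau>) \<rho> (ExN \<phi>)" "\<And>x. \<not> P x \<longleftrightarrow> sat M (case_nat x \<tau>) \<rho> (ExN \<psi>)"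
    by (rule isS_formula[OF assms]) (rule that)
  define \<xi> where "\<xi> = ExN \<phi>"
  define \<zeta> where "\<zeta> = AllN (Neg \<psi>)"
  have \<xi>: "Sigma1 \<xi>" "sat M (case_nat x \<tau>) \<rho> \<xi> \<longleftrightarrow> P x" for x
    using \<phi>(1,4) by (auto simp: \<xi>_def Sigma1_def)
  have \<zeta>: "Pi1 \<zeta>" using \<phi>(2) unfolding \<zeta>_def Pi1_def by (blast intro: Delta0.intros)
  have \<zeta>_sat: "sat M (case_nat x \<tau>) \<rho> \<zeta> \<longleftrightarrow> P x" for x
    using \<phi>(5)[of x] unfolding \<zeta>_def by simp blast
  have "comprehension_axiom \<xi> \<zeta> \<in> RCA0"
    using \<xi>(1) \<zeta> unfolding RCA0_def by blast
  then have "sat M \<tau> \<rho> (comprehension_axiom \<xi> \<zeta>)"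
    using axioms \<phi>(3) unfolding models_def by blast
  moreover have "sat M (case_nat x \<tau>) (case_nat A \<rho>) (liftS \<xi>) \<longleftrightarrow> P x" for x A
    unfolding liftS_def sat_subst \<xi>(2)[symmetric] by simp
  ultimately have "\<exists>A\<in>sets. \<forall>x. x \<in> A \<longleftrightarrow> P x"
    by (simp add: comprehension_axiom_def \<xi>(2) \<zeta>_sat) blast
  then obtain A where "A \<in> sets" "\<forall>x. x \<in> A \<longleftrightarrow> P x" ..
  then have "A = {x. P x}" by blast
  with \<open>A \<in> sets\<close> show ?thesis by simp
qed

lemma comprehension_D: "isD (\<lambda>\<sigma>. P (\<sigma> 0)) \<Longrightarrow> {x. P x} \<in> sets"
  by (intro comprehension isS_isD isD_not)

lemma isD_induct:
  "isD (\<lambda>\<sigma>. P (\<sigma> 0)) \<Longrightarrow> P \<zero> \<Longrightarrow> (\<And>x. P x \<Longrightarrow> P (x \<oplus> \<one>)) \<Longrightarrow> P x"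
  using isS_induct isS_isD by blast

subsection \<open>Arithmetic\<close>

lemma sat_basic: "\<phi> \<in> basic_axioms \<Longrightarrow> \<exists>\<rho>. sat M \<sigma> \<rho> \<phi>"
proof -
  assume "\<phi> \<in> basic_axioms"
  then have "models M \<phi>" by (intro axioms) (simp add: RCA0_def)
  moreover obtain A where "A \<in> sets" using sets_nonempty by blast
  then have "range (\<lambda>_::nat. A) \<subseteq> sets" by auto
  ultimately show ?thesis unfolding models_def by blast
qed

lemma
  shows add_one_neq_zero [simp]: "x \<oplus> \<one> \<noteq> \<zero>"
    and add_one_inject: "x \<oplus> \<one> = y \<oplus> \<one> \<longleftrightarrow> x = y"
    and plus_zero: "x \<oplus> \<zero> = x"
    and plus_add_one: "x \<oplus> (y \<oplus> \<one>) = x \<oplus> y \<oplus> \<one>"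
    and times_zero: "x \<otimes> \<zero> = \<zero>"
    and times_add_one: "x \<otimes> (y \<oplus> \<one>) = x \<otimes> y \<oplus> x"
    and not_less_zero [simp]: "\<not> x \<prec> \<zero>"
    and less_add_one_iff: "x \<prec> y \<oplus> \<one> \<longleftrightarrow> x \<prec> y \<or> x = y"
proof -
  have sat: "\<forall>\<phi>\<in>basic_axioms. \<exists>\<rho>. sat M (case_nat x (\<lambda>_. y)) \<rho> \<phi>" for x y
    using sat_basic by blast
  show "x \<oplus> \<one> \<noteq> \<zero>" using sat[of x x] by (simp add: basic_axioms_def Let_def)
  show "x \<oplus> \<one> = y \<oplus> \<one> \<longleftrightarrow> x = y" using sat[of x y] by (auto simp: basic_axioms_def Let_def)
  show "x \<oplus> \<zero> = x" using sat[of x y] by (simp add: basic_axioms_def Let_def)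
  show "x \<oplus> (y \<oplus> \<one>) = x \<oplus> y \<oplus> \<one>" using sat[of x y] by (simp add: basic_axioms_def Let_def)
  show "x \<otimes> \<zero> = \<zero>" using sat[of x y] by (simp add: basic_axioms_def Let_def)
  show "x \<otimes> (y \<oplus> \<one>) = x \<otimes> y \<oplus> x" using sat[of x y] by (simp add: basic_axioms_def Let_def)
  show "\<not> x \<prec> \<zero>" using sat[of x y] by (simp add: basic_axioms_def Let_def)
  show "x \<prec> y \<oplus> \<one> \<longleftrightarrow> x \<prec> y \<or> x = y" using sat[of x y] by (simp add: basic_axioms_def Let_def) blast
qed

lemma plus_assoc: "x \<oplus> y \<oplus> z = x \<oplus> (y \<oplus> z)"
  by (rule isD_induct[where P = "\<lambda>z. x \<oplus> y \<oplus> z = x \<oplus> (y \<oplus> z)"], intro dfn)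
    (simp_all add: plus_zero plus_add_one)

lemma zero_plus: "\<zero> \<oplus> x = x"
  by (rule isD_induct[where P = "\<lambda>x. \<zero> \<oplus> x = x"], intro dfn)
    (simp_all add: plus_zero plus_add_one)

lemma one_plus: "\<one> \<oplus> x = x \<oplus> \<one>"
  by (rule isD_induct[where P = "\<lambda>x. \<one> \<oplus> x = x \<oplus> \<one>"], intro dfn)
    (simp_all add: plus_zero zero_plus plus_add_one)

lemma plus_commute: "x \<oplus> y = y \<oplus> x"
proof (rule isD_induct[where P = "\<lambda>y. x \<oplus> y = y \<oplus> x"], intro dfn)
  show "x \<oplus> (y \<oplus> \<one>) = y \<oplus> \<one> \<oplus> x" if "x \<oplus> y = y \<oplus> x" for y
    using that by (simp only: plus_assoc[of y \<one> x] one_plus plus_add_one)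
qed (simp add: plus_zero zero_plus)

lemma times_plus: "x \<otimes> (y \<oplus> z) = x \<otimes> y \<oplus> x \<otimes> z"
  by (rule isD_induct[where P = "\<lambda>z. x \<otimes> (y \<oplus> z) = x \<otimes> y \<oplus> x \<otimes> z"], intro dfn)
    (simp_all add: plus_zero times_zero plus_add_one times_add_one plus_assoc[symmetric])

lemma times_one: "x \<otimes> \<one> = x"
  using times_add_one[of x \<zero>] by (simp add: times_zero zero_plus)

lemma times_assoc: "x \<otimes> y \<otimes> z = x \<otimes> (y \<otimes> z)"
  by (rule isD_induct[where P = "\<lambda>z. x \<otimes> y \<otimes> z = x \<otimes> (y \<otimes> z)"], intro dfn)
    (simp_all add: times_zero times_one times_plus)

lemma zero_times: "\<zero> \<otimes> x = \<zero>"
  by (rule isD_induct[where P = "\<lambda>x. \<zero> \<otimes> x = \<zero>"], intro dfn)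
    (simp_all add: times_zero times_add_one plus_zero)

lemma plus_left_commute: "x \<oplus> (y \<oplus> z) = y \<oplus> (x \<oplus> z)"
  by (metis plus_assoc plus_commute)

lemma plus_times: "(x \<oplus> y) \<otimes> z = x \<otimes> z \<oplus> y \<otimes> z"
  by (rule isD_induct[where P = "\<lambda>z. (x \<oplus> y) \<otimes> z = x \<otimes> z \<oplus> y \<otimes> z"], intro dfn)
    (simp_all add: times_zero times_add_one plus_zero plus_assoc plus_left_commute)

lemma one_times: "\<one> \<otimes> x = x"
  by (rule isD_induct[where P = "\<lambda>x. \<one> \<otimes> x = x"], intro dfn)
    (simp_all add: times_zero times_add_one)

lemma times_commute: "x \<otimes> y = y \<otimes> x"
  by (rule isD_induct[where P = "\<lambda>y. x \<otimes> y = y \<otimes> x"], intro dfn)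
    (simp_all add: times_zero zero_times times_add_one plus_times one_times)

lemma plus_right_cancel: "x \<oplus> z = y \<oplus> z \<Longrightarrow> x = y"
proof -
  have "x \<oplus> z = y \<oplus> z \<longrightarrow> x = y"
    by (rule isD_induct[where P = "\<lambda>z. x \<oplus> z = y \<oplus> z \<longrightarrow> x = y"], intro dfn)
      (simp_all add: plus_zero plus_add_one add_one_inject)
  then show "x \<oplus> z = y \<oplus> z \<Longrightarrow> x = y" ..
qed

text \<open>The axioms describe the order only at zero and at successors. Induction turns it into
  the existence of a difference, from which the order laws follow algebraically.\<close>

lemma less_iff: "x \<prec> y \<longleftrightarrow> (\<exists>z. y = x \<oplus> z \<oplus> \<one>)"
proof
  assume "x \<prec> y"
  moreover have "x \<prec> y \<longrightarrow> (\<exists>z. y = x \<oplus> z \<oplus> \<one>)"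
  proof (rule isS_induct[where P = "\<lambda>y. x \<prec> y \<longrightarrow> (\<exists>z. y = x \<oplus> z \<oplus> \<one>)"])
    show "isS (\<lambda>\<sigma>. x \<prec> \<sigma> 0 \<longrightarrow> (\<exists>z. \<sigma> 0 = x \<oplus> z \<oplus> \<one>))"
      by (rule isS_imp, intro dfn, rule isS_ex, intro dfn)
    show "x \<prec> y \<oplus> \<one> \<longrightarrow> (\<exists>z. y \<oplus> \<one> = x \<oplus> z \<oplus> \<one>)" if "x \<prec> y \<longrightarrow> (\<exists>z. y = x \<oplus> z \<oplus> \<one>)" for y
    proof
      assume "x \<prec> y \<oplus> \<one>"
      then consider "x \<prec> y" | "y = x" by (auto simp: less_add_one_iff)
      then show "\<exists>z. y \<oplus> \<one> = x \<oplus> z \<oplus> \<one>"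
      proof cases
        case 1
        with that obtain z where "y = x \<oplus> (z \<oplus> \<one>)" by (auto simp: plus_assoc)
        then show ?thesis by blast
      next
        case 2
        then show ?thesis by (intro exI[of _ \<zero>]) (simp add: plus_zero)
      qed
    qed
  qed simp
  ultimately show "\<exists>z. y = x \<oplus> z \<oplus> \<one>" by blast
next
  have "x \<prec> x \<oplus> z \<oplus> \<one>" for z
    by (rule isD_induct[where P = "\<lambda>z. x \<prec> x \<oplus> z \<oplus> \<one>"], intro dfn)
      (simp_all add: plus_zero less_add_one_iff plus_add_one)
  then show "\<exists>z. y = x \<oplus> z \<oplus> \<one> \<Longrightarrow> x \<prec> y" by blast
qed

lemma zero_or_add_one: "x = \<zero> \<or> (\<exists>y. x = y \<oplus> \<one>)"
proof (rule isS_induct[where P = "\<lambda>x. x = \<zero> \<or> (\<exists>y. x = y \<oplus> \<one>)"])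
  have "isS (\<lambda>\<sigma>. \<sigma> 0 \<noteq> \<zero> \<longrightarrow> (\<exists>y. \<sigma> 0 = y \<oplus> \<one>))"
    by (rule isS_imp, intro dfn, rule isS_ex, intro dfn)
  then show "isS (\<lambda>\<sigma>. \<sigma> 0 = \<zero> \<or> (\<exists>y. \<sigma> 0 = y \<oplus> \<one>))" by (simp add: disj_imp)
qed auto

lemma less_linear: "x \<prec> y \<or> x = y \<or> y \<prec> x"
proof (rule isD_induct[where P = "\<lambda>x. x \<prec> y \<or> x = y \<or> y \<prec> x"], intro dfn)
  show "\<zero> \<prec> y \<or> \<zero> = y \<or> y \<prec> \<zero>"
    using zero_or_add_one[of y] by (auto simp: less_iff[of \<zero>] zero_plus)
  show "x \<oplus> \<one> \<prec> y \<or> x \<oplus> \<one> = y \<or> y \<prec> x \<oplus> \<one>" if IH: "x \<prec> y \<or> x = y \<or> y \<prec> x" for x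
  proof -
    consider z where "y = x \<oplus> z \<oplus> \<one>" | "x = y \<or> y \<prec> x" using IH unfolding less_iff[of x y] by iprover
    then show ?thesis
    proof cases
      case 1
      have "x \<oplus> (w \<oplus> \<one>) \<oplus> \<one> = x \<oplus> \<one> \<oplus> w \<oplus> \<one>" for w
        by (simp only: plus_assoc plus_commute[of \<one> w] plus_assoc[of x \<one> w])
      with 1 show ?thesis using zero_or_add_one[of z]
        by (auto simp: plus_zero less_iff[of "x \<oplus> \<one>"])
    qed (auto simp: less_add_one_iff)
  qed
qed

definition leq (infix \<open>\<preceq>\<close> 50) where "x \<preceq> y \<longleftrightarrow> x \<prec> y \<or> x = y"

lemma leq_iff: "x \<preceq> y \<longleftrightarrow> (\<exists>z. y = x \<oplus> z)"
  unfolding leq_def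
proof
  assume "x \<prec> y \<or> x = y"
  then show "\<exists>z. y = x \<oplus> z"
    by (auto simp: less_iff plus_assoc intro: exI[of _ \<zero>] plus_zero[symmetric])
next
  assume "\<exists>z. y = x \<oplus> z"
  then obtain z where z: "y = x \<oplus> z" ..
  show "x \<prec> y \<or> x = y"
    using zero_or_add_one[of z] by (auto simp: z plus_zero less_iff plus_assoc)
qed

lemma leq_plus_iff: "x \<preceq> x \<oplus> z"
  unfolding leq_iff by blast

text \<open>Truncated subtraction is not in the language; it is introduced so that the model can be
  made an instance of \<open>linordered_semidom\<close>, whose algebraic and order rules then
  apply.\<close>

definition minus (infixl \<open>\<ominus>\<close> 65) where
  "x \<ominus> y = (if y \<preceq> x then (THE z. x = y \<oplus> z) else \<zero>)"

lemma plus_left_cancel: "z \<oplus> x = z \<oplus> y \<Longrightarrow> x = y"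
  using plus_right_cancel plus_commute by metis

lemma plus_minus: "(x \<oplus> y) \<ominus> x = y"
proof -
  have "(THE z. x \<oplus> y = x \<oplus> z) = y"
    by (rule the_equality) (auto dest: plus_left_cancel)
  then show ?thesis using leq_plus_iff[of x y] by (simp add: minus_def)
qed

lemma minus_eq_zero: "\<not> y \<preceq> x \<Longrightarrow> x \<ominus> y = \<zero>"
  unfolding minus_def by (rule if_not_P)

lemma less_irrefl: "\<not> x \<prec> x"
proof
  assume "x \<prec> x"
  then obtain z where "x = x \<oplus> (z \<oplus> \<one>)" by (auto simp: less_iff plus_assoc)
  then have "x \<oplus> (z \<oplus> \<one>) = x \<oplus> \<zero>" by (simp add: plus_zero)
  then show False by (auto dest: plus_left_cancel)
qed

lemma less_trans: "x \<prec> y \<Longrightarrow> y \<prec> z \<Longrightarrow> x \<prec> z"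
proof -
  assume "x \<prec> y" "y \<prec> z"
  then obtain u v where "y = x \<oplus> u \<oplus> \<one>" "z = y \<oplus> v \<oplus> \<one>" by (auto simp: less_iff)
  then have "z = x \<oplus> (u \<oplus> \<one> \<oplus> v) \<oplus> \<one>" by (simp add: plus_assoc)
  then show ?thesis unfolding less_iff by blast
qed

lemma zero_minus: "\<zero> \<ominus> x = \<zero>"
proof (cases "x = \<zero>")
  case True
  then show ?thesis using plus_minus[of \<zero> \<zero>] by (simp add: plus_zero)
next
  case False
  then show ?thesis by (intro minus_eq_zero) (simp add: leq_def)
qed

lemma minus_minus: "x \<ominus> y \<ominus> z = x \<ominus> (y \<oplus> z)"
proof (cases "y \<oplus> z \<preceq> x")
  case True
  then obtain w where "x = y \<oplus> z \<oplus> w" unfolding leq_iff by blast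
  then show ?thesis by (simp only: plus_minus) (simp only: plus_assoc plus_minus)
next
  case False
  show ?thesis
  proof (cases "y \<preceq> x")
    case True
    then obtain w where w: "x = y \<oplus> w" unfolding leq_iff by blast
    have "\<not> z \<preceq> w"
      using False unfolding leq_iff w plus_assoc by (auto simp: plus_assoc)
    then show ?thesis using minus_eq_zero[OF False] minus_eq_zero[of z w] by (simp add: w plus_minus)
  next
    case nle: False
    then show ?thesis using minus_eq_zero[OF False] by (simp add: minus_eq_zero zero_minus)
  qed
qed

lemma times_minus: "x \<otimes> (y \<ominus> z) = x \<otimes> y \<ominus> x \<otimes> z"
proof (cases "z \<preceq> y")
  case True
  then obtain w where "y = z \<oplus> w" unfolding leq_iff by blast
  then show ?thesis by (simp add: plus_minus times_plus)
next
  case False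
  then obtain w where w: "z = y \<oplus> w"
    using less_linear[of y z] leq_iff[of y z] unfolding leq_def by blast
  have "x \<otimes> y \<ominus> x \<otimes> z = (x \<otimes> y \<ominus> x \<otimes> y) \<ominus> x \<otimes> w"
    by (simp only: w times_plus minus_minus)
  also have "x \<otimes> y \<ominus> x \<otimes> y = \<zero>"
    using plus_minus[of "x \<otimes> y" \<zero>] by (simp add: plus_zero)
  also have "\<zero> \<ominus> x \<otimes> w = \<zero>" by (rule zero_minus)
  finally show ?thesis using minus_eq_zero[OF False] by (simp add: times_zero)
qed

lemma less_leq_not_leq: "x \<prec> y \<longleftrightarrow> x \<preceq> y \<and> \<not> y \<preceq> x"
  unfolding leq_def using less_trans less_irrefl by blast

lemma leq_refl: "x \<preceq> x"
  by (simp add: leq_def)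

lemma leq_trans: "x \<preceq> y \<Longrightarrow> y \<preceq> z \<Longrightarrow> x \<preceq> z"
  unfolding leq_def using less_trans by blast

lemma leq_antisym: "x \<preceq> y \<Longrightarrow> y \<preceq> x \<Longrightarrow> x = y"
  unfolding leq_def using less_trans less_irrefl by blast

lemma leq_linear: "x \<preceq> y \<or> y \<preceq> x"
  unfolding leq_def using less_linear by blast

lemma plus_left_mono: "x \<preceq> y \<Longrightarrow> z \<oplus> x \<preceq> z \<oplus> y"
  unfolding leq_iff by (auto simp: plus_assoc)

lemma times_strict_left_mono: "x \<prec> y \<Longrightarrow> \<zero> \<prec> z \<Longrightarrow> z \<otimes> x \<prec> z \<otimes> y"
proof -
  assume "x \<prec> y" "\<zero> \<prec> z"
  then obtain u v where u: "y = x \<oplus> u \<oplus> \<one>" and v: "z = v \<oplus> \<one>"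
    by (auto simp: less_iff zero_plus)
  have "z \<otimes> y = z \<otimes> x \<oplus> z \<otimes> u \<oplus> z"
    unfolding u by (simp only: times_plus times_one)
  also have "\<dots> = z \<otimes> x \<oplus> (z \<otimes> u \<oplus> v) \<oplus> \<one>"
    by (subst (3) v) (simp only: plus_assoc)
  finally show ?thesis unfolding less_iff by blast
qed

lemma zero_less_one: "\<zero> \<prec> \<one>"
  unfolding less_iff by (rule exI[of _ \<zero>]) (simp add: zero_plus)

lemma zero_neq_one: "\<zero> \<noteq> \<one>"
  using zero_less_one less_irrefl by metis

lemma no_zero_divisors: "x \<noteq> \<zero> \<Longrightarrow> y \<noteq> \<zero> \<Longrightarrow> x \<otimes> y \<noteq> \<zero>"
  using times_strict_left_mono[of \<zero> y x] less_linear[of \<zero> x] less_linear[of \<zero> y] less_irrefl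
  by (auto simp: times_zero)

lemma minus_plus: "y \<preceq> x \<Longrightarrow> x \<ominus> y \<oplus> y = x"
  unfolding leq_iff by (auto simp: plus_minus plus_commute[of "x \<ominus> y" y])

lemmas semidom_laws = plus_assoc plus_commute plus_minus minus_minus less_leq_not_leq leq_refl
  leq_trans leq_antisym leq_linear plus_left_mono plus_times times_plus zero_plus plus_zero
  zero_times times_zero times_strict_left_mono times_assoc times_commute one_times times_one
  zero_neq_one no_zero_divisors times_minus zero_less_one minus_plus

sublocale linordered_semidom plus minus leq less zero times one
  by unfold_locales (fact semidom_laws)+

end

section \<open>Bounded quantifiers and extrema of \<open>\<Sigma>\<^sub>1\<close> sets\<close>

context rca_model
begin

declare one_add_one [simp del] \<comment> \<open>it introduces numerals of the interpreted class\<close>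

lemma zero_leq [simp]: "\<zero> \<preceq> x"
  using less_linear[of \<zero> x] by (auto simp: leq_def)

lemma less_iff_add_one_leq: "x \<prec> y \<longleftrightarrow> x \<oplus> \<one> \<preceq> y"
  unfolding leq_iff less_iff by (auto simp: add_ac)

lemma less_add_one_iff_leq: "x \<prec> y \<oplus> \<one> \<longleftrightarrow> x \<preceq> y"
  by (simp add: leq_def less_add_one_iff)

lemma leq_times_add_one: "x \<preceq> x \<otimes> (y \<oplus> \<one>)"
  by (simp add: distrib_left leq_iff) (metis add_commute)

lemma plus_eq_zeroD: "x \<oplus> y = \<zero> \<Longrightarrow> y = \<zero>"
  using zero_or_add_one[of y] by (auto simp: plus_add_one)

lemma isD_leq [dfn]: "isT f \<Longrightarrow> isT g \<Longrightarrow> isD (\<lambda>\<sigma>. f \<sigma> \<preceq> g \<sigma>)"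
  unfolding leq_def by (intro dfn)

lemma isD_ball_leq [dfn]:
  assumes "isT f" "isD (\<lambda>\<sigma>. P (\<sigma> 0) (\<lambda>n. \<sigma> (Suc n)))"
  shows "isD (\<lambda>\<sigma>. \<forall>x. x \<preceq> f \<sigma> \<longrightarrow> P x \<sigma>)"
  using isD_ball[OF isT_add[OF assms(1) isT_const[of \<one>]] assms(2)] by (simp only: less_add_one_iff_leq)

lemma isD_bex_leq [dfn]:
  assumes "isT f" "isD (\<lambda>\<sigma>. P (\<sigma> 0) (\<lambda>n. \<sigma> (Suc n)))"
  shows "isD (\<lambda>\<sigma>. \<exists>x. x \<preceq> f \<sigma> \<and> P x \<sigma>)"
  using isD_bex[OF isT_add[OF assms(1) isT_const[of \<one>]] assms(2)] by (simp only: less_add_one_iff_leq)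

lemma isD_swap: "isD (\<lambda>\<sigma>. Q (\<sigma> 0) (\<sigma> 1)) \<Longrightarrow> isD (\<lambda>\<sigma>. Q (\<sigma> 1) (\<sigma> 0))"
  using isD_rename[of "\<lambda>\<sigma>. Q (\<sigma> 0) (\<sigma> 1)" "\<lambda>n. if n = 0 then 1 else 0"] by simp

text \<open>Strong induction would run over a \<open>\<Pi>\<^sub>1\<close> statement. Instead, if
  there is no least element, one descends from \<open>a\<close> and counts the steps: after
  \<open>j\<close> of them an element \<open>y\<close> with \<open>y \<oplus> j \<preceq> a\<close>
  is reached, which is absurd for \<open>j = a \<oplus> \<one>\<close>.\<close>

lemma Sigma1_least:
  assumes D: "isD (\<lambda>\<sigma>. Q (\<sigma> 0) (\<sigma> 1))" and "Q w a"
  obtains y v where "Q v y" "\<And>z w. z \<prec> y \<Longrightarrow> \<not> Q w z"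
proof (rule ccontr)
  note obtained = that
  assume "\<not> thesis"
  then have least: "\<exists>z\<in>{z. z \<prec> y}. \<exists>w. Q w z" if "Q v y" for v y
    using that obtained by blast
  \<comment> \<open>The conjunct \<open>y \<preceq> a\<close> makes the quantifier over
    \<open>y\<close> bounded, leaving \<open>v\<close> as the only unbounded one.\<close>
  have "\<exists>v. \<exists>y. y \<preceq> a \<and> (y \<oplus> j \<preceq> a \<and> Q v y)" for j
  proof (rule isS_induct[where P = "\<lambda>j. \<exists>v. \<exists>y. y \<preceq> a \<and> (y \<oplus> j \<preceq> a \<and> Q v y)"])
    have "isD (\<lambda>\<sigma>. Q (\<sigma> 1) (\<sigma> 0))" using D by (rule isD_swap)
    then show "isS (\<lambda>\<sigma>. \<exists>v. \<exists>y. y \<preceq> a \<and> (y \<oplus> \<sigma> 0 \<preceq> a \<and> Q v y))"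
      by (intro isS_ex dfn) simp
    show "\<exists>v y. y \<preceq> a \<and> (y \<oplus> \<zero> \<preceq> a \<and> Q v y)" using \<open>Q w a\<close> by auto
    show "\<exists>v y. y \<preceq> a \<and> (y \<oplus> (j \<oplus> \<one>) \<preceq> a \<and> Q v y)"
      if IH: "\<exists>v y. y \<preceq> a \<and> (y \<oplus> j \<preceq> a \<and> Q v y)" for j
    proof -
      obtain v y where y: "y \<oplus> j \<preceq> a" "Q v y" using IH by blast
      obtain z u where z: "z \<prec> y" "Q u z" using least[OF y(2)] by blast
      have "z \<oplus> (j \<oplus> \<one>) = (z \<oplus> \<one>) \<oplus> j" by (simp add: add_ac)
      also have "\<dots> \<preceq> y \<oplus> j" using z(1) by (simp add: less_iff_add_one_leq)
      also note y(1)
      finally have "z \<oplus> (j \<oplus> \<one>) \<preceq> a" .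
      moreover have "z \<preceq> z \<oplus> (j \<oplus> \<one>)" by (rule leq_plus_iff)
      ultimately show ?thesis using z(2) leq_trans by blast
    qed
  qed
  from this[of "a \<oplus> \<one>"] obtain y where "y \<oplus> (a \<oplus> \<one>) \<preceq> a" by blast
  moreover have "a \<prec> y \<oplus> (a \<oplus> \<one>)" unfolding less_iff by (auto simp: add_ac)
  ultimately show False by simp
qed

text \<open>The mirror image of the descent: without a greatest element the set would reach every
  \<open>j\<close>, in particular one beyond the bound \<open>b\<close>.\<close>

lemma Sigma1_greatest:
  assumes D: "isD (\<lambda>\<sigma>. Q (\<sigma> 0) (\<sigma> 1))" and "Q w a" and bound: "\<And>v y. Q v y \<Longrightarrow> y \<preceq> b"
  obtains y v where "Q v y" "\<And>w z. Q w z \<Longrightarrow> z \<preceq> y"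
proof (rule ccontr)
  note obtained = that
  assume "\<not> thesis"
  then have step: "\<exists>w z. Q w z \<and> y \<prec> z" if "Q v y" for v y
    using that obtained by (meson not_le)
  have "\<exists>v. \<exists>y. y \<preceq> b \<and> (j \<preceq> y \<and> Q v y)" for j
  proof (rule isS_induct[where P = "\<lambda>j. \<exists>v. \<exists>y. y \<preceq> b \<and> (j \<preceq> y \<and> Q v y)"])
    have "isD (\<lambda>\<sigma>. Q (\<sigma> 1) (\<sigma> 0))" using D by (rule isD_swap)
    then show "isS (\<lambda>\<sigma>. \<exists>v. \<exists>y. y \<preceq> b \<and> (\<sigma> 0 \<preceq> y \<and> Q v y))"
      by (intro isS_ex dfn) simp
    show "\<exists>v y. y \<preceq> b \<and> (\<zero> \<preceq> y \<and> Q v y)" using \<open>Q w a\<close> bound by auto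
    show "\<exists>v y. y \<preceq> b \<and> (j \<oplus> \<one> \<preceq> y \<and> Q v y)"
      if IH: "\<exists>v y. y \<preceq> b \<and> (j \<preceq> y \<and> Q v y)" for j
    proof -
      obtain v y where y: "j \<preceq> y" "Q v y" using IH by blast
      obtain u z where z: "y \<prec> z" "Q u z" using step[OF y(2)] by blast
      have "j \<oplus> \<one> \<preceq> z" using y(1) z(1) unfolding less_iff_add_one_leq[symmetric] by (rule le_less_trans)
      then show ?thesis using z(2) bound by blast
    qed
  qed
  from this[of "b \<oplus> \<one>"] obtain y where "y \<preceq> b" "b \<oplus> \<one> \<preceq> y" by blast
  then show False by (simp add: less_iff_add_one_leq[symmetric])
qed

subsection \<open>Pairs\<close>

definition pr :: "'a \<Rightarrow> 'a \<Rightarrow> 'a" where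
  "pr x y = (x \<oplus> y) \<otimes> (x \<oplus> y) \<oplus> x"

lemma isT_pr [dfn]: "isT f \<Longrightarrow> isT g \<Longrightarrow> isT (\<lambda>\<sigma>. pr (f \<sigma>) (g \<sigma>))"
  unfolding pr_def by (intro dfn)

text \<open>Pairs with sum \<open>s\<close> have codes from the square of \<open>s\<close> up to
  that square plus \<open>s\<close>, below the next square. Hence a code determines the sum, and
  then the first component.\<close>

lemma pr_less: "x \<oplus> y \<prec> u \<oplus> v \<Longrightarrow> pr x y \<prec> pr u v"
proof -
  assume "x \<oplus> y \<prec> u \<oplus> v"
  define s where "s = x \<oplus> y"
  define t where "t = u \<oplus> v"
  have st: "s \<oplus> \<one> \<preceq> t" using \<open>x \<oplus> y \<prec> u \<oplus> v\<close> by (simp add: s_def t_def less_iff_add_one_leq)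
  have "pr x y \<preceq> s \<otimes> s \<oplus> s" by (simp add: pr_def s_def leq_plus_iff)
  also have "\<dots> \<prec> (s \<oplus> \<one>) \<otimes> (s \<oplus> \<one>)"
    unfolding less_iff by (rule exI[of _ s]) (simp add: algebra_simps)
  also have "\<dots> \<preceq> t \<otimes> t" using st by (intro mult_mono) auto
  also have "\<dots> \<preceq> pr u v" by (simp add: pr_def t_def leq_plus_iff)
  finally show ?thesis .
qed

lemma pr_eq_iff [simp]: "pr x y = pr u v \<longleftrightarrow> x = u \<and> y = v"
proof
  assume eq: "pr x y = pr u v"
  then have sum: "x \<oplus> y = u \<oplus> v"
    using pr_less[of x y u v] pr_less[of u v x y] less_linear by (metis less_irrefl)
  with eq have "x = u" by (simp add: pr_def)
  with sum show "x = u \<and> y = v" by simp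
qed simp

lemma leq_pr1 [simp]: "x \<preceq> pr x y"
  unfolding pr_def leq_iff by (metis add_commute)

lemma leq_square: "x \<preceq> x \<otimes> x"
  using zero_or_add_one[of x] leq_times_add_one[of x] by auto

lemma leq_pr2 [simp]: "y \<preceq> pr x y"
proof -
  have "y \<preceq> x \<oplus> y" unfolding leq_iff by (metis add_commute)
  also have "\<dots> \<preceq> (x \<oplus> y) \<otimes> (x \<oplus> y)" by (rule leq_square)
  also have "\<dots> \<preceq> pr x y" unfolding pr_def by (rule leq_plus_iff)
  finally show ?thesis .
qed

lemma pr_less_mono: "x \<preceq> u \<Longrightarrow> y \<prec> v \<Longrightarrow> pr x y \<prec> pr u v"
  by (intro pr_less add_le_less_mono)

subsection \<open>Codes of finite sets\<close>

text \<open>Bounding the quotient by \<open>b\<close> makes divisibility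
  \<open>\<Delta>\<^sub>0\<close>; for divisors of the form \<open>a \<oplus> \<one>\<close> the
  bound holds automatically, see \<open>dv_iff\<close>.\<close>

definition dv :: "'a \<Rightarrow> 'a \<Rightarrow> bool" where
  "dv a b \<longleftrightarrow> (\<exists>q. q \<preceq> b \<and> b = q \<otimes> a)"

lemma isD_dv [dfn]: "isT f \<Longrightarrow> isT g \<Longrightarrow> isD (\<lambda>\<sigma>. dv (f \<sigma>) (g \<sigma>))"
  unfolding dv_def by (intro dfn; rule isT_rename)

lemma dv_iff: "dv (a \<oplus> \<one>) b \<longleftrightarrow> (\<exists>q. b = q \<otimes> (a \<oplus> \<one>))"
  unfolding dv_def using leq_times_add_one by auto

lemma dv_times: "dv (a \<oplus> \<one>) b \<Longrightarrow> dv (a \<oplus> \<one>) (b \<otimes> c)"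
  unfolding dv_iff by (metis mult_assoc mult_commute)

lemma dv_diff: "dv (a \<oplus> \<one>) (b \<oplus> c) \<Longrightarrow> dv (a \<oplus> \<one>) b \<Longrightarrow> dv (a \<oplus> \<one>) c"
  unfolding dv_iff by (metis add_diff_cancel_left' left_diff_distrib')

text \<open>A modulus \<open>u = m \<otimes> c \<oplus> \<one>\<close> can be cancelled against
  \<open>m\<close>: if it divides \<open>x \<otimes> m\<close>, it divides both
  \<open>x \<otimes> m \<otimes> c\<close> and \<open>x \<otimes> u\<close>, hence their difference
  \<open>x\<close>. The factor \<open>d \<oplus> \<one>\<close> is first completed to
  \<open>m\<close> by its cofactor and then cancelled the same way.\<close>

lemma dv_cancel:
  assumes dm: "dv (d \<oplus> \<one>) m" and dv: "dv (m \<otimes> c \<oplus> \<one>) (n \<otimes> (m \<otimes> (d \<oplus> \<one>)))"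
  shows "dv (m \<otimes> c \<oplus> \<one>) n"
proof -
  have cancel: "dv (m \<otimes> c \<oplus> \<one>) x" if "dv (m \<otimes> c \<oplus> \<one>) (x \<otimes> m)" for x
  proof (rule dv_diff)
    show "dv (m \<otimes> c \<oplus> \<one>) (x \<otimes> m \<otimes> c)" using that by (rule dv_times)
    have "x \<otimes> m \<otimes> c \<oplus> x = x \<otimes> (m \<otimes> c \<oplus> \<one>)" by (simp add: algebra_simps)
    then show "dv (m \<otimes> c \<oplus> \<one>) (x \<otimes> m \<otimes> c \<oplus> x)" unfolding dv_iff by blast
  qed
  from dm obtain d' where d': "m = d' \<otimes> (d \<oplus> \<one>)" unfolding dv_iff by blast
  have "dv (m \<otimes> c \<oplus> \<one>) (n \<otimes> (d \<oplus> \<one>) \<otimes> m)" using dv by (simp only: mult_ac)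
  then have "dv (m \<otimes> c \<oplus> \<one>) (n \<otimes> (d \<oplus> \<one>))" by (rule cancel)
  then have "dv (m \<otimes> c \<oplus> \<one>) (n \<otimes> (d \<oplus> \<one>) \<otimes> d')" by (rule dv_times)
  also have "n \<otimes> (d \<oplus> \<one>) \<otimes> d' = n \<otimes> m" by (simp only: d' mult_ac)
  finally show ?thesis by (rule cancel)
qed

text \<open>This is the coprimality of the moduli \<open>m (i + 1) + 1\<close>, in a form that needs no Bezout identity.\<close>

lemma dv_times_modulus_iff:
  assumes m: "\<forall>k. k \<prec> b \<longrightarrow> dv (k \<oplus> \<one>) m" and ij: "i \<prec> b" "j \<prec> b" "i \<noteq> j"
  shows "dv (m \<otimes> (i \<oplus> \<one>) \<oplus> \<one>) (n \<otimes> (m \<otimes> (j \<oplus> \<one>) \<oplus> \<one>)) \<longleftrightarrow> dv (m \<otimes> (i \<oplus> \<one>) \<oplus> \<one>) n"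
    (is "dv ?u (n \<otimes> ?v) \<longleftrightarrow> _")
proof
  assume uv: "dv ?u (n \<otimes> ?v)"
  have u: "dv ?u (n \<otimes> ?u)" unfolding dv_iff by blast
  consider d where "j = i \<oplus> d \<oplus> \<one>" | d where "i = j \<oplus> d \<oplus> \<one>"
    using less_linear[of i j] ij(3) unfolding less_iff by blast
  then show "dv ?u n"
  proof cases
    case 1
    have "d \<oplus> \<one> \<preceq> j" unfolding 1 by (simp add: leq_iff add_ac) (metis add_ac)
    then have "dv (d \<oplus> \<one>) m" using m ij(2) by (metis less_iff_add_one_leq less_trans leq_def)
    \<comment> \<open>The two moduli differ by \<open>m \<otimes> (d \<oplus> \<one>)\<close>, and
      \<open>d \<oplus> \<one>\<close> divides \<open>m\<close> because \<open>d\<close> is below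
      \<open>b\<close>; this is the situation of \<open>dv_cancel\<close>.\<close>
    moreover have "dv ?u (n \<otimes> (m \<otimes> (d \<oplus> \<one>)))"
    proof (rule dv_diff[OF _ u])
      have "n \<otimes> ?u \<oplus> n \<otimes> (m \<otimes> (d \<oplus> \<one>)) = n \<otimes> ?v" by (simp add: 1 algebra_simps)
      then show "dv ?u (n \<otimes> ?u \<oplus> n \<otimes> (m \<otimes> (d \<oplus> \<one>)))" using uv by simp
    qed
    ultimately show ?thesis by (rule dv_cancel)
  next
    case 2
    have "d \<oplus> \<one> \<preceq> i" unfolding 2 by (simp add: leq_iff add_ac) (metis add_ac)
    then have "dv (d \<oplus> \<one>) m" using m ij(1) by (metis less_iff_add_one_leq less_trans leq_def)
    moreover have "dv ?u (n \<otimes> (m \<otimes> (d \<oplus> \<one>)))"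
    proof (rule dv_diff[OF _ uv])
      have "n \<otimes> ?v \<oplus> n \<otimes> (m \<otimes> (d \<oplus> \<one>)) = n \<otimes> ?u" by (simp add: 2 algebra_simps)
      then show "dv ?u (n \<otimes> ?v \<oplus> n \<otimes> (m \<otimes> (d \<oplus> \<one>)))" using u by simp
    qed
    ultimately show ?thesis by (rule dv_cancel)
  qed
qed (rule dv_times)

text \<open>The role of the factorial, built up one factor at a time; recursion becomes available
  only after finite sets can be coded.\<close>

lemma ex_common_multiple: "\<exists>m. m \<noteq> \<zero> \<and> (\<forall>k. k \<prec> b \<longrightarrow> dv (k \<oplus> \<one>) m)"
proof (rule isS_induct[where P = "\<lambda>b. \<exists>m. m \<noteq> \<zero> \<and> (\<forall>k. k \<prec> b \<longrightarrow> dv (k \<oplus> \<one>) m)"])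
  show "isS (\<lambda>\<sigma>. \<exists>m. m \<noteq> \<zero> \<and> (\<forall>k. k \<prec> \<sigma> 0 \<longrightarrow> dv (k \<oplus> \<one>) m))"
    by (intro isS_ex dfn)
  show "\<exists>m. m \<noteq> \<zero> \<and> (\<forall>k. k \<prec> b \<oplus> \<one> \<longrightarrow> dv (k \<oplus> \<one>) m)"
    if IH: "\<exists>m. m \<noteq> \<zero> \<and> (\<forall>k. k \<prec> b \<longrightarrow> dv (k \<oplus> \<one>) m)" for b
  proof -
    obtain m where m: "m \<noteq> \<zero>" "\<And>k. k \<prec> b \<Longrightarrow> dv (k \<oplus> \<one>) m" using IH by blast
    have "dv (k \<oplus> \<one>) (m \<otimes> (b \<oplus> \<one>))" if "k \<prec> b \<oplus> \<one>" for k
    proof (cases "k = b")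
      case True
      then show ?thesis unfolding dv_iff by blast
    next
      case False
      then show ?thesis using that m(2) by (simp add: less_add_one_iff dv_times)
    qed
    moreover have "m \<otimes> (b \<oplus> \<one>) \<noteq> \<zero>" using m(1) by (intro no_zero_divisors) simp_all
    ultimately show ?thesis by blast
  qed
qed (auto intro: exI[of _ \<one>] zero_neq_one[symmetric])

text \<open>Divisibility by the moduli \<open>m (i + 1) + 1\<close> codes the set; the component \<open>b\<close> keeps accidental
  divisors beyond the intended range out of it.\<close>

definition elt :: "'a \<Rightarrow> 'a \<Rightarrow> bool" where
  "elt i w \<longleftrightarrow> (\<exists>b. b \<preceq> w \<and> (\<exists>m. m \<preceq> w \<and> (\<exists>n. n \<preceq> w \<and>
    (w = pr b (pr m n) \<and> i \<prec> b \<and> dv (m \<otimes> (i \<oplus> \<one>) \<oplus> \<one>) n))))"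

lemma isD_elt [dfn]:
  assumes "isT f" "isT g"
  shows "isD (\<lambda>\<sigma>. elt (f \<sigma>) (g \<sigma>))"
  unfolding elt_def by (intro dfn isT_rename[OF assms(1)] isT_rename[OF assms(2)] assms)

lemma elt_pr: "elt i (pr b (pr m n)) \<longleftrightarrow> i \<prec> b \<and> dv (m \<otimes> (i \<oplus> \<one>) \<oplus> \<one>) n"
proof -
  have "m \<preceq> pr b (pr m n)" "n \<preceq> pr b (pr m n)"
    using leq_trans[OF leq_pr1 leq_pr2] leq_trans[OF leq_pr2 leq_pr2] by auto
  then show ?thesis unfolding elt_def by auto
qed

lemma elt_less: "elt i w \<Longrightarrow> i \<prec> w"
  unfolding elt_def by (auto intro: less_le_trans)

text \<open>Starting from 1, the modulus of \<open>c\<close> is multiplied in whenever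
  \<open>c \<in> A\<close>. Coprimality of the moduli leaves membership of the other numbers
  unchanged.\<close>

lemma ex_code_set:
  assumes A: "A \<in> sets"
  shows "\<exists>w. \<forall>i. elt i w \<longleftrightarrow> i \<prec> b \<and> i \<in> A"
proof -
  obtain m where m: "m \<noteq> \<zero>" "\<forall>k. k \<prec> b \<longrightarrow> dv (k \<oplus> \<one>) m" using ex_common_multiple by blast
  let ?P = "\<lambda>c. \<exists>n. c \<preceq> b \<longrightarrow> (\<forall>i. i \<prec> b \<longrightarrow> (dv (m \<otimes> (i \<oplus> \<one>) \<oplus> \<one>) n \<longleftrightarrow> i \<prec> c \<and> i \<in> A))"
  have "?P b"
  proof (rule isS_induct[where P = ?P])
    show "isS (\<lambda>\<sigma>. \<exists>n. \<sigma> 0 \<preceq> b \<longrightarrow>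
        (\<forall>i. i \<prec> b \<longrightarrow> (dv (m \<otimes> (i \<oplus> \<one>) \<oplus> \<one>) n \<longleftrightarrow> i \<prec> \<sigma> 0 \<and> i \<in> A)))"
      by (intro isS_ex dfn A)
    \<comment> \<open>The empty product must code the empty set. This is where
      \<open>m \<noteq> \<zero>\<close> enters: otherwise all moduli would be 1 and divide
      everything.\<close>
    have "\<not> dv (m \<otimes> (i \<oplus> \<one>) \<oplus> \<one>) \<one>" for i
    proof
      assume "dv (m \<otimes> (i \<oplus> \<one>) \<oplus> \<one>) \<one>"
      then obtain q where q: "\<one> = q \<otimes> (m \<otimes> (i \<oplus> \<one>) \<oplus> \<one>)" unfolding dv_iff by blast
      then have "q \<noteq> \<zero>" by auto
      then obtain p where p: "q = p \<oplus> \<one>" using zero_or_add_one by blast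
      have "\<zero> \<oplus> \<one> = (p \<otimes> (m \<otimes> (i \<oplus> \<one>) \<oplus> \<one>) \<oplus> m \<otimes> (i \<oplus> \<one>)) \<oplus> \<one>"
        using q unfolding p by (simp add: algebra_simps)
      then have "\<zero> = p \<otimes> (m \<otimes> (i \<oplus> \<one>) \<oplus> \<one>) \<oplus> m \<otimes> (i \<oplus> \<one>)"
        by (simp only: add_one_inject)
      then have "m \<otimes> (i \<oplus> \<one>) = \<zero>"
        by (rule plus_eq_zeroD[OF sym])
      with m(1) show False using no_zero_divisors[of m "i \<oplus> \<one>"] by simp
    qed
    then show "?P \<zero>" by (intro exI[of _ \<one>]) simp
    show "?P (c \<oplus> \<one>)" if IH: "?P c" for c
    proof (cases "c \<prec> b")
      case False
      then show ?thesis by (auto simp: less_iff_add_one_leq)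
    next
      case True
      then have "c \<preceq> b" by (simp add: leq_def)
      with IH obtain n where n: "\<And>i. i \<prec> b \<Longrightarrow> dv (m \<otimes> (i \<oplus> \<one>) \<oplus> \<one>) n \<longleftrightarrow> i \<prec> c \<and> i \<in> A" by blast
      show ?thesis
      proof (cases "c \<in> A")
        case False
        then have "i \<prec> c \<oplus> \<one> \<and> i \<in> A \<longleftrightarrow> i \<prec> c \<and> i \<in> A" for i
          by (auto simp: less_add_one_iff)
        with n show ?thesis by (intro exI[of _ n]) simp
      next
        case cA: True
        have "dv (m \<otimes> (i \<oplus> \<one>) \<oplus> \<one>) (n \<otimes> (m \<otimes> (c \<oplus> \<one>) \<oplus> \<one>)) \<longleftrightarrow> i \<prec> c \<oplus> \<one> \<and> i \<in> A"
          if "i \<prec> b" for i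
        proof (cases "i = c")
          case True
          then show ?thesis using cA unfolding dv_iff by (auto simp: less_add_one_iff)
        next
          case False
          then show ?thesis
            using dv_times_modulus_iff[OF m(2) that True False] n[OF that] by (simp add: less_add_one_iff)
        qed
        then show ?thesis by blast
      qed
    qed
  qed
  then obtain n where "\<And>i. i \<prec> b \<Longrightarrow> dv (m \<otimes> (i \<oplus> \<one>) \<oplus> \<one>) n \<longleftrightarrow> i \<prec> b \<and> i \<in> A" by auto
  then show ?thesis by (intro exI[of _ "pr b (pr m n)"]) (auto simp: elt_pr)
qed

lemma ex_code:
  assumes "isD (\<lambda>\<sigma>. P (\<sigma> 0))" and "\<And>i. P i \<Longrightarrow> i \<prec> b"
  obtains w where "\<And>i. elt i w \<longleftrightarrow> P i"
  using ex_code_set[OF comprehension_D[OF assms(1)], of b] assms(2) by auto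

lemma ex_code_pairs:
  assumes D: "isD (\<lambda>\<sigma>. P (\<sigma> 0) (\<sigma> 1))" and bound: "\<And>x y. P x y \<Longrightarrow> pr x y \<prec> b"
  obtains w where "\<And>x y. elt (pr x y) w \<longleftrightarrow> P x y" "\<And>i. elt i w \<Longrightarrow> \<exists>x y. i = pr x y"
proof -
  let ?Q = "\<lambda>i. \<exists>x. x \<preceq> i \<and> (\<exists>y. y \<preceq> i \<and> (i = pr x y \<and> P x y))"
  have "isD (\<lambda>\<sigma>. P (\<sigma> 1) (\<sigma> 0))" using D by (rule isD_swap)
  then have "isD (\<lambda>\<sigma>. ?Q (\<sigma> 0))" by (intro dfn) simp
  then obtain w where "\<And>i. elt i w \<longleftrightarrow> ?Q i" by (rule ex_code[of ?Q b]) (auto intro: bound that)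
  then show thesis by (intro that[of w]) auto
qed

lemma isT_swap: "isT (\<lambda>\<sigma>. f (\<sigma> 0) (\<sigma> 1)) \<Longrightarrow> isT (\<lambda>\<sigma>. f (\<sigma> i) (\<sigma> j))"
  using isT_rename[of "\<lambda>\<sigma>. f (\<sigma> 0) (\<sigma> 1)" "\<lambda>n. if n = 0 then i else j"] by simp

lemma elt_pr_bounds:
  assumes "elt (pr x y) w"
  shows "x \<preceq> w" "y \<preceq> w"
proof -
  have "pr x y \<preceq> w" using elt_less[OF assms] by (rule less_imp_le)
  then show "x \<preceq> w" "y \<preceq> w" using leq_trans[OF leq_pr1] leq_trans[OF leq_pr2] by blast+
qed

subsection \<open>The pigeonhole principle\<close>

definition php_fails :: "'a \<Rightarrow> 'a \<Rightarrow> bool" where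
  "php_fails w n \<longleftrightarrow> (\<forall>k. k \<preceq> n \<longrightarrow> (\<exists>c. c \<prec> n \<and> elt (pr k c) w)) \<and>
    (\<forall>k. k \<preceq> n \<longrightarrow> (\<forall>l. l \<preceq> n \<longrightarrow> (\<forall>c. c \<prec> n \<longrightarrow> (elt (pr k c) w \<and> elt (pr l c) w \<longrightarrow> k = l))))"

text \<open>Drop the argument \<open>n \<oplus> \<one>\<close>, which is related to
  \<open>c0\<close>, and redirect to \<open>c0\<close> whatever was sent to \<open>n\<close>. By
  injectivity no remaining argument was sent to \<open>c0\<close> before.\<close>

lemma php_fails_pred:
  assumes "php_fails w (n \<oplus> \<one>)"
  shows "\<exists>v. php_fails v n"
proof -
  have le: "k \<preceq> n \<oplus> \<one>" if "k \<preceq> n" for k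
    using that by (simp add: less_imp_le less_add_one_iff_leq)
  have inj: "k = l" if "k \<preceq> n \<oplus> \<one>" "l \<preceq> n \<oplus> \<one>" "c \<preceq> n" "elt (pr k c) w" "elt (pr l c) w" for k l c
    using assms that unfolding php_fails_def less_add_one_iff_leq by blast
  have tot: "\<exists>c. c \<preceq> n \<and> elt (pr k c) w" if "k \<preceq> n \<oplus> \<one>" for k
    using assms that unfolding php_fails_def less_add_one_iff_leq by blast
  obtain c0 where c0: "c0 \<preceq> n" "elt (pr (n \<oplus> \<one>) c0) w"
    using tot[of "n \<oplus> \<one>"] by auto
  have nk: "k \<noteq> n \<oplus> \<one>" if "k \<preceq> n" for k
    using that by (metis less_add_one_iff_leq less_irrefl)
  let ?P = "\<lambda>k c. k \<preceq> n \<and> c \<prec> n \<and> (elt (pr k c) w \<or> elt (pr k n) w \<and> c = c0)"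
  obtain v where v: "\<And>k c. elt (pr k c) v \<longleftrightarrow> ?P k c"
  proof (rule ex_code_pairs[of ?P "pr n n"])
    show "isD (\<lambda>\<sigma>. ?P (\<sigma> 0) (\<sigma> 1))" by (intro dfn)
    show "pr k c \<prec> pr n n" if "?P k c" for k c using that by (intro pr_less_mono) auto
  qed (rule that)
  have "php_fails v n"
    unfolding php_fails_def
  proof (intro conjI allI impI)
    fix k assume k: "k \<preceq> n"
    obtain c where c: "c \<preceq> n" "elt (pr k c) w" using tot[OF le[OF k]] by blast
    show "\<exists>c. c \<prec> n \<and> elt (pr k c) v"
    proof (cases "c = n")
      case True
      have "c0 \<noteq> n"
      proof
        assume "c0 = n"
        then have "k = n \<oplus> \<one>" using inj[OF le[OF k] order.refl, of n] c c0 True by simp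
        then show False using nk[OF k] by simp
      qed
      with c0(1) have "c0 \<prec> n" by (simp add: leq_def)
      then show ?thesis using k c True v by blast
    next
      case False
      with c(1) have "c \<prec> n" by (simp add: leq_def)
      then show ?thesis using k c v by blast
    qed
  next
    fix k l c assume kl: "k \<preceq> n" "l \<preceq> n" "c \<prec> n" "elt (pr k c) v \<and> elt (pr l c) v"
    have no: "\<not> elt (pr k c0) w" if "k \<preceq> n" for k
      using inj[OF le[OF that] order.refl, of c0] c0 nk[OF that] by auto
    show "k = l"
    proof (cases "c = c0")
      case True
      then have "elt (pr k n) w" "elt (pr l n) w" using kl v no by auto
      then show ?thesis using inj[OF le[OF kl(1)] le[OF kl(2)]] by blast
    next
      case False
      then have "elt (pr k c) w" "elt (pr l c) w" using kl v by auto
      then show ?thesis using inj[OF le[OF kl(1)] le[OF kl(2)], of c] kl(3) by (simp add: leq_def)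
    qed
  qed
  then show ?thesis ..
qed

text \<open>Coding the relation by a number makes failure at \<open>n\<close> a
  \<open>\<Sigma>\<^sub>1\<close> statement, so there is a least failing \<open>n\<close>, which
  \<open>php_fails_pred\<close> refutes.\<close>

lemma pigeonhole:
  assumes D: "isD (\<lambda>\<sigma>. P (\<sigma> 0) (\<sigma> 1))"
    and tot: "\<And>k. k \<preceq> n \<Longrightarrow> \<exists>c. c \<prec> n \<and> P k c"
    and inj: "\<And>k l c. k \<preceq> n \<Longrightarrow> l \<preceq> n \<Longrightarrow> P k c \<Longrightarrow> P l c \<Longrightarrow> k = l"
  shows False
proof -
  let ?P = "\<lambda>k c. k \<preceq> n \<and> c \<prec> n \<and> P k c"
  obtain w where w: "\<And>k c. elt (pr k c) w \<longleftrightarrow> ?P k c"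
  proof (rule ex_code_pairs[of ?P "pr n n"])
    show "isD (\<lambda>\<sigma>. ?P (\<sigma> 0) (\<sigma> 1))" by (intro dfn D)
    show "pr k c \<prec> pr n n" if "?P k c" for k c using that by (intro pr_less_mono) auto
  qed (rule that)
  have "php_fails w n"
    unfolding php_fails_def
  proof (intro conjI allI impI)
    show "\<exists>c. c \<prec> n \<and> elt (pr k c) w" if "k \<preceq> n" for k
      using tot[OF that] that w by blast
    show "k = l" if "k \<preceq> n" "l \<preceq> n" "elt (pr k c) w \<and> elt (pr l c) w" for k l c
      using that(3) inj[OF that(1,2), of c] w by blast
  qed
  have "isD (\<lambda>\<sigma>. php_fails (\<sigma> 0) (\<sigma> 1))"
    unfolding php_fails_def by (intro dfn)
  then obtain y v where y: "php_fails v y" "\<And>z w. z \<prec> y \<Longrightarrow> \<not> php_fails w z"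
    using \<open>php_fails w n\<close> by (rule Sigma1_least) (rule that)
  have "y \<noteq> \<zero>"
    using y(1) unfolding php_fails_def by (metis not_less_zero zero_leq)
  then obtain z where "y = z \<oplus> \<one>" using zero_or_add_one by blast
  with y show False using php_fails_pred less_add_one_iff by blast
qed

subsection \<open>Primitive recursion\<close>

text \<open>\<open>hist w n\<close> says that \<open>w\<close> codes a computation history up to
  \<open>n\<close>. Histories exist by \<open>\<Sigma>\<^sub>1\<close> induction and agree with each
  other. Hence the graph and its complement are both \<open>\<Sigma>\<^sub>1\<close>: a history with
  another value at \<open>n\<close> refutes membership.\<close>

lemma primitive_recursion:
  assumes "isT (\<lambda>\<sigma>. f (\<sigma> 0) (\<sigma> 1))"
  obtains h where "h \<zero> = c" "\<And>n. h (n \<oplus> \<one>) = f n (h n)" "{p. \<exists>n. p = pr n (h n)} \<in> sets"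
proof -
  note f [dfn] = isT_swap[OF assms]
  define hist where "hist w n \<longleftrightarrow> elt (pr \<zero> c) w \<and>
    (\<forall>i. i \<prec> n \<longrightarrow> (\<forall>z. z \<preceq> w \<longrightarrow> (elt (pr i z) w \<longrightarrow> elt (pr (i \<oplus> \<one>) (f i z)) w))) \<and>
    (\<forall>i. i \<preceq> n \<longrightarrow> (\<forall>z. z \<preceq> w \<longrightarrow> (\<forall>z'. z' \<preceq> w \<longrightarrow> (elt (pr i z) w \<and> elt (pr i z') w \<longrightarrow> z = z'))))"
    for w n
  have hist_D: "isD (\<lambda>\<sigma>. hist (g \<sigma>) (k \<sigma>))" if "isT g" "isT k" for g k
    unfolding hist_def by (intro dfn isT_rename[OF that(1)] isT_rename[OF that(2)] that)
  have hist0: "elt (pr \<zero> c) w" if "hist w n" for w n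
    using that by (simp add: hist_def)
  have histS: "elt (pr (i \<oplus> \<one>) (f i z)) w" if "hist w n" "i \<prec> n" "elt (pr i z) w" for w n i z
    using that elt_pr_bounds[OF that(3)] unfolding hist_def by blast
  have histU: "z = z'" if "hist w n" "i \<preceq> n" "elt (pr i z) w" "elt (pr i z') w" for w n i z z'
    using that elt_pr_bounds[OF that(3)] elt_pr_bounds[OF that(4)] unfolding hist_def by blast
  have hist_agree: "i \<preceq> n \<longrightarrow> (\<exists>x. x \<preceq> w \<and> (elt (pr i x) w \<and> elt (pr i x) w'))"
    if h: "hist w n" "hist w' n" for w w' n i
  proof (rule isD_induct[where P = "\<lambda>i. i \<preceq> n \<longrightarrow> (\<exists>x. x \<preceq> w \<and> (elt (pr i x) w \<and> elt (pr i x) w'))"])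
    show "\<zero> \<preceq> n \<longrightarrow> (\<exists>x. x \<preceq> w \<and> (elt (pr \<zero> x) w \<and> elt (pr \<zero> x) w'))"
      using hist0[OF h(1)] hist0[OF h(2)] elt_pr_bounds by blast
    show "i \<oplus> \<one> \<preceq> n \<longrightarrow> (\<exists>x. x \<preceq> w \<and> (elt (pr (i \<oplus> \<one>) x) w \<and> elt (pr (i \<oplus> \<one>) x) w'))"
      if IH: "i \<preceq> n \<longrightarrow> (\<exists>x. x \<preceq> w \<and> (elt (pr i x) w \<and> elt (pr i x) w'))" for i
    proof
      assume "i \<oplus> \<one> \<preceq> n"
      then have i: "i \<prec> n" by (simp add: less_iff_add_one_leq)
      then obtain x where "elt (pr i x) w" "elt (pr i x) w'" using IH by (auto simp: leq_def)
      then have "elt (pr (i \<oplus> \<one>) (f i x)) w" "elt (pr (i \<oplus> \<one>) (f i x)) w'"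
        using histS h i by blast+
      then show "\<exists>x. x \<preceq> w \<and> (elt (pr (i \<oplus> \<one>) x) w \<and> elt (pr (i \<oplus> \<one>) x) w')"
        using elt_pr_bounds by blast
    qed
  qed (intro dfn)
  have uniq: "z = z'" if "hist w n" "elt (pr n z) w" "hist w' n" "elt (pr n z') w'" for w w' n z z'
    using hist_agree[OF that(1,3), of n] histU[OF that(1) _ that(2)] histU[OF that(3) _ that(4)] by force
  have ex: "\<exists>w. hist w n \<and> (\<exists>z. z \<preceq> w \<and> elt (pr n z) w)" for n
  proof (rule isS_induct[where P = "\<lambda>n. \<exists>w. hist w n \<and> (\<exists>z. z \<preceq> w \<and> elt (pr n z) w)"])
    show "isS (\<lambda>\<sigma>. \<exists>w. hist w (\<sigma> 0) \<and> (\<exists>z. z \<preceq> w \<and> elt (pr (\<sigma> 0) z) w))"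
      by (intro isS_ex dfn hist_D)
    let ?P = "\<lambda>i z. i = \<zero> \<and> z = c"
    obtain w where w: "\<And>i z. elt (pr i z) w \<longleftrightarrow> ?P i z"
    proof (rule ex_code_pairs[of ?P "pr \<zero> c \<oplus> \<one>"])
      show "isD (\<lambda>\<sigma>. ?P (\<sigma> 0) (\<sigma> 1))" by (intro dfn)
    qed (auto simp: less_add_one_iff intro: that)
    then have "hist w \<zero>" unfolding hist_def by auto
    then show "\<exists>w. hist w \<zero> \<and> (\<exists>z. z \<preceq> w \<and> elt (pr \<zero> z) w)"
      using hist0 elt_pr_bounds by blast
  next
    fix n assume "\<exists>w. hist w n \<and> (\<exists>z. z \<preceq> w \<and> elt (pr n z) w)"
    then obtain w z where w: "hist w n" "elt (pr n z) w" by blast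
    \<comment> \<open>A history up to \<open>n\<close> is unconstrained beyond \<open>n\<close>, so
      later entries are cut off before the value at \<open>n \<oplus> \<one>\<close> is
      added.\<close>
    let ?P = "\<lambda>i y. i \<preceq> n \<and> elt (pr i y) w \<or> i = n \<oplus> \<one> \<and> y = f n z"
    obtain v where v: "\<And>i y. elt (pr i y) v \<longleftrightarrow> ?P i y"
    proof (rule ex_code_pairs[of ?P "pr (n \<oplus> \<one>) (f n z) \<oplus> \<one> \<oplus> w"])
      show "isD (\<lambda>\<sigma>. ?P (\<sigma> 0) (\<sigma> 1))" by (intro dfn)
      show "pr i y \<prec> pr (n \<oplus> \<one>) (f n z) \<oplus> \<one> \<oplus> w" if "?P i y" for i y
        using that
      proof
        assume "i \<preceq> n \<and> elt (pr i y) w"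
        then have "pr i y \<prec> w" by (auto intro: elt_less)
        also have "w \<preceq> pr (n \<oplus> \<one>) (f n z) \<oplus> \<one> \<oplus> w" unfolding leq_iff by (metis add_commute)
        finally show ?thesis .
      next
        assume "i = n \<oplus> \<one> \<and> y = f n z"
        then have "pr i y \<prec> pr (n \<oplus> \<one>) (f n z) \<oplus> \<one>" by (simp add: less_add_one_iff)
        also have "\<dots> \<preceq> \<dots> \<oplus> w" by (rule leq_plus_iff)
        finally show ?thesis .
      qed
    qed (rule that)
    have neq: "i \<noteq> n \<oplus> \<one>" if "i \<preceq> n" for i
      using that by (metis less_add_one_iff_leq less_irrefl)
    have "hist v (n \<oplus> \<one>)"
      unfolding hist_def
    proof (intro conjI allI impI)
      show "elt (pr \<zero> c) v" using hist0[OF w(1)] v by simp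
    next
      fix i y assume i: "i \<prec> n \<oplus> \<one>" and "elt (pr i y) v"
      then have "i \<preceq> n" "elt (pr i y) w"
        using v neq by (auto simp: less_add_one_iff_leq)
      show "elt (pr (i \<oplus> \<one>) (f i y)) v"
      proof (cases "i = n")
        case True
        then have "y = z" using histU[OF w(1) \<open>i \<preceq> n\<close> \<open>elt (pr i y) w\<close>] w(2) by simp
        then show ?thesis using True v by simp
      next
        case False
        then have "i \<prec> n" using \<open>i \<preceq> n\<close> by (simp add: leq_def)
        then show ?thesis using histS[OF w(1) _ \<open>elt (pr i y) w\<close>] v by (simp add: less_iff_add_one_leq)
      qed
    next
      fix i y y' assume "elt (pr i y) v \<and> elt (pr i y') v"
      then show "y = y'" unfolding v using histU[OF w(1)] neq by blast
    qed
    moreover have "elt (pr (n \<oplus> \<one>) (f n z)) v" using v by simp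
    ultimately show "\<exists>w. hist w (n \<oplus> \<one>) \<and> (\<exists>z. z \<preceq> w \<and> elt (pr (n \<oplus> \<one>) z) w)"
      using elt_pr_bounds by blast
  qed
  then have "\<forall>n. \<exists>z. \<exists>w. hist w n \<and> elt (pr n z) w" by blast
  then obtain h where h: "\<And>n. \<exists>w. hist w n \<and> elt (pr n (h n)) w" by metis
  have graph: "z = h n \<longleftrightarrow> (\<exists>w. hist w n \<and> elt (pr n z) w)" for n z
    using h[of n] uniq by blast
  show thesis
  proof
    obtain w where "hist w \<zero>" using h by blast
    then show "h \<zero> = c" using graph[of c \<zero>] hist0 by blast
    show "h (n \<oplus> \<one>) = f n (h n)" for n
    proof -
      obtain w where w: "hist w (n \<oplus> \<one>)" using h by blast
      obtain w' where w': "hist w' n" "elt (pr n (h n)) w'" using h by blast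
      have "n \<prec> n \<oplus> \<one>" by (simp add: less_add_one_iff)
      have "hist w n"
        unfolding hist_def
      proof (intro conjI allI impI)
        show "elt (pr \<zero> c) w" by (rule hist0[OF w])
        show "elt (pr (i \<oplus> \<one>) (f i z)) w" if "i \<prec> n" "elt (pr i z) w" for i z
          by (rule histS[OF w less_trans[OF that(1) \<open>n \<prec> n \<oplus> \<one>\<close>] that(2)])
        show "z = z'" if "i \<preceq> n" "elt (pr i z) w \<and> elt (pr i z') w" for i z z'
          using histU[OF w leq_trans[OF that(1) less_imp_le[OF \<open>n \<prec> n \<oplus> \<one>\<close>]]] that(2) by blast
      qed
      then have "elt (pr n (h n)) w"
        using hist_agree[OF w'(1), of w n] histU[OF w'(1) _ w'(2)] by force
      then have "elt (pr (n \<oplus> \<one>) (f n (h n))) w"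
        by (rule histS[OF w \<open>n \<prec> n \<oplus> \<one>\<close>])
      then show ?thesis using graph[of "f n (h n)" "n \<oplus> \<one>"] w by auto
    qed
    let ?P = "\<lambda>p. \<exists>n. p = pr n (h n)"
    have P: "?P p \<longleftrightarrow> (\<exists>w. \<exists>n. n \<preceq> p \<and> (\<exists>z. z \<preceq> p \<and> (p = pr n z \<and> hist w n \<and> elt (pr n z) w)))" for p
    proof
      assume "?P p"
      then obtain n where p: "p = pr n (h n)" by blast
      obtain w where "hist w n" "elt (pr n (h n)) w" using h by blast
      then have "\<exists>n. n \<preceq> p \<and> (\<exists>z. z \<preceq> p \<and> (p = pr n z \<and> hist w n \<and> elt (pr n z) w))"
        unfolding p by (intro exI[of _ n] conjI exI[of _ "h n"]) auto
      then show "\<exists>w. \<exists>n. n \<preceq> p \<and> (\<exists>z. z \<preceq> p \<and> (p = pr n z \<and> hist w n \<and> elt (pr n z) w))" ..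
    next
      assume "\<exists>w. \<exists>n. n \<preceq> p \<and> (\<exists>z. z \<preceq> p \<and> (p = pr n z \<and> hist w n \<and> elt (pr n z) w))"
      then obtain w n z where z: "p = pr n z" "hist w n" "elt (pr n z) w" by (elim exE conjE) (rule that)
      then have "z = h n" using graph[of z n] by blast
      with z(1) show "?P p" by blast
    qed
    have nP: "\<not> ?P p \<longleftrightarrow> (\<exists>w. (\<forall>n. n \<preceq> p \<longrightarrow> (\<forall>z. z \<preceq> p \<longrightarrow> p \<noteq> pr n z)) \<or>
      (\<exists>n. n \<preceq> p \<and> (\<exists>z. z \<preceq> p \<and> (p = pr n z \<and> hist w n \<and> (\<exists>y. y \<preceq> w \<and> (y \<noteq> z \<and> elt (pr n y) w))))))" for p
    proof (cases "\<exists>n z. p = pr n z")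
      case False
      then show ?thesis by blast
    next
      case True
      then obtain n z where p: "p = pr n z" by blast
      have "\<not> ?P p \<longleftrightarrow> h n \<noteq> z" by (auto simp: p)
      also have "\<dots> \<longleftrightarrow> (\<exists>w. hist w n \<and> (\<exists>y. y \<preceq> w \<and> (y \<noteq> z \<and> elt (pr n y) w)))"
        using h[of n] graph elt_pr_bounds by metis
      also have "\<dots> \<longleftrightarrow> (\<exists>w. (\<forall>n. n \<preceq> p \<longrightarrow> (\<forall>z. z \<preceq> p \<longrightarrow> p \<noteq> pr n z)) \<or>
        (\<exists>n. n \<preceq> p \<and> (\<exists>z. z \<preceq> p \<and> (p = pr n z \<and> hist w n \<and> (\<exists>y. y \<preceq> w \<and> (y \<noteq> z \<and> elt (pr n y) w))))))"
        using leq_pr1[of n z] leq_pr2[of z n] unfolding p pr_eq_iff by blast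
      finally show ?thesis .
    qed
    show "{p. ?P p} \<in> sets"
    proof (rule comprehension)
      show "isS (\<lambda>\<sigma>. ?P (\<sigma> 0))" unfolding P by (intro isS_ex dfn hist_D)
      show "isS (\<lambda>\<sigma>. \<not> ?P (\<sigma> 0))" unfolding nP by (intro isS_ex dfn hist_D)
    qed
  qed
qed

subsection \<open>Computations\<close>

primrec nm :: "nat \<Rightarrow> 'a" where
  "nm 0 = \<zero>"
| "nm (Suc n) = nm n \<oplus> \<one>"

lemma nm_eq_iff [simp]: "nm m = nm n \<longleftrightarrow> m = n"
proof (induction m arbitrary: n)
  case 0
  show ?case by (cases n) (auto dest: sym)
next
  case (Suc m)
  then show ?case by (cases n) (auto simp: add_one_inject)
qed

text \<open>This and the following predicates copy the schemes of the object language clause by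
  clause, so that their agreement with satisfaction is a matter of unfolding.\<close>

definition betaM :: "'a \<Rightarrow> 'a \<Rightarrow> 'a \<Rightarrow> 'a \<Rightarrow> bool" where
  "betaM a b i z \<longleftrightarrow> z \<prec> (i \<oplus> \<one>) \<otimes> b \<oplus> \<one> \<and>
    (\<exists>q. q \<prec> a \<oplus> \<one> \<and> a = q \<otimes> ((i \<oplus> \<one>) \<otimes> b \<oplus> \<one>) \<oplus> z)"

lemma isD_betaM [dfn]:
  assumes "isT f" "isT g" "isT h" "isT k"
  shows "isD (\<lambda>\<sigma>. betaM (f \<sigma>) (g \<sigma>) (h \<sigma>) (k \<sigma>))"
  unfolding betaM_def by (intro dfn assms assms[THEN isT_rename])

lemma remainder_unique:
  assumes "q \<otimes> m \<oplus> z = q' \<otimes> m \<oplus> z'" "z \<prec> m" "z' \<prec> m"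
  shows "z = z'"
proof -
  have False if "q \<otimes> m \<oplus> z = q' \<otimes> m \<oplus> z'" "q \<prec> q'" "z \<prec> m" for q q' z z'
  proof -
    have "q \<otimes> m \<oplus> z \<prec> q \<otimes> m \<oplus> m" using that(3) by simp
    also have "\<dots> = (q \<oplus> \<one>) \<otimes> m" by (simp add: algebra_simps)
    also have "\<dots> \<preceq> q' \<otimes> m" using that(2) by (intro mult_right_mono) (simp_all add: less_iff_add_one_leq)
    also have "\<dots> \<preceq> q' \<otimes> m \<oplus> z'" by (rule leq_plus_iff)
    finally show False using that(1) by simp
  qed
  then have "q = q'" using less_linear[of q q'] assms by metis
  with assms(1) show ?thesis by simp
qed

lemma betaM_unique: "betaM a b i z \<Longrightarrow> betaM a b i z' \<Longrightarrow> z = z'"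
  unfolding betaM_def using remainder_unique by metis

lemma betaM_leq: "betaM a b i z \<Longrightarrow> z \<preceq> a"
  unfolding betaM_def leq_iff by (metis add_commute)

definition stepM :: "'a set \<Rightarrow> ('a \<Rightarrow> 'a \<Rightarrow> 'a \<Rightarrow> bool) \<Rightarrow> 'a \<Rightarrow> 'a \<Rightarrow> 'a \<Rightarrow> 'a \<Rightarrow> bool" where
  "stepM X D a c x y \<longleftrightarrow> (let E = \<lambda>P. \<exists>v. v \<prec> a \<oplus> \<one> \<and> P v in
      (c = pr (nm 0) (nm 0) \<and> y = nm 0)
    \<or> (c = pr (nm 1) (nm 0) \<and> y = x)
    \<or> (c = pr (nm 2) (nm 0) \<and> y = x \<oplus> \<one>)
    \<or> (c = pr (nm 3) (nm 0) \<and> E (\<lambda>v. x = pr y v))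
    \<or> (c = pr (nm 4) (nm 0) \<and> E (\<lambda>u. x = pr u y))
    \<or> (c = pr (nm 5) (nm 0) \<and> ((x \<in> X \<and> y = nm 1) \<or> (\<not> x \<in> X \<and> y = nm 0)))
    \<or> E (\<lambda>f. E (\<lambda>g. E (\<lambda>u. E (\<lambda>v.
        c = pr (nm 6) (pr f g) \<and> y = pr u v \<and> D f x u \<and> D g x v))))
    \<or> E (\<lambda>f. E (\<lambda>g. E (\<lambda>u.
        c = pr (nm 7) (pr f g) \<and> D g x u \<and> D f u y)))
    \<or> E (\<lambda>f. E (\<lambda>g. E (\<lambda>p.
        c = pr (nm 8) (pr f g) \<and> x = pr p (nm 0) \<and> D f p y)))
    \<or> E (\<lambda>f. E (\<lambda>g. E (\<lambda>p. E (\<lambda>m. E (\<lambda>u.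
        c = pr (nm 8) (pr f g) \<and> x = pr p (m \<oplus> \<one>) \<and> D c (pr p m) u \<and> D g (pr p (pr m u)) y)))))
    \<or> E (\<lambda>f. E (\<lambda>p.
        c = pr (nm 9) f \<and> x = pr p y \<and> D f x (nm 0)))
    \<or> E (\<lambda>f. E (\<lambda>p. E (\<lambda>m. E (\<lambda>u.
        c = pr (nm 9) f \<and> x = pr p m \<and> D f x (u \<oplus> \<one>) \<and> D c (pr p (m \<oplus> \<one>)) y)))))"

text \<open>The tag in \<open>c\<close> separates the clauses except for the two with tag 8, told
  apart by zero or a successor in the argument, and the two with tag 9, told apart by the recorded
  value of \<open>f\<close>, which \<open>det\<close> makes unique.\<close>

lemma stepM_deterministic:
  assumes det: "\<And>c u v v'. D c u v \<Longrightarrow> D' c u v' \<Longrightarrow> v = v'"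
    and s: "stepM X D a c x y" and s': "stepM X D' a' c x y'"
  shows "y = y'"
proof -
  have [simp]: "nm 0 \<noteq> u \<oplus> \<one>" "u \<oplus> \<one> \<noteq> nm 0" for u
    by (simp_all add: add_one_neq_zero[THEN not_sym])
  from s show ?thesis
    unfolding stepM_def Let_def
    by (elim disjE exE conjE; insert s'; unfold stepM_def Let_def;
      auto simp del: nm.simps One_nat_def simp: add_one_inject dest: det)
qed

lemma isD_stepM_betaM [dfn]:
  assumes "X \<in> sets" "isT f" "isT g" "isT h" "isT c" "isT x" "isT y"
  shows "isD (\<lambda>\<sigma>. stepM X (\<lambda>c' u' v'. \<exists>j. j \<prec> h \<sigma> \<and> betaM (f \<sigma>) (g \<sigma>) j (pr c' (pr u' v'))) (f \<sigma>) (c \<sigma>) (x \<sigma>) (y \<sigma>))"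
  unfolding stepM_def Let_def
  by (intro dfn assms assms(2-)[THEN isT_rename])

definition computation :: "'a set \<Rightarrow> 'a \<Rightarrow> 'a \<Rightarrow> 'a \<Rightarrow> bool" where
  "computation X a b n \<longleftrightarrow> (\<forall>i. i \<prec> n \<oplus> \<one> \<longrightarrow>
    (\<exists>c. c \<prec> a \<oplus> \<one> \<and> (\<exists>u. u \<prec> a \<oplus> \<one> \<and> (\<exists>v. v \<prec> a \<oplus> \<one> \<and>
      (betaM a b i (pr c (pr u v)) \<and>
       stepM X (\<lambda>c' u' v'. \<exists>j. j \<prec> i \<and> betaM a b j (pr c' (pr u' v'))) a c u v)))))"

lemma isD_computation [dfn]:
  assumes "X \<in> sets" "isT f" "isT g" "isT h"
  shows "isD (\<lambda>\<sigma>. computation X (f \<sigma>) (g \<sigma>) (h \<sigma>))"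
  unfolding computation_def
  by (intro dfn assms assms(2-)[THEN isT_rename])

lemma computation_step:
  assumes "computation X a b n" "i \<preceq> n" "betaM a b i (pr c (pr u v))"
  shows "stepM X (\<lambda>c' u' v'. \<exists>j. j \<prec> i \<and> betaM a b j (pr c' (pr u' v'))) a c u v"
proof -
  obtain c' u' v' where *: "betaM a b i (pr c' (pr u' v'))"
    "stepM X (\<lambda>c' u' v'. \<exists>j. j \<prec> i \<and> betaM a b j (pr c' (pr u' v'))) a c' u' v'"
    using assms(1,2) unfolding computation_def less_add_one_iff_leq by blast
  then show ?thesis using betaM_unique[OF *(1) assms(3)] by simp
qed

text \<open>Minimize the position in the first computation that conflicts with any position of the
  second. The premises of that step lie earlier and so conflict with nothing recorded in the second,
  whence both steps give the same value.\<close>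

lemma computation_deterministic:
  assumes comp: "computation X a b n" "computation X a' b' n'"
    and val: "betaM a b n (pr c (pr u v))" "betaM a' b' n' (pr c (pr u v'))"
  shows "v = v'"
proof (rule ccontr)
  \<comment> \<open>The bounds \<open>a\<close> and \<open>a'\<close> are available because every
    component of a recorded triple is at most the code of its sequence.\<close>
  let ?Q = "\<lambda>w i. i \<preceq> n \<and> (\<exists>j. j \<preceq> n' \<and> (\<exists>c. c \<preceq> a \<and> (\<exists>u. u \<preceq> a \<and> (\<exists>v. v \<preceq> a \<and> (\<exists>v'. v' \<preceq> a' \<and>
    (v \<noteq> v' \<and> betaM a b i (pr c (pr u v)) \<and> betaM a' b' j (pr c (pr u v'))))))))"
  have Q: "?Q w i" if "i \<preceq> n" "j \<preceq> n'" "v \<noteq> v'" "betaM a b i (pr c (pr u v))"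
    "betaM a' b' j (pr c (pr u v'))" for w i j c u v v'
  proof -
    have "c \<preceq> a" "u \<preceq> a" "v \<preceq> a" "v' \<preceq> a'"
      using betaM_leq[OF that(4)] betaM_leq[OF that(5)] leq_pr1 leq_pr2 leq_trans by metis+
    with that show ?thesis by blast
  qed
  assume "v \<noteq> v'"
  have "isD (\<lambda>\<sigma>. ?Q (\<sigma> 0) (\<sigma> 1))" by (intro dfn)
  moreover have "?Q \<zero> n" by (rule Q[OF order.refl order.refl \<open>v \<noteq> v'\<close> val])
  ultimately obtain i w where i: "?Q w i" and least: "\<And>z w. z \<prec> i \<Longrightarrow> \<not> ?Q w z"
    by (rule Sigma1_least[where Q = ?Q]) (rule that)
  from i obtain j c u v v' where *: "i \<preceq> n" "j \<preceq> n'" "v \<noteq> v'" "betaM a b i (pr c (pr u v))"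
    "betaM a' b' j (pr c (pr u v'))" by blast
  have "v = v'"
  proof (rule stepM_deterministic[OF _ computation_step[OF comp(1) *(1,4)] computation_step[OF comp(2) *(2,5)]])
    fix c u v v'
    assume "\<exists>i'. i' \<prec> i \<and> betaM a b i' (pr c (pr u v))" "\<exists>j'. j' \<prec> j \<and> betaM a' b' j' (pr c (pr u v'))"
    then obtain i' j' where ij: "i' \<prec> i" "j' \<prec> j" "betaM a b i' (pr c (pr u v))"
      "betaM a' b' j' (pr c (pr u v'))" by blast
    have "i' \<preceq> n" "j' \<preceq> n'" using ij(1,2) *(1,2) by (auto intro: less_imp_le less_le_trans)
    then show "v = v'" using Q[of i' j' v v' c u] least[OF ij(1)] ij(3,4) by blast
  qed
  with *(3) show False ..
qed

definition PhiM :: "'a set \<Rightarrow> 'a \<Rightarrow> 'a \<Rightarrow> 'a \<Rightarrow> bool" where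
  "PhiM X e x y \<longleftrightarrow> (\<exists>a b n. betaM a b n (pr e (pr x y)) \<and> computation X a b n)"

lemma UNIV_sets: "UNIV \<in> sets"
proof -
  have "{x. x = x} \<in> sets" by (rule comprehension_D) (intro dfn)
  then show ?thesis by simp
qed

text \<open>Positions \<open>k \<oplus> k\<close> and \<open>k \<oplus> k \<oplus> \<one>\<close> of
  a list form its pair number \<open>k\<close>; the bound here keeps both inside the list, and
  \<open>double_eqD\<close> recovers \<open>k\<close> from either.\<close>

lemma double_less: "k \<prec> l \<Longrightarrow> k \<oplus> k \<oplus> \<one> \<prec> l \<oplus> l"
proof -
  assume "k \<prec> l"
  then have "(k \<oplus> \<one>) \<oplus> (k \<oplus> \<one>) \<preceq> l \<oplus> l" by (intro add_mono) (simp_all add: less_iff_add_one_leq)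
  moreover have "k \<oplus> k \<oplus> \<one> \<prec> (k \<oplus> \<one>) \<oplus> (k \<oplus> \<one>)"
    unfolding less_iff by (rule exI[of _ \<zero>]) (simp add: add_ac)
  ultimately show ?thesis by simp
qed

lemma double_eqD: "a = k \<oplus> k \<or> a = k \<oplus> k \<oplus> \<one> \<Longrightarrow> a = l \<oplus> l \<or> a = l \<oplus> l \<oplus> \<one> \<Longrightarrow> k = l"
proof -
  have *: False if "k \<prec> l" "a = k \<oplus> k \<or> a = k \<oplus> k \<oplus> \<one>" "a = l \<oplus> l \<or> a = l \<oplus> l \<oplus> \<one>" for k l
  proof -
    have "a \<preceq> k \<oplus> k \<oplus> \<one>" using that(2) leq_plus_iff by auto
    also have "\<dots> \<prec> l \<oplus> l" using that(1) by (rule double_less)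
    also have "l \<oplus> l \<preceq> a" using that(3) leq_plus_iff by auto
    finally show False by simp
  qed
  assume "a = k \<oplus> k \<or> a = k \<oplus> k \<oplus> \<one>" "a = l \<oplus> l \<or> a = l \<oplus> l \<oplus> \<one>"
  then show ?thesis using *[of k l] *[of l k] less_linear[of k l] by blast
qed

subsection \<open>Lists\<close>

text \<open>A list is coded by the set of the pairs \<open>\<langle>position, entry\<rangle>\<close>.\<close>

definition list_code :: "'a set \<Rightarrow> 'a \<Rightarrow> 'a \<Rightarrow> 'a \<Rightarrow> bool" where
  "list_code R e n w \<longleftrightarrow> (\<forall>k. k \<prec> n \<longrightarrow> (\<exists>x. x \<preceq> w \<and> elt (pr k x) w)) \<and>
    (\<forall>k. k \<preceq> w \<longrightarrow> (\<forall>x. x \<preceq> w \<longrightarrow> (elt (pr k x) w \<longrightarrow> k \<prec> n \<and> e \<preceq> x \<and> x \<in> R))) \<and>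
    (\<forall>k. k \<preceq> w \<longrightarrow> (\<forall>x. x \<preceq> w \<longrightarrow> (\<forall>l. l \<preceq> w \<longrightarrow> (\<forall>y. y \<preceq> w \<longrightarrow>
      (elt (pr k x) w \<and> elt (pr l y) w \<longrightarrow> (k = l \<longrightarrow> x = y) \<and> (k \<prec> l \<longrightarrow> x \<prec> y))))))"

lemma isD_list_code [dfn]:
  assumes "R \<in> sets" "isT f" "isT g" "isT h"
  shows "isD (\<lambda>\<sigma>. list_code R (f \<sigma>) (g \<sigma>) (h \<sigma>))"
  unfolding list_code_def by (intro dfn assms assms(2-)[THEN isT_rename])

lemma list_codeI:
  assumes "\<And>k. k \<prec> n \<Longrightarrow> \<exists>x. elt (pr k x) w"
    and "\<And>k x. elt (pr k x) w \<Longrightarrow> k \<prec> n \<and> e \<preceq> x \<and> x \<in> R"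
    and "\<And>k x y. elt (pr k x) w \<Longrightarrow> elt (pr k y) w \<Longrightarrow> x = y"
    and "\<And>k x l y. elt (pr k x) w \<Longrightarrow> elt (pr l y) w \<Longrightarrow> k \<prec> l \<Longrightarrow> x \<prec> y"
  shows "list_code R e n w"
  unfolding list_code_def
proof (intro conjI allI impI)
  fix k assume "k \<prec> n"
  then show "\<exists>x. x \<preceq> w \<and> elt (pr k x) w" using assms(1) elt_pr_bounds(2) by metis
qed (use assms(2-) in auto)

lemma list_codeD:
  assumes "list_code R e n w"
  shows "k \<prec> n \<Longrightarrow> \<exists>x. elt (pr k x) w"
    and "elt (pr k x) w \<Longrightarrow> k \<prec> n" and "elt (pr k x) w \<Longrightarrow> e \<preceq> x" and "elt (pr k x) w \<Longrightarrow> x \<in> R"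
    and "elt (pr k x) w \<Longrightarrow> elt (pr k y) w \<Longrightarrow> x = y"
    and "elt (pr k x) w \<Longrightarrow> elt (pr l y) w \<Longrightarrow> k \<prec> l \<Longrightarrow> x \<prec> y"
  using assms elt_pr_bounds[of k x w] elt_pr_bounds[of k y w] elt_pr_bounds[of l y w]
  unfolding list_code_def by simp_all blast+

lemma list_code_inject:
  assumes "list_code R e n w" "elt (pr k x) w" "elt (pr l x) w"
  shows "k = l"
  using list_codeD(6)[OF assms(1)] assms(2,3) less_linear[of k l] less_irrefl by metis

lemma list_code_mono: "list_code R e n w \<Longrightarrow> list_code UNIV e n w"
  by (rule list_codeI) (auto dest: list_codeD)

lemma ex_list_code:
  assumes R: "R \<in> sets" and inf: "\<And>x. \<exists>y. x \<prec> y \<and> y \<in> R"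
  shows "\<exists>w. list_code R e n w"
proof (rule isS_induct[where P = "\<lambda>n. \<exists>w. list_code R e n w"])
  show "isS (\<lambda>\<sigma>. \<exists>w. list_code R e (\<sigma> 0) w)" by (intro isS_ex dfn R)
  obtain w where "\<And>i. elt i w \<longleftrightarrow> False"
    by (rule ex_code[of "\<lambda>_. False" \<zero>]) (intro dfn, simp, rule that)
  then show "\<exists>w. list_code R e \<zero> w" by (intro exI[of _ w] list_codeI) auto
next
  fix n assume "\<exists>w. list_code R e n w"
  then obtain w where w: "list_code R e n w" ..
  \<comment> \<open>Entries are bounded by the code of the list, so an element of \<open>R\<close>
    above \<open>w \<oplus> e\<close> exceeds all of them as well as \<open>e\<close>.\<close>
  obtain x where x: "w \<oplus> e \<prec> x" "x \<in> R" using inf by blast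
  have "w \<prec> x" "e \<preceq> x"
  proof -
    have "w \<preceq> w \<oplus> e" by (rule leq_plus_iff)
    then show "w \<prec> x" using x(1) by (rule le_less_trans)
    have "e \<preceq> w \<oplus> e" unfolding leq_iff by (metis add_commute)
    then show "e \<preceq> x" using x(1) by (metis le_less_trans less_imp_le)
  qed
  let ?P = "\<lambda>k y. elt (pr k y) w \<or> k = n \<and> y = x"
  obtain v where v: "\<And>k y. elt (pr k y) v \<longleftrightarrow> ?P k y"
  proof (rule ex_code_pairs[of ?P "pr n x \<oplus> \<one> \<oplus> w"])
    show "isD (\<lambda>\<sigma>. ?P (\<sigma> 0) (\<sigma> 1))" by (intro dfn)
    show "pr k y \<prec> pr n x \<oplus> \<one> \<oplus> w" if "?P k y" for k y
      using that
    proof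
      assume "elt (pr k y) w"
      then have "pr k y \<prec> w" by (rule elt_less)
      also have "w \<preceq> pr n x \<oplus> \<one> \<oplus> w" unfolding leq_iff by (metis add_commute)
      finally show ?thesis .
    next
      assume "k = n \<and> y = x"
      then have "pr k y \<prec> pr n x \<oplus> \<one>" by (simp add: less_add_one_iff)
      also have "\<dots> \<preceq> \<dots> \<oplus> w" by (rule leq_plus_iff)
      finally show ?thesis .
    qed
  qed (rule that)
  have less_n: "k \<prec> n" if "elt (pr k y) w" for k y using list_codeD(2)[OF w that] .
  have less_x: "y \<prec> x" if "elt (pr k y) w" for k y
    using elt_pr_bounds(2)[OF that] \<open>w \<prec> x\<close> by (rule le_less_trans)
  have "list_code R e (n \<oplus> \<one>) v"
  proof (rule list_codeI, goal_cases)
    case (1 k)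
    then show ?case using list_codeD(1)[OF w, of k] v by (auto simp: less_add_one_iff)
  next
    case (2 k y)
    then show ?case
      using v list_codeD(2-4)[OF w, of k y] x(2) \<open>e \<preceq> x\<close> by (auto simp: less_add_one_iff)
  next
    case (3 k y z)
    then show ?case using v list_codeD(5)[OF w, of k y z] less_n less_irrefl by metis
  next
    case (4 k y l z)
    then show ?case using v list_codeD(6)[OF w, of k y l z] less_n less_x less_irrefl less_trans by metis
  qed
  then show "\<exists>w. list_code R e (n \<oplus> \<one>) w" ..
qed

subsection \<open>Sizes\<close>

text \<open>The guess at \<open>e\<close> is a list of length \<open>2 sz e\<close>.  The recursion makes \<open>sz e\<close> exceed every pair
  \<open>\<langle>i, l\<rangle>\<close> with \<open>i < e\<close> and \<open>l < 2 sz i\<close>, so that the guesses at smaller arguments cannot meet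
  all of \<open>sz e\<close> many disjoint pairs.\<close>

definition is_size :: "('a \<Rightarrow> 'a) \<Rightarrow> bool" where
  "is_size h \<longleftrightarrow> h \<zero> = \<one> \<and> (\<forall>n. h (n \<oplus> \<one>) = pr n (h n \<oplus> h n) \<oplus> \<one>) \<and> {p. \<exists>n. p = pr n (h n)} \<in> sets"

definition sz :: "'a \<Rightarrow> 'a" where "sz = (SOME h. is_size h)"

text \<open>\<open>sz\<close> is not a term of the language; bounded formulas refer to it through
  its graph, used as a set parameter.\<close>

definition szG :: "'a set" where "szG = {p. \<exists>n. p = pr n (sz n)}"

lemma is_size_sz: "is_size sz"
proof -
  have "isT (\<lambda>\<sigma>. pr (\<sigma> 0) (\<sigma> 1 \<oplus> \<sigma> 1) \<oplus> \<one>)" by (intro dfn)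
  then obtain h where "h \<zero> = \<one>" "\<And>n. h (n \<oplus> \<one>) = pr n (h n \<oplus> h n) \<oplus> \<one>" "{p. \<exists>n. p = pr n (h n)} \<in> sets"
    by (rule primitive_recursion[where f = "\<lambda>n z. pr n (z \<oplus> z) \<oplus> \<one>" and c = \<one>]) (rule that)
  then have "is_size h" by (simp add: is_size_def)
  then show ?thesis unfolding sz_def by (rule someI[where P = is_size])
qed

lemma sz_zero: "sz \<zero> = \<one>" and sz_add_one: "sz (n \<oplus> \<one>) = pr n (sz n \<oplus> sz n) \<oplus> \<one>"
  and szG_sets: "szG \<in> sets"
  using is_size_sz by (simp_all add: is_size_def szG_def)

lemma pr_szG: "pr n z \<in> szG \<longleftrightarrow> z = sz n"
  by (auto simp: szG_def)

lemma sz_mono: "m \<preceq> n \<Longrightarrow> sz m \<preceq> sz n"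
proof -
  \<comment> \<open>Passing through the graph turns the inequality into a
    \<open>\<Sigma>\<^sub>1\<close> statement about \<open>d\<close>, as induction requires.\<close>
  have "\<exists>z. pr (m \<oplus> d) z \<in> szG \<and> sz m \<preceq> z" for d
  proof (rule isS_induct[where P = "\<lambda>d. \<exists>z. pr (m \<oplus> d) z \<in> szG \<and> sz m \<preceq> z"])
    show "isS (\<lambda>\<sigma>. \<exists>z. pr (m \<oplus> \<sigma> 0) z \<in> szG \<and> sz m \<preceq> z)" by (intro isS_ex dfn szG_sets)
    show "\<exists>z. pr (m \<oplus> (d \<oplus> \<one>)) z \<in> szG \<and> sz m \<preceq> z" if "\<exists>z. pr (m \<oplus> d) z \<in> szG \<and> sz m \<preceq> z" for d
    proof -
      have "sz m \<preceq> sz (m \<oplus> d)" using that by (simp add: pr_szG)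
      also have "\<dots> \<preceq> sz (m \<oplus> d) \<oplus> sz (m \<oplus> d)" by (rule leq_plus_iff)
      also have "\<dots> \<preceq> pr (m \<oplus> d) (sz (m \<oplus> d) \<oplus> sz (m \<oplus> d))" by (rule leq_pr2)
      also have "\<dots> \<preceq> sz (m \<oplus> d \<oplus> \<one>)" unfolding sz_add_one by (rule leq_plus_iff)
      finally show ?thesis by (simp add: pr_szG plus_add_one)
    qed
  qed (simp add: pr_szG)
  then show "m \<preceq> n \<Longrightarrow> sz m \<preceq> sz n" by (auto simp: pr_szG leq_iff[of m])
qed

text \<open>The slot \<open>pr i l\<close> stands for position \<open>l\<close> in the list at
  \<open>i\<close>. Slots of smaller indices have codes below \<open>m\<close>, against
  \<open>m \<oplus> \<one>\<close> pairs at \<open>e\<close>, exactly the mismatch that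
  \<open>pigeonhole\<close> uses.\<close>

lemma ex_slot_bound:
  obtains m where "sz e = m \<oplus> \<one>" "\<And>i l. i \<prec> e \<Longrightarrow> l \<prec> sz i \<oplus> sz i \<Longrightarrow> pr i l \<prec> m"
proof (cases "e = \<zero>")
  case True
  then show thesis by (intro that[of \<zero>]) (simp_all add: sz_zero)
next
  case False
  then obtain d where e: "e = d \<oplus> \<one>" using zero_or_add_one by blast
  have "pr i l \<prec> pr d (sz d \<oplus> sz d)" if "i \<prec> e" "l \<prec> sz i \<oplus> sz i" for i l
  proof (rule pr_less_mono)
    show "i \<preceq> d" using that(1) by (simp add: e less_add_one_iff_leq)
    then have "sz i \<oplus> sz i \<preceq> sz d \<oplus> sz d" by (intro add_mono sz_mono)
    with that(2) show "l \<prec> sz d \<oplus> sz d" by (rule less_le_trans)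
  qed
  then show thesis using that[of "pr d (sz d \<oplus> sz d)"] by (simp add: e sz_add_one)
qed

text \<open>The bound \<open>n \<preceq> y\<close> keeps the property
  \<open>\<Delta>\<^sub>0\<close>. It is met because the last position of the list, which is at
  least \<open>sz e\<close>, occurs in its code; \<open>ex_good\<close> carries this out.\<close>

definition good :: "'a set \<Rightarrow> 'a \<Rightarrow> 'a \<Rightarrow> bool" where
  "good R e y \<longleftrightarrow> (\<exists>n. n \<preceq> y \<and> (pr e n \<in> szG \<and> list_code R e (n \<oplus> n) y))"

lemma isD_good [dfn]:
  assumes "R \<in> sets" "isT f" "isT g"
  shows "isD (\<lambda>\<sigma>. good R (f \<sigma>) (g \<sigma>))"
  unfolding good_def by (intro dfn szG_sets assms assms(2-)[THEN isT_rename])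

lemma good_list_code: "good R e y \<Longrightarrow> list_code R e (sz e \<oplus> sz e) y"
  by (auto simp: good_def pr_szG)

lemma good_UNIV: "good R e y \<Longrightarrow> good UNIV e y"
  unfolding good_def using list_code_mono by blast

lemma ex_good:
  assumes "R \<in> sets" "\<And>x. \<exists>y. x \<prec> y \<and> y \<in> R"
  shows "\<exists>y. good R e y"
proof -
  obtain y where y: "list_code R e (sz e \<oplus> sz e) y" using ex_list_code[OF assms] by blast
  obtain m where m: "sz e = m \<oplus> \<one>" by (rule ex_slot_bound)
  have "m \<oplus> m \<oplus> \<one> \<prec> sz e \<oplus> sz e" unfolding m by (rule double_less) (simp add: less_add_one_iff)
  then obtain x where "elt (pr (m \<oplus> m \<oplus> \<one>) x) y" using list_codeD(1)[OF y] by blast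
  then have "m \<oplus> m \<oplus> \<one> \<preceq> y" by (rule elt_pr_bounds)
  moreover have "sz e \<preceq> m \<oplus> m \<oplus> \<one>" unfolding m leq_iff by (rule exI[of _ m]) (simp add: add_ac)
  ultimately have "sz e \<preceq> y" by simp
  with y show ?thesis unfolding good_def by (auto simp: pr_szG)
qed

subsection \<open>The coloring\<close>

definition coloringM :: "'a set \<Rightarrow> bool" where
  "coloringM F \<longleftrightarrow> (\<forall>w. w \<in> F \<longrightarrow> (\<exists>x s z. x \<prec> s \<and> w = pr (pr x s) z)) \<and>
    (\<forall>x s. x \<prec> s \<longrightarrow> (\<exists>z. pr (pr x s) z \<in> F)) \<and>
    (\<forall>p z z'. pr p z \<in> F \<and> pr p z' \<in> F \<longrightarrow> z = z')"

definition two_boundedM :: "'a set \<Rightarrow> bool" where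
  "two_boundedM F \<longleftrightarrow> (\<forall>z p q r. pr p z \<in> F \<and> pr q z \<in> F \<and> pr r z \<in> F \<longrightarrow> p = q \<or> p = r \<or> q = r)"

definition same_colorM :: "'a set \<Rightarrow> 'a \<Rightarrow> 'a \<Rightarrow> 'a \<Rightarrow> bool" where
  "same_colorM F x y s \<longleftrightarrow> (\<exists>z. pr (pr x s) z \<in> F \<and> pr (pr y s) z \<in> F)"

definition rainbow_stableM :: "'a set \<Rightarrow> bool" where
  "rainbow_stableM F \<longleftrightarrow> (\<forall>x. (\<exists>y. \<not> y = x \<and> (\<exists>t. \<forall>s. t \<prec> s \<longrightarrow> same_colorM F x y s)) \<or>
    (\<exists>t. \<forall>s. t \<prec> s \<longrightarrow> \<not> (\<exists>y. \<not> y = x \<and> same_colorM F x y s)))"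

definition rainbowM :: "'a set \<Rightarrow> 'a set \<Rightarrow> bool" where
  "rainbowM F R \<longleftrightarrow> (\<forall>x s y t z. x \<in> R \<and> s \<in> R \<and> x \<prec> s \<and> y \<in> R \<and> t \<in> R \<and> y \<prec> t \<and>
    pr (pr x s) z \<in> F \<and> pr (pr y t) z \<in> F \<longrightarrow> x = y \<and> s = t)"

context
  fixes X assumes X: "X \<in> sets"
begin

text \<open>Bounding the value and its computation by the stage makes this
  \<open>\<Delta>\<^sub>0\<close>. Values that do not code a list of the prescribed kind are ignored
  altogether.\<close>

definition conv :: "'a \<Rightarrow> 'a \<Rightarrow> 'a \<Rightarrow> bool" where
  "conv e y s \<longleftrightarrow> y \<prec> s \<and> good UNIV e y \<and> (\<exists>a. a \<prec> s \<and> (\<exists>b. b \<prec> s \<and> (\<exists>n. n \<prec> s \<and>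
    (betaM a b n (pr e (pr e y)) \<and> computation X a b n))))"

definition occ :: "'a \<Rightarrow> 'a \<Rightarrow> 'a \<Rightarrow> bool" where
  "occ e s x \<longleftrightarrow> (\<exists>y. y \<prec> s \<and> (conv e y s \<and> (\<exists>k. k \<preceq> y \<and> elt (pr k x) y)))"

text \<open>Smaller indices have priority: a pair is lost to \<open>e\<close> as soon as one of them
  lists a member of it.\<close>

definition free :: "'a \<Rightarrow> 'a \<Rightarrow> 'a \<Rightarrow> bool" where
  "free e s x \<longleftrightarrow> (\<forall>i. i \<prec> e \<longrightarrow> \<not> occ i s x)"

definition cand :: "'a \<Rightarrow> 'a \<Rightarrow> 'a \<Rightarrow> 'a \<Rightarrow> 'a \<Rightarrow> bool" where
  "cand e s k x z \<longleftrightarrow> (\<exists>y. y \<prec> s \<and> (conv e y s \<and> elt (pr (k \<oplus> k) x) y \<and> elt (pr (k \<oplus> k \<oplus> \<one>) z) y \<and>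
    free e s x \<and> free e s z))"

definition claim :: "'a \<Rightarrow> 'a \<Rightarrow> 'a \<Rightarrow> 'a \<Rightarrow> 'a \<Rightarrow> bool" where
  "claim e s k x z \<longleftrightarrow> cand e s k x z \<and> (\<forall>j. j \<prec> k \<longrightarrow> (\<forall>u. u \<prec> s \<longrightarrow> (\<forall>v. v \<prec> s \<longrightarrow> \<not> cand e s j u v)))"

text \<open>An index claiming the pair lists \<open>x\<close>, whence \<open>e \<preceq> x\<close>,
  and \<open>k\<close> is bounded by the code of a list found before stage \<open>s\<close>. So the
  bounds make the relation \<open>\<Delta>\<^sub>0\<close> and lose no claim, as
  \<open>claim_paired\<close> confirms.\<close>

definition paired :: "'a \<Rightarrow> 'a \<Rightarrow> 'a \<Rightarrow> bool" where
  "paired s x z \<longleftrightarrow> (\<exists>e. e \<preceq> x \<and> (\<exists>k. k \<prec> s \<and> claim e s k x z))"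

text \<open>The least member of the block of \<open>x\<close> at stage \<open>s\<close>, a block
  being a claimed pair or a singleton. Together with the stage it forms the color in
  \<open>col\<close>, so equal colors mean equal stages and equal blocks.\<close>

definition root :: "'a \<Rightarrow> 'a \<Rightarrow> 'a \<Rightarrow> bool" where
  "root s x r \<longleftrightarrow> r \<prec> x \<and> paired s r x \<or> r = x \<and> (\<forall>u. u \<prec> x \<longrightarrow> \<not> paired s u x)"

definition col :: "'a set" where
  "col = {w. \<exists>x. x \<preceq> w \<and> (\<exists>s. s \<preceq> w \<and> (\<exists>r. r \<preceq> w \<and> (w = pr (pr x s) (pr r s) \<and> x \<prec> s \<and> root s x r)))}"

lemma isD_conv [dfn]: "isT f \<Longrightarrow> isT g \<Longrightarrow> isT h \<Longrightarrow> isD (\<lambda>\<sigma>. conv (f \<sigma>) (g \<sigma>) (h \<sigma>))"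
  unfolding conv_def by (intro dfn X UNIV_sets; (assumption | erule isT_rename))

lemma isD_occ [dfn]: "isT f \<Longrightarrow> isT g \<Longrightarrow> isT h \<Longrightarrow> isD (\<lambda>\<sigma>. occ (f \<sigma>) (g \<sigma>) (h \<sigma>))"
  unfolding occ_def by (intro dfn; (assumption | erule isT_rename))

lemma isD_free [dfn]: "isT f \<Longrightarrow> isT g \<Longrightarrow> isT h \<Longrightarrow> isD (\<lambda>\<sigma>. free (f \<sigma>) (g \<sigma>) (h \<sigma>))"
  unfolding free_def by (intro dfn; (assumption | erule isT_rename))

lemma isD_cand [dfn]:
  "isT f \<Longrightarrow> isT g \<Longrightarrow> isT h \<Longrightarrow> isT k \<Longrightarrow> isT l \<Longrightarrow> isD (\<lambda>\<sigma>. cand (f \<sigma>) (g \<sigma>) (h \<sigma>) (k \<sigma>) (l \<sigma>))"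
  unfolding cand_def by (intro dfn; (assumption | erule isT_rename))

lemma isD_claim [dfn]:
  "isT f \<Longrightarrow> isT g \<Longrightarrow> isT h \<Longrightarrow> isT k \<Longrightarrow> isT l \<Longrightarrow> isD (\<lambda>\<sigma>. claim (f \<sigma>) (g \<sigma>) (h \<sigma>) (k \<sigma>) (l \<sigma>))"
  unfolding claim_def by (intro dfn; (assumption | erule isT_rename))

lemma isD_paired [dfn]: "isT f \<Longrightarrow> isT g \<Longrightarrow> isT h \<Longrightarrow> isD (\<lambda>\<sigma>. paired (f \<sigma>) (g \<sigma>) (h \<sigma>))"
  unfolding paired_def by (intro dfn; (assumption | erule isT_rename))

lemma isD_root [dfn]: "isT f \<Longrightarrow> isT g \<Longrightarrow> isT h \<Longrightarrow> isD (\<lambda>\<sigma>. root (f \<sigma>) (g \<sigma>) (h \<sigma>))"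
  unfolding root_def by (intro dfn; (assumption | erule isT_rename))

lemma col_sets: "col \<in> sets"
  unfolding col_def by (intro comprehension_D dfn)

section \<open>Candidates, claims and the disjointness of claimed pairs\<close>

lemma conv_unique: "conv e y s \<Longrightarrow> conv e y' s' \<Longrightarrow> y = y'"
  unfolding conv_def by (elim conjE exE) (rule computation_deterministic)

lemma conv_mono: "conv e y s \<Longrightarrow> s \<preceq> t \<Longrightarrow> conv e y t"
  unfolding conv_def by (meson less_le_trans)

lemma ex_conv: "PhiM X e e y \<Longrightarrow> good UNIV e y \<Longrightarrow> \<exists>s. conv e y s"
proof -
  assume y: "PhiM X e e y" "good UNIV e y"
  then obtain a b n where *: "betaM a b n (pr e (pr e y))" "computation X a b n"
    unfolding PhiM_def by blast
  define s where "s = a \<oplus> b \<oplus> n \<oplus> y \<oplus> \<one>"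
  have "s = a \<oplus> (b \<oplus> n \<oplus> y) \<oplus> \<one>" "s = b \<oplus> (a \<oplus> n \<oplus> y) \<oplus> \<one>"
    "s = n \<oplus> (a \<oplus> b \<oplus> y) \<oplus> \<one>" "s = y \<oplus> (a \<oplus> b \<oplus> n) \<oplus> \<one>"
    by (simp_all add: s_def add_ac)
  then have "a \<prec> s" "b \<prec> s" "n \<prec> s" "y \<prec> s" unfolding less_iff by blast+
  with * y(2) show ?thesis unfolding conv_def by blast
qed

lemma conv_list_code: "conv e y s \<Longrightarrow> list_code UNIV e (sz e \<oplus> sz e) y"
  unfolding conv_def using good_list_code by blast

lemma occI: "conv e y s \<Longrightarrow> elt (pr k x) y \<Longrightarrow> occ e s x"
  unfolding occ_def using elt_pr_bounds(1) conv_def by blast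

lemma occE:
  assumes "occ e s x"
  obtains y k where "conv e y s" "elt (pr k x) y"
  using assms unfolding occ_def by blast

lemma occ_leq: "occ e s x \<Longrightarrow> e \<preceq> x"
  by (elim occE) (rule list_codeD(3)[OF conv_list_code])

lemma occ_less: "occ e s x \<Longrightarrow> x \<prec> s"
  by (elim occE) (metis conv_def elt_pr_bounds(2) le_less_trans)

lemma occ_mono: "occ e s x \<Longrightarrow> s \<preceq> t \<Longrightarrow> occ e t x"
  by (elim occE) (blast intro: occI conv_mono)

lemma candI:
  "conv e y s \<Longrightarrow> elt (pr (k \<oplus> k) x) y \<Longrightarrow> elt (pr (k \<oplus> k \<oplus> \<one>) z) y \<Longrightarrow> free e s x \<Longrightarrow> free e s z \<Longrightarrow>
    cand e s k x z"
  unfolding cand_def conv_def by blast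

lemma candE:
  assumes "cand e s k x z"
  obtains y where "conv e y s" "elt (pr (k \<oplus> k) x) y" "elt (pr (k \<oplus> k \<oplus> \<one>) z) y" "free e s x" "free e s z"
  using assms unfolding cand_def by blast

lemma cand_occ: "cand e s k x z \<Longrightarrow> occ e s x" "cand e s k x z \<Longrightarrow> occ e s z"
  by (elim candE, erule occI, assumption)+

lemma cand_free: "cand e s k x z \<Longrightarrow> free e s x" "cand e s k x z \<Longrightarrow> free e s z"
  by (elim candE, assumption)+

lemma cand_less: "cand e s k x z \<Longrightarrow> x \<prec> z"
proof (elim candE)
  fix y assume y: "conv e y s" "elt (pr (k \<oplus> k) x) y" "elt (pr (k \<oplus> k \<oplus> \<one>) z) y"
  have "k \<oplus> k \<prec> k \<oplus> k \<oplus> \<one>" by (simp add: less_add_one_iff)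
  then show "x \<prec> z" by (rule list_codeD(6)[OF conv_list_code[OF y(1)] y(2,3)])
qed

lemma cand_unique: "cand e s k x z \<Longrightarrow> cand e t k u v \<Longrightarrow> x = u \<and> z = v"
  by (elim candE) (metis conv_unique conv_list_code list_codeD(5))

text \<open>The bound does not depend on the stage \<open>s\<close>, so it limits all positions that
  \<open>e\<close> can ever claim.\<close>

lemma cand_index: "cand e s k x z \<Longrightarrow> conv e y t \<Longrightarrow> k \<preceq> y"
proof (elim candE)
  fix y' assume "conv e y t" and y': "conv e y' s" "elt (pr (k \<oplus> k) x) y'"
  then have "y' = y" using conv_unique by blast
  have "k \<preceq> k \<oplus> k" by (rule leq_plus_iff)
  then show "k \<preceq> y" using elt_pr_bounds(1)[OF y'(2)] \<open>y' = y\<close> leq_trans by blast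
qed

text \<open>Lists accumulate with the stage, so a pair that is free later was free before. Once the
  list at \<open>e\<close> is present, candidates can only disappear.\<close>

lemma cand_antimono:
  assumes "cand e s k x z" "conv e y t" "t \<preceq> s"
  shows "cand e t k x z"
  using assms(1)
proof (elim candE)
  fix y' assume y': "conv e y' s" "elt (pr (k \<oplus> k) x) y'" "elt (pr (k \<oplus> k \<oplus> \<one>) z) y'" "free e s x" "free e s z"
  have "y' = y" using conv_unique[OF y'(1) assms(2)] .
  moreover have "free e t x" "free e t z"
    using y'(4,5) occ_mono[OF _ assms(3)] unfolding free_def by blast+
  ultimately show ?thesis using assms(2) y'(2,3) by (auto intro: candI)
qed

lemma claim_cand: "claim e s k x z \<Longrightarrow> cand e s k x z"
  by (simp add: claim_def)

lemma claim_least: "claim e s k x z \<Longrightarrow> cand e s j u v \<Longrightarrow> k \<preceq> j"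
proof (rule ccontr)
  assume *: "claim e s k x z" "cand e s j u v" "\<not> k \<preceq> j"
  have "u \<prec> s" "v \<prec> s" using cand_occ[OF *(2)] by (auto intro: occ_less)
  moreover have "j \<prec> k" using *(3) by simp
  ultimately show False using *(1,2) unfolding claim_def by blast
qed

lemma ex_claim:
  assumes "cand e s k x z"
  shows "\<exists>j u v. claim e s j u v"
proof -
  let ?Q = "\<lambda>w j. \<exists>u. u \<prec> s \<and> (\<exists>v. v \<prec> s \<and> cand e s j u v)"
  have "isD (\<lambda>\<sigma>. ?Q (\<sigma> 0) (\<sigma> 1))" by (intro dfn)
  moreover have "?Q \<zero> k" using assms cand_occ[OF assms] occ_less by blast
  ultimately obtain j w where "?Q w j" "\<And>i w. i \<prec> j \<Longrightarrow> \<not> ?Q w i"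
    by (rule Sigma1_least[where Q = ?Q]) (rule that)
  then show ?thesis unfolding claim_def by blast
qed

lemma claim_unique:
  assumes "claim e s k x z" "claim e s j u v"
  shows "k = j \<and> x = u \<and> z = v"
proof -
  have "k = j"
    using claim_least[OF assms(1) claim_cand[OF assms(2)]] claim_least[OF assms(2) claim_cand[OF assms(1)]]
    by (rule leq_antisym)
  then show ?thesis using cand_unique claim_cand assms by blast
qed

text \<open>A common member is listed at both indices by stage \<open>s\<close>, so it is not free
  for the larger of them.\<close>

lemma claim_overlap:
  assumes "claim e s k x z" "claim d s j u v" "x = u \<or> x = v \<or> z = u \<or> z = v"
  shows "e = d"
proof -
  obtain a where "a = x \<or> a = z" "a = u \<or> a = v" using assms(3) by blast
  then have a: "occ e s a" "free e s a" "occ d s a" "free d s a"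
    using cand_occ[OF claim_cand[OF assms(1)]] cand_free[OF claim_cand[OF assms(1)]]
      cand_occ[OF claim_cand[OF assms(2)]] cand_free[OF claim_cand[OF assms(2)]] by blast+
  then show ?thesis unfolding free_def using less_linear[of e d] by blast
qed

lemma claim_paired: "claim e s k x z \<Longrightarrow> paired s x z"
proof -
  assume c: "claim e s k x z"
  obtain y where "conv e y s" using claim_cand[OF c] by (rule candE)
  then have "k \<prec> s"
    using cand_index[OF claim_cand[OF c]] by (metis conv_def le_less_trans)
  then show ?thesis unfolding paired_def using occ_leq[OF cand_occ(1)[OF claim_cand[OF c]]] c by blast
qed

lemma paired_claim: "paired s x z \<Longrightarrow> \<exists>e k. claim e s k x z"
  unfolding paired_def by blast

lemma paired_less: "paired s x z \<Longrightarrow> x \<prec> z"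
  using paired_claim claim_cand cand_less by blast

lemma paired_less_stage: "paired s x z \<Longrightarrow> x \<prec> s \<and> z \<prec> s"
  using paired_claim claim_cand cand_occ occ_less by meson

lemma paired_overlap:
  assumes "paired s x z" "paired s u v" "x = u \<or> x = v \<or> z = u \<or> z = v"
  shows "x = u \<and> z = v"
proof -
  obtain e k d j where "claim e s k x z" "claim d s j u v" using assms(1,2) paired_claim by blast
  moreover from this have "e = d" using assms(3) by (rule claim_overlap)
  ultimately show ?thesis using claim_unique by blast
qed

lemma ex_root: "\<exists>r. root s x r"
  unfolding root_def by blast

lemma root_unique: "root s x r \<Longrightarrow> root s x q \<Longrightarrow> r = q"
  unfolding root_def using paired_overlap by blast

lemma root_eq: "root s x r \<Longrightarrow> root s y r \<Longrightarrow> x \<noteq> y \<Longrightarrow> paired s x y \<or> paired s y x"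
  unfolding root_def using paired_overlap by blast

lemma paired_root:
  assumes "paired s x y"
  shows "root s x x" "root s y x"
proof -
  show "root s x x"
    unfolding root_def using paired_overlap[OF assms] less_irrefl by blast
  show "root s y x" unfolding root_def using assms paired_less by blast
qed

lemma pr_col: "pr (pr x s) z \<in> col \<longleftrightarrow> x \<prec> s \<and> (\<exists>r. z = pr r s \<and> root s x r)"
proof
  assume "x \<prec> s \<and> (\<exists>r. z = pr r s \<and> root s x r)"
  then obtain r where r: "x \<prec> s" "z = pr r s" "root s x r" by blast
  have "x \<preceq> pr (pr x s) z" "s \<preceq> pr (pr x s) z" "r \<preceq> pr (pr x s) z"
    unfolding r(2) using leq_trans[OF leq_pr1 leq_pr1] leq_trans[OF leq_pr2 leq_pr1] leq_trans[OF leq_pr1 leq_pr2]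
    by blast+
  with r show "pr (pr x s) z \<in> col" unfolding col_def by blast
qed (auto simp: col_def)

lemma col_elem: "w \<in> col \<Longrightarrow> \<exists>x s r. w = pr (pr x s) (pr r s) \<and> x \<prec> s \<and> root s x r"
  unfolding col_def by blast

section \<open>The coloring satisfies the hypotheses of the principle\<close>

lemma coloringM_col: "coloringM col"
  unfolding coloringM_def
proof (intro conjI allI impI)
  show "\<exists>x s z. x \<prec> s \<and> w = pr (pr x s) z" if "w \<in> col" for w
    using col_elem[OF that] by blast
  show "\<exists>z. pr (pr x s) z \<in> col" if "x \<prec> s" for x s
    using ex_root[of s x] that unfolding pr_col by blast
  show "z = z'" if "pr p z \<in> col \<and> pr p z' \<in> col" for p z z'
    using that col_elem[of "pr p z"] by (auto simp: pr_col dest: root_unique)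
qed

text \<open>Equal colors share the stage and the root. Two distinct numbers with one root form a
  claimed pair, and a third would give a second pair overlapping it.\<close>

lemma two_boundedM_col: "two_boundedM col"
  unfolding two_boundedM_def
proof (intro allI impI)
  fix z p q r assume *: "pr p z \<in> col \<and> pr q z \<in> col \<and> pr r z \<in> col"
  obtain x s c where p: "p = pr x s" "z = pr c s" "root s x c" using col_elem * by fastforce
  obtain y where q: "q = pr y s" "root s y c" using col_elem[of "pr q z"] * p(2) by auto
  obtain u where r: "r = pr u s" "root s u c" using col_elem[of "pr r z"] * p(2) by auto
  show "p = q \<or> p = r \<or> q = r"
  proof (rule ccontr)
    assume "\<not> ?thesis"
    then have neq: "x \<noteq> y" "x \<noteq> u" "y \<noteq> u" using p q r by auto
    have "paired s x y \<or> paired s y x" "paired s x u \<or> paired s u x"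
      using root_eq[OF p(3) q(2) neq(1)] root_eq[OF p(3) r(2) neq(2)] by blast+
    then show False using paired_overlap neq by metis
  qed
qed

lemma same_colorM_col:
  assumes "x \<noteq> y"
  shows "same_colorM col x y s \<longleftrightarrow> paired s x y \<or> paired s y x"
proof
  assume "same_colorM col x y s"
  then obtain r where "root s x r" "root s y r" unfolding same_colorM_def pr_col by auto
  then show "paired s x y \<or> paired s y x" using assms by (rule root_eq)
next
  assume "paired s x y \<or> paired s y x"
  then have "x \<prec> s \<and> y \<prec> s \<and> (\<exists>r. root s x r \<and> root s y r)"
    using paired_root paired_less_stage by blast
  then show "same_colorM col x y s" unfolding same_colorM_def pr_col by blast
qed

text \<open>If \<open>x\<close> is ever listed, the least \<open>e\<close> that ever lists it is eventually the only one that can claim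
  a pair containing \<open>x\<close>.  The position of the pair claimed by \<open>e\<close> does not decrease with the stage
  and is bounded, so it is eventually constant unless \<open>e\<close> stops claiming pairs.\<close>

lemma rainbow_stableM_col: "rainbow_stableM col"
  unfolding rainbow_stableM_def
proof (rule allI)
  fix x
  let ?a = "\<exists>y. \<not> y = x \<and> (\<exists>t. \<forall>s. t \<prec> s \<longrightarrow> same_colorM col x y s)"
  let ?b = "\<exists>t. \<forall>s. t \<prec> s \<longrightarrow> \<not> (\<exists>y. \<not> y = x \<and> same_colorM col x y s)"
  have bI: ?b if "\<And>s y. t \<preceq> s \<Longrightarrow> paired s x y \<or> paired s y x \<Longrightarrow> False" for t
  proof (intro exI allI impI notI)
    fix s assume "t \<prec> s" "\<exists>y. \<not> y = x \<and> same_colorM col x y s"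
    then show False using that[of s] same_colorM_col less_imp_le by metis
  qed
  have involved: "\<exists>e k u v. claim e s k u v \<and> (x = u \<or> x = v)" if "paired s x y \<or> paired s y x" for s y
    using that paired_claim by blast
  show "?a \<or> ?b"
  proof (cases "\<exists>i s. occ i s x")
    case False
    have ?b
    proof (rule bI)
      fix s y assume "paired s x y \<or> paired s y x"
      then show False using involved claim_cand cand_occ False by metis
    qed
    then show ?thesis ..
  next
    case True
    then obtain i s where "occ i s x" by blast
    \<comment> \<open>Position 0 is the stage, acting as the witness; position 1 is the index to be
      minimized.\<close>
    have "isD (\<lambda>\<sigma>. occ (\<sigma> 1) (\<sigma> 0) x)" by (intro dfn)
    then obtain e t0 where e: "occ e t0 x" and least: "\<And>i s. i \<prec> e \<Longrightarrow> \<not> occ i s x"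
      using \<open>occ i s x\<close> by (rule Sigma1_least[where Q = "\<lambda>s i. occ i s x"]) (rule that)
    from e obtain y where y: "conv e y t0" by (rule occE)
    have only: "\<exists>k u v. claim e s k u v \<and> (x = u \<or> x = v)"
      if st: "t0 \<preceq> s" "paired s x z \<or> paired s z x" for s z
    proof -
      obtain d k u v where d: "claim d s k u v" "x = u \<or> x = v" using involved[OF st(2)] by blast
      then have "occ d s x" "free d s x"
        using cand_occ[OF claim_cand[OF d(1)]] cand_free[OF claim_cand[OF d(1)]] by auto
      then have "d = e"
        using occ_mono[OF e st(1)] least less_linear[of d e] unfolding free_def by blast
      with d show ?thesis by blast
    qed
    show ?thesis
    \<comment> \<open>If \<open>e\<close> has run out of candidates at some stage after its list
      appeared, it regains none later, by \<open>cand_antimono\<close>.\<close>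
    proof (cases "\<exists>t. t0 \<preceq> t \<and> (\<forall>k u v. \<not> cand e t k u v)")
      case True
      then obtain t where t: "t0 \<preceq> t" "\<And>k u v. \<not> cand e t k u v" by blast
      have ?b
      proof (rule bI)
        fix s z assume "t \<preceq> s" "paired s x z \<or> paired s z x"
        then obtain k u v where "claim e s k u v" using only leq_trans[OF t(1)] by blast
        then show False
          using cand_antimono[OF claim_cand conv_mono[OF y t(1)] \<open>t \<preceq> s\<close>] t(2) by blast
      qed
      then show ?thesis ..
    next
      case False
      then have ex: "\<exists>k u v. claim e s k u v" if "t0 \<preceq> s" for s
        using that ex_claim by blast
      let ?Q = "\<lambda>s k. t0 \<preceq> s \<and> (\<exists>u. u \<prec> s \<and> (\<exists>v. v \<prec> s \<and> claim e s k u v))"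
      have QI: "?Q s k" if "t0 \<preceq> s" "claim e s k u v" for s k u v
        using that paired_less_stage[OF claim_paired[OF that(2)]] by blast
      obtain k0 u0 v0 where "claim e t0 k0 u0 v0" using ex[OF order.refl] by blast
      then have Q0: "?Q t0 k0" by (rule QI[OF order.refl])
      \<comment> \<open>The limit position is the greatest one claimed at any stage from
        \<open>t0\<close> on: these positions form a \<open>\<Sigma>\<^sub>1\<close> set bounded by
        the code \<open>y\<close>.\<close>
      obtain k t1 where k: "?Q t1 k" and max: "\<And>s j. ?Q s j \<Longrightarrow> j \<preceq> k"
      proof (rule Sigma1_greatest[where Q = ?Q and b = y])
        show "isD (\<lambda>\<sigma>. ?Q (\<sigma> 0) (\<sigma> 1))" by (intro dfn)
        show "?Q t0 k0" by (rule Q0)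
        show "k \<preceq> y" if "?Q s k" for s k using that claim_cand cand_index[OF _ y] by blast
      qed (rule that)
      from k obtain u v where t1: "t0 \<preceq> t1" "claim e t1 k u v" by blast
      have const: "claim e s k u v" if "t1 \<preceq> s" for s
      proof -
        have "t0 \<preceq> s" using t1(1) that by (rule leq_trans)
        then obtain j u' v' where j: "claim e s j u' v'" using ex by blast
        \<comment> \<open>Read back at stage \<open>t1\<close>, the later candidate cannot precede
          the pair claimed there, so \<open>k \<preceq> j\<close>; maximality of \<open>k\<close>
          gives the converse.\<close>
        have "cand e t1 j u' v'"
          using cand_antimono[OF claim_cand[OF j] conv_mono[OF y t1(1)] that] .
        then have "k \<preceq> j" by (rule claim_least[OF t1(2)])
        moreover have "j \<preceq> k" using max[OF QI[OF \<open>t0 \<preceq> s\<close> j]] .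
        ultimately have "j = k" by (simp add: leq_antisym)
        moreover have "u' = u \<and> v' = v"
          using cand_unique[OF claim_cand[OF j[unfolded \<open>j = k\<close>]] claim_cand[OF t1(2)]] .
        ultimately show ?thesis using j by simp
      qed
      have uv: "u \<noteq> v" using cand_less[OF claim_cand[OF t1(2)]] less_irrefl by blast
      have same: "same_colorM col u v s" "same_colorM col v u s" if "t1 \<prec> s" for s
        using claim_paired[OF const[OF less_imp_le[OF that]]] same_colorM_col uv by auto
      consider "x = u" | "x = v" | "x \<noteq> u" "x \<noteq> v" by blast
      then show ?thesis
      proof cases
        case 1
        then have ?a using uv same(1) by (intro exI[of _ v]) auto
        then show ?thesis ..
      next
        case 2
        then have ?a using uv same(2) by (intro exI[of _ u]) auto
        then show ?thesis ..
      next
        case 3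
        have ?b
        proof (rule bI)
          fix s z assume s: "t1 \<preceq> s" "paired s x z \<or> paired s z x"
          then obtain j u' v' where "claim e s j u' v'" "x = u' \<or> x = v'"
            using only leq_trans[OF t1(1)] by blast
          then show False using claim_unique[OF _ const[OF s(1)]] 3 by blast
        qed
        then show ?thesis ..
      qed
    qed
  qed
qed

subsection \<open>Rainbows\<close>

text \<open>If every pair of the list is spoiled, send pair number \<open>k\<close> to a slot of a
  smaller index that holds one of its members. The slot determines the entry, the entry its position
  in \<open>y\<close>, and the position the number \<open>k\<close>, so this is injective into too
  few slots.\<close>

lemma ex_cand:
  assumes y: "conv e y s"
  shows "\<exists>k u v. cand e s k u v"
proof (rule ccontr)
  assume no: "\<not> ?thesis"
  note yl = conv_list_code[OF y]
  obtain m where m: "sz e = m \<oplus> \<one>" "\<And>i l. i \<prec> e \<Longrightarrow> l \<prec> sz i \<oplus> sz i \<Longrightarrow> pr i l \<prec> m"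
    by (rule ex_slot_bound) (rule that)
  \<comment> \<open>\<open>?P k c\<close> says that slot \<open>c\<close> spoils pair number
    \<open>k\<close>; the bounds \<open>c\<close>, \<open>y\<close> and \<open>s\<close> make it
    \<open>\<Delta>\<^sub>0\<close>, as \<open>pigeonhole\<close> demands.\<close>
  let ?P = "\<lambda>k c. \<exists>i. i \<preceq> c \<and> (\<exists>l. l \<preceq> c \<and> (c = pr i l \<and> i \<prec> e \<and> (\<exists>x. x \<preceq> y \<and>
    ((elt (pr (k \<oplus> k) x) y \<or> elt (pr (k \<oplus> k \<oplus> \<one>) x) y) \<and> (\<exists>z. z \<prec> s \<and> (conv i z s \<and> elt (pr l x) z))))))"
  show False
  proof (rule pigeonhole[of ?P m])
    show "isD (\<lambda>\<sigma>. ?P (\<sigma> 0) (\<sigma> 1))" by (intro dfn)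
  next
    fix k assume "k \<preceq> m"
    then have "k \<prec> sz e" by (simp add: m less_add_one_iff_leq)
    then have k1: "k \<oplus> k \<oplus> \<one> \<prec> sz e \<oplus> sz e" by (rule double_less)
    then have k0: "k \<oplus> k \<prec> sz e \<oplus> sz e" using less_add_one_iff less_trans by blast
    obtain u v where uv: "elt (pr (k \<oplus> k) u) y" "elt (pr (k \<oplus> k \<oplus> \<one>) v) y"
      using list_codeD(1)[OF yl k0] list_codeD(1)[OF yl k1] by blast
    have "\<not> free e s u \<or> \<not> free e s v" using candI[OF y uv] no by blast
    then obtain x where x: "elt (pr (k \<oplus> k) x) y \<or> elt (pr (k \<oplus> k \<oplus> \<one>) x) y" "\<not> free e s x" using uv by blast
    from x(2) obtain i where i: "i \<prec> e" "occ i s x" unfolding free_def by blast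
    from i(2) obtain z l where z: "conv i z s" "elt (pr l x) z" by (rule occE)
    have "l \<prec> sz i \<oplus> sz i" by (rule list_codeD(2)[OF conv_list_code[OF z(1)] z(2)])
    then have "pr i l \<prec> m" by (rule m(2)[OF i(1)])
    moreover have "x \<preceq> y" using x(1) elt_pr_bounds(2) by blast
    moreover have "z \<prec> s" using z(1) by (simp add: conv_def)
    ultimately show "\<exists>c. c \<prec> m \<and> ?P k c"
      using i(1) x(1) z leq_pr1[of i l] leq_pr2[of l i] by blast
  next
    fix k k' c assume "?P k c" "?P k' c"
    then obtain i l x z i' l' x' z' where
      *: "c = pr i l" "c = pr i' l'" "elt (pr (k \<oplus> k) x) y \<or> elt (pr (k \<oplus> k \<oplus> \<one>) x) y"
      "elt (pr (k' \<oplus> k') x') y \<or> elt (pr (k' \<oplus> k' \<oplus> \<one>) x') y" "conv i z s" "elt (pr l x) z"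
      "conv i' z' s" "elt (pr l' x') z'" by blast
    then have "i' = i" "l' = l" by auto
    then have "z' = z" using conv_unique *(5,7) by blast
    then have "x' = x"
      using list_codeD(5)[OF conv_list_code[OF *(5)]] *(6,8) \<open>l' = l\<close> by blast
    obtain a where a: "a = k \<oplus> k \<or> a = k \<oplus> k \<oplus> \<one>" "elt (pr a x) y" using *(3) by blast
    obtain a' where a': "a' = k' \<oplus> k' \<or> a' = k' \<oplus> k' \<oplus> \<one>" "elt (pr a' x) y" using *(4) \<open>x' = x\<close> by blast
    have "a' = a" by (rule list_code_inject[OF yl a'(2) a(2)])
    then show "k = k'" using double_eqD a(1) a'(1) by blast
  qed
qed

lemma rainbow_avoids:
  assumes inf: "\<And>x. \<exists>y. x \<prec> y \<and> y \<in> R" and rainbow: "rainbowM col R" and y: "good R e y"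
  shows "\<not> PhiM X e e y"
proof
  assume "PhiM X e e y"
  then obtain t where t: "conv e y t" using ex_conv good_UNIV[OF y] by blast
  \<comment> \<open>The stage is itself taken in \<open>R\<close>, because the colors given at stage
    \<open>s\<close> belong to pairs with upper element \<open>s\<close>.\<close>
  obtain s where s: "t \<prec> s" "s \<in> R" using inf by blast
  have "conv e y s" using conv_mono[OF t less_imp_le[OF s(1)]] .
  then obtain k u v where c: "claim e s k u v" using ex_cand ex_claim by metis
  obtain y' where y': "conv e y' s" "elt (pr (k \<oplus> k) u) y'" "elt (pr (k \<oplus> k \<oplus> \<one>) v) y'"
    using claim_cand[OF c] by (rule candE)
  have "y' = y" by (rule conv_unique[OF y'(1) t])
  then have R: "u \<in> R" "v \<in> R" using list_codeD(4)[OF good_list_code[OF y]] y'(2,3) by blast+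
  have p: "paired s u v" using c by (rule claim_paired)
  then have "pr (pr u s) (pr u s) \<in> col" "pr (pr v s) (pr u s) \<in> col"
    using paired_root[OF p] paired_less_stage[OF p] unfolding pr_col by blast+
  then have "u = v"
    using rainbow R s(2) paired_less_stage[OF p] unfolding rainbowM_def by blast
  then show False using paired_less[OF p] less_irrefl by blast
qed

end

section \<open>From a rainbow to a diagonally noncomputable function\<close>

lemma ex_diagonally_noncomputable:
  assumes SRRT: "\<And>F. F \<in> sets \<Longrightarrow> coloringM F \<Longrightarrow> two_boundedM F \<Longrightarrow> rainbow_stableM F \<Longrightarrow>
      \<exists>R\<in>sets. (\<forall>x. \<exists>y. x \<prec> y \<and> y \<in> R) \<and> rainbowM F R"
    and X: "X \<in> sets"
  shows "\<exists>G\<in>sets. (\<forall>w. w \<in> G \<longrightarrow> (\<exists>x y. w = pr x y)) \<and> (\<forall>x. \<exists>y. pr x y \<in> G) \<and>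
    (\<forall>x y y'. pr x y \<in> G \<and> pr x y' \<in> G \<longrightarrow> y = y') \<and> (\<forall>e y. pr e y \<in> G \<longrightarrow> \<not> PhiM X e e y)"
proof -
  obtain R where R: "R \<in> sets" "\<And>x. \<exists>y. x \<prec> y \<and> y \<in> R" "rainbowM (col X) R"
    using SRRT[OF col_sets coloringM_col two_boundedM_col rainbow_stableM_col] X by blast
  define G where "G = {p. \<exists>e. e \<preceq> p \<and> (\<exists>y. y \<preceq> p \<and> (p = pr e y \<and> good R e y \<and> (\<forall>z. z \<prec> y \<longrightarrow> \<not> good R e z)))}"
  have "G \<in> sets" unfolding G_def by (intro comprehension_D dfn R(1))
  moreover have G: "pr e y \<in> G \<longleftrightarrow> good R e y \<and> (\<forall>z. z \<prec> y \<longrightarrow> \<not> good R e z)" for e y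
    by (auto simp: G_def)
  have "\<exists>y. pr e y \<in> G" for e
  proof -
    have "isD (\<lambda>\<sigma>. good R e (\<sigma> 1))" by (intro dfn R(1))
    moreover obtain y0 where "good R e y0" using ex_good[OF R(1,2)] by blast
    ultimately obtain y w where "good R e y" "\<And>z w. z \<prec> y \<Longrightarrow> \<not> good R e z"
      by (rule Sigma1_least[where Q = "\<lambda>w y. good R e y"]) (rule that)
    then show ?thesis unfolding G by blast
  qed
  moreover have "y = y'" if "pr x y \<in> G" "pr x y' \<in> G" for x y y'
    using that less_linear[of y y'] unfolding G by blast
  moreover have "\<exists>x y. w = pr x y" if "w \<in> G" for w using that unfolding G_def by blast
  moreover have "\<not> PhiM X e e y" if "pr e y \<in> G" for e y
    using rainbow_avoids[OF X R(2,3)] that unfolding G by blast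
  ultimately show ?thesis by (intro bexI[of _ G]) blast+
qed

end

section \<open>Satisfaction of the named formulas\<close>

lemmas scheme_defs = eq_s_def less_s_def mem_s_def add_s_def mul_s_def pair_s_def suc_s_def

text \<open>Stated at arbitrary depths, so that named formulas unfold connective by connective and
  bound names become lookups in the assignment.\<close>

lemma sat_scheme:
  "sat M \<sigma> \<rho> ((\<^bold>\<not> P) d k) \<longleftrightarrow> \<not> sat M \<sigma> \<rho> (P d k)"
  "sat M \<sigma> \<rho> ((P \<^bold>\<and> Q) d k) \<longleftrightarrow> sat M \<sigma> \<rho> (P d k) \<and> sat M \<sigma> \<rho> (Q d k)"
  "sat M \<sigma> \<rho> ((P \<^bold>\<or> Q) d k) \<longleftrightarrow> sat M \<sigma> \<rho> (P d k) \<or> sat M \<sigma> \<rho> (Q d k)"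
  "sat M \<sigma> \<rho> ((P \<^bold>\<longrightarrow> Q) d k) \<longleftrightarrow> (sat M \<sigma> \<rho> (P d k) \<longrightarrow> sat M \<sigma> \<rho> (Q d k))"
  "sat M \<sigma> \<rho> (allN_s F d k) \<longleftrightarrow> (\<forall>x. sat M (case_nat x \<sigma>) \<rho> (F (\<lambda>d'. Var (d' - Suc d)) (Suc d) k))"
  "sat M \<sigma> \<rho> (exN_s F d k) \<longleftrightarrow> (\<exists>x. sat M (case_nat x \<sigma>) \<rho> (F (\<lambda>d'. Var (d' - Suc d)) (Suc d) k))"
  "sat M \<sigma> \<rho> (allS_s G d k) \<longleftrightarrow> (\<forall>A\<in>sets_of M. sat M \<sigma> (case_nat A \<rho>) (G (\<lambda>k'. k' - Suc k) d (Suc k)))"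
  "sat M \<sigma> \<rho> (exS_s G d k) \<longleftrightarrow> (\<exists>A\<in>sets_of M. sat M \<sigma> (case_nat A \<rho>) (G (\<lambda>k'. k' - Suc k) d (Suc k)))"
  "sat M \<sigma> \<rho> (all_below t F d k) \<longleftrightarrow> (\<forall>x. sat M (case_nat x \<sigma>) \<rho> (((\<lambda>d'. Var (d' - Suc d)) \<^bold>< t) (Suc d) k) \<longrightarrow>
    sat M (case_nat x \<sigma>) \<rho> (F (\<lambda>d'. Var (d' - Suc d)) (Suc d) k))"
  "sat M \<sigma> \<rho> (ex_below t F d k) \<longleftrightarrow> (\<exists>x. sat M (case_nat x \<sigma>) \<rho> (((\<lambda>d'. Var (d' - Suc d)) \<^bold>< t) (Suc d) k) \<and>
    sat M (case_nat x \<sigma>) \<rho> (F (\<lambda>d'. Var (d' - Suc d)) (Suc d) k))"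
  by (auto simp: neg_s_def conj_s_def disj_s_def imp_s_def allN_s_def exN_s_def allS_s_def exS_s_def
    all_below_def ex_below_def)

context rca_model
begin

lemma sat_coloring: "sat M \<sigma> \<rho> (coloring F d k) \<longleftrightarrow> coloringM (\<rho> (F k))"
  unfolding coloring_def sat_scheme coloringM_def by (simp add: scheme_defs pr_def)

lemma sat_two_bounded: "sat M \<sigma> \<rho> (two_bounded F d k) \<longleftrightarrow> two_boundedM (\<rho> (F k))"
  unfolding two_bounded_def sat_scheme two_boundedM_def by (simp add: scheme_defs pr_def)

lemma sat_rainbow_stable: "sat M \<sigma> \<rho> (rainbow_stable F d k) \<longleftrightarrow> rainbow_stableM (\<rho> (F k))"
  unfolding rainbow_stable_def same_color_def almost_all_def sat_scheme rainbow_stableM_def same_colorM_def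
  by (simp add: scheme_defs pr_def)

lemma sat_infinite_set:
  "sat M \<sigma> \<rho> (infinite_set R d k) \<longleftrightarrow> (\<forall>x. \<exists>y. x \<prec> y \<and> y \<in> \<rho> (R k))"
  unfolding infinite_set_def sat_scheme by (simp add: scheme_defs)

lemma sat_rainbow: "sat M \<sigma> \<rho> (rainbow F R d k) \<longleftrightarrow> rainbowM (\<rho> (F k)) (\<rho> (R k))"
  unfolding rainbow_def sat_scheme rainbowM_def by (simp add: scheme_defs pr_def)

lemma sat_total_function:
  "sat M \<sigma> \<rho> (total_function G d k) \<longleftrightarrow> (\<forall>w. w \<in> \<rho> (G k) \<longrightarrow> (\<exists>x y. w = pr x y)) \<and>
    (\<forall>x. \<exists>y. pr x y \<in> \<rho> (G k)) \<and> (\<forall>x y y'. pr x y \<in> \<rho> (G k) \<and> pr x y' \<in> \<rho> (G k) \<longrightarrow> y = y')"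
  unfolding total_function_def sat_scheme by (simp add: scheme_defs pr_def)

lemma val_numeral_s: "val M \<sigma> (numeral_s n d) = nm n"
  by (induction n) (simp_all add: add_s_def)

text \<open>Fixing the number depth at 0 makes every index in the deeply nested \<open>Phi\<close>
  concrete, so all lookups are resolved by computation.\<close>

lemma sat_diagonally_noncomputable:
  "sat M \<sigma> \<rho> (diagonally_noncomputable X G 0 k) \<longleftrightarrow>
    (\<forall>e y. pr e y \<in> \<rho> (G k) \<longrightarrow> \<not> PhiM (\<rho> (X k)) e e y)"
  by (simp only: diagonally_noncomputable_def Phi_def beta_def step_def Let_def sat_scheme scheme_defs
    PhiM_def computation_def stepM_def betaM_def sat.simps val.simps val_numeral_s
    diff_Suc_Suc minus_nat.diff_0 old.nat.case pr_def[symmetric])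

lemma sat_SRRT22:
  "sat M \<sigma> \<rho> SRRT22 \<longleftrightarrow> (\<forall>F\<in>sets. coloringM F \<and> two_boundedM F \<and> rainbow_stableM F \<longrightarrow>
    (\<exists>R\<in>sets. (\<forall>x. \<exists>y. x \<prec> y \<and> y \<in> R) \<and> rainbowM F R))"
  unfolding SRRT22_def sat_scheme sat_coloring sat_two_bounded sat_rainbow_stable sat_infinite_set
    sat_rainbow by simp

lemma sat_DNR:
  "sat M \<sigma> \<rho> DNR \<longleftrightarrow> (\<forall>X\<in>sets. \<exists>G\<in>sets. (\<forall>w. w \<in> G \<longrightarrow> (\<exists>x y. w = pr x y)) \<and>
    (\<forall>x. \<exists>y. pr x y \<in> G) \<and> (\<forall>x y y'. pr x y \<in> G \<and> pr x y' \<in> G \<longrightarrow> y = y') \<and>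
    (\<forall>e y. pr e y \<in> G \<longrightarrow> \<not> PhiM X e e y))"
  unfolding DNR_def sat_scheme sat_total_function sat_diagonally_noncomputable by simp

lemma sat_SRRT22_imp_DNR: "sat M \<sigma> \<rho> (Imp SRRT22 DNR)"
  unfolding sat.simps sat_SRRT22 sat_DNR
  by (intro impI ballI ex_diagonally_noncomputable) (simp, assumption)

end

theorem theorem5p11:
  shows "RCA0 \<turnstile> Imp SRRT22 DNR"
proof (rule RCA0_completeness)
  fix M :: "nat str"
  assume M: "\<forall>\<phi>\<in>RCA0. models M \<phi>"
  show "models M (Imp SRRT22 DNR)"
    unfolding models_def
  proof (intro allI impI)
    fix \<sigma> :: "nat \<Rightarrow> nat" and \<rho> :: "nat \<Rightarrow> nat set"
    assume "range \<rho> \<subseteq> sets_of M"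
    \<comment> \<open>The values of \<open>\<rho>\<close> themselves show that the model has a
      set.\<close>
    then interpret rca_model M using M by unfold_locales auto
    show "sat M \<sigma> \<rho> (Imp SRRT22 DNR)" by (rule sat_SRRT22_imp_DNR)
  qed
qed

end
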